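(* Let $d\ge1$ and $L\ge2$ be integers, let $0<\alpha<d$, and consider critical percolation ($\beta=\beta_c$) on the hierarchical lattice $\mathbb{H}^d_L$ with kernel $J(x,y)=\frac{L^{d+\alpha}}{L^{d+\alpha}-1}\|x-y\|^{-d-\alpha}$. If $d<3\alpha$ then $$M_n\asymp L^{\frac{d+\alpha}{2}n}$$ for every $n\ge0$.
   Context: Hierarchical lattice: $\mathbb{H}^d_L=\bigoplus_{i=1}^\infty(\mathbb{Z}/L\mathbb{Z})^d$ with $\|x-y\|=0$ if $x=y$ and $\|x-y\|=L^{h(x,y)}$ otherwise, where $h(x,y)=\max\{i\ge1:x_i\ne y_i\}$. An $n$-block is an ultrametric ball of radius $L^n$ if $n\ge1$ and a singleton if $n=0$; $\Lambda_n$ is the $n$-block containing the origin $0$. Percolation: for $\beta\ge0$, for each $n\ge0$ and each $n$-block $\Lambda$ let $\omega_\Lambda$ be the random set of edges in which each unordered pair of distinct points of $\Lambda$ is included independently with probability $1-\exp(-\beta L^{-(d+\alpha)n})$, with the $\omega_\Lambda$ independent over all blocks. The union $\omega=\bigcup_\Lambda\omega_\Lambda$ is long-range percolation on $\mathbb{H}^d_L$ in which each pair $\{x,y\}$ is independently open with probability $1-e^{-\beta J(x,y)}$, $J(x,y)=\sum_{n\ge h(x,y)}L^{-(d+\alpha)n}=\frac{L^{d+\alpha}}{L^{d+\alpha}-1}\|x-y\|^{-d-\alpha}$. Connected components are clusters; $\beta_c=\inf\{\beta\ge0:\omega$ has an infinite cluster with positive probability$\}$. Put $\eta_n=\bigcup\{\omega_{\Lambda'}:\Lambda'\subseteq\Lambda_n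 \text{ a block}\}$, a random graph with vertex set $\Lambda_n$. $M_n=\min\{m\in\mathbb{Z}_{\ge0}:\mathbb{P}_{\beta_c}(\text{the largest cluster of }\eta_n\text{ has at least }m\text{ vertices})\le e^{-1}\}$. The notation $f\asymp g$ means $cg\le f\le Cg$ for positive constants $c,C$ depending only on $d,L,\alpha$. *)

theory Defs
  imports "HOL-Probability.Probability" "HOL-Algebra.Product_Groups"
begin

subsection \<open>The hierarchical lattice\<close>

type_synonym point = "nat \<Rightarrow> nat \<Rightarrow> int"

text \<open>A point \<open>x\<close> has coordinates \<open>x i \<in> (\<int>/L\<int>)\<^sup>d\<close> for \<open>i \<ge> 1\<close>; being extensional,
  it is \<open>undefined\<close> at \<open>i = 0\<close>.\<close>

definition hier_group :: "nat \<Rightarrow> nat \<Rightarrow> point monoid" where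
  "hier_group d L = sum_group {1..} (\<lambda>i. product_group {..<d} (\<lambda>j. integer_mod_group L))"

definition hier_lattice :: "nat \<Rightarrow> nat \<Rightarrow> point set" where
  "hier_lattice d L = carrier (hier_group d L)"

definition hier_origin :: "nat \<Rightarrow> nat \<Rightarrow> point" where
  "hier_origin d L = \<one>\<^bsub>hier_group d L\<^esub>"

definition hier_height :: "point \<Rightarrow> point \<Rightarrow> nat" where
  "hier_height x y = Max {i. 1 \<le> i \<and> x i \<noteq> y i}"

definition hier_dist :: "nat \<Rightarrow> point \<Rightarrow> point \<Rightarrow> real" where
  "hier_dist L x y = (if x = y then 0 else real L ^ hier_height x y)"

definition hier_kernel :: "nat \<Rightarrow> nat \<Rightarrow> real \<Rightarrow> point \<Rightarrow> point \<Rightarrow> real" where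
  "hier_kernel d L \<alpha> x y =
     real L powr (d + \<alpha>) / (real L powr (d + \<alpha>) - 1) * hier_dist L x y powr (- (d + \<alpha>))"

definition hier_block :: "nat \<Rightarrow> nat \<Rightarrow> nat \<Rightarrow> point \<Rightarrow> point set" where
  "hier_block d L n x =
     (if n = 0 then {x} else {y \<in> hier_lattice d L. hier_dist L x y \<le> real L ^ n})"

definition hier_blocks :: "nat \<Rightarrow> nat \<Rightarrow> nat \<Rightarrow> point set set" where
  "hier_blocks d L n = hier_block d L n ` hier_lattice d L"

definition origin_block :: "nat \<Rightarrow> nat \<Rightarrow> nat \<Rightarrow> point set" where
  "origin_block d L n = hier_block d L n (hier_origin d L)"


subsection \<open>Percolation configurations\<close>

text \<open>A slot \<open>(n, \<Lambda>, e)\<close> stands for the pair \<open>e\<close> in its role as a potential element of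
  \<open>\<omega>\<^sub>\<Lambda>\<close>, where \<open>\<Lambda>\<close> is an \<open>n\<close>-block. A configuration tells which slots are open; under
  \<open>hier_perc\<close> the slots are independent, so one pair gets an independent trial in each
  block containing it.\<close>

type_synonym slot = "nat \<times> point set \<times> point set"

definition slots :: "nat \<Rightarrow> nat \<Rightarrow> slot set" where
  "slots d L = {(n, \<Lambda>, e). \<Lambda> \<in> hier_blocks d L n \<and> e \<subseteq> \<Lambda> \<and> card e = 2}"

definition slot_prob :: "nat \<Rightarrow> nat \<Rightarrow> real \<Rightarrow> real \<Rightarrow> slot \<Rightarrow> real" where
  "slot_prob d L \<alpha> \<beta> = (\<lambda>(n, \<Lambda>, e). 1 - exp (- \<beta> * real L powr (- (d + \<alpha>) * n)))"

definition hier_perc :: "nat \<Rightarrow> nat \<Rightarrow> real \<Rightarrow> real \<Rightarrow> (slot \<Rightarrow> bool) measure" where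
  "hier_perc d L \<alpha> \<beta> =
     (\<Pi>\<^sub>M s\<in>slots d L. measure_pmf (bernoulli_pmf (slot_prob d L \<alpha> \<beta> s)))"

definition block_edges :: "nat \<Rightarrow> nat \<Rightarrow> nat \<Rightarrow> point set \<Rightarrow> (slot \<Rightarrow> bool) \<Rightarrow> point set set" where
  "block_edges d L n \<Lambda> c = {e. (n, \<Lambda>, e) \<in> slots d L \<and> c (n, \<Lambda>, e)}"

definition perc_edges :: "nat \<Rightarrow> nat \<Rightarrow> (slot \<Rightarrow> bool) \<Rightarrow> point set set" where
  "perc_edges d L c = (\<Union>n. \<Union>\<Lambda>\<in>hier_blocks d L n. block_edges d L n \<Lambda> c)"

definition eta_edges :: "nat \<Rightarrow> nat \<Rightarrow> nat \<Rightarrow> (slot \<Rightarrow> bool) \<Rightarrow> point set set" where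
  "eta_edges d L n c =
     (\<Union>k. \<Union>\<Lambda>\<in>{\<Lambda> \<in> hier_blocks d L k. \<Lambda> \<subseteq> origin_block d L n}. block_edges d L k \<Lambda> c)"


subsection \<open>Clusters, the critical point and the typical maximal cluster size\<close>

definition cluster :: "'a set \<Rightarrow> 'a set set \<Rightarrow> 'a \<Rightarrow> 'a set" where
  "cluster V E x = {y \<in> V. (x, y) \<in> {(u, v). {u, v} \<in> E}\<^sup>*}"

definition clusters :: "'a set \<Rightarrow> 'a set set \<Rightarrow> 'a set set" where
  "clusters V E = cluster V E ` V"

definition max_cluster_size :: "'a set \<Rightarrow> 'a set set \<Rightarrow> nat" where
  "max_cluster_size V E = Max (card ` clusters V E)"

definition prob_infinite_cluster :: "nat \<Rightarrow> nat \<Rightarrow> real \<Rightarrow> real \<Rightarrow> real" where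
  "prob_infinite_cluster d L \<alpha> \<beta> =
     measure (hier_perc d L \<alpha> \<beta>)
       {c \<in> space (hier_perc d L \<alpha> \<beta>).
          \<exists>K\<in>clusters (hier_lattice d L) (perc_edges d L c). infinite K}"

definition beta_c :: "nat \<Rightarrow> nat \<Rightarrow> real \<Rightarrow> real" where
  "beta_c d L \<alpha> = Inf {\<beta>. 0 \<le> \<beta> \<and> prob_infinite_cluster d L \<alpha> \<beta> > 0}"

definition typical_max :: "nat \<Rightarrow> nat \<Rightarrow> real \<Rightarrow> nat \<Rightarrow> nat" where
  "typical_max d L \<alpha> n =
     (LEAST m. measure (hier_perc d L \<alpha> (beta_c d L \<alpha>))
                 {c \<in> space (hier_perc d L \<alpha> (beta_c d L \<alpha>)).
                    max_cluster_size (origin_block d L n) (eta_edges d L n c) \<ge> m}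
               \<le> exp (- 1))"


subsection \<open>Edge probabilities\<close>

text \<open>The block construction is long-range percolation with kernel \<^const>\<open>hier_kernel\<close>.\<close>

lemma hier_lattice_iff:
  "hier_lattice d L = {x \<in> \<Pi>\<^sub>E i\<in>{1..}. carrier (product_group {..<d} (\<lambda>j. integer_mod_group L)).
     finite {i \<in> {1..}. x i \<noteq> \<one>\<^bsub>product_group {..<d} (\<lambda>j. integer_mod_group L)\<^esub>}}"
  unfolding hier_lattice_def hier_group_def by (rule carrier_sum_group) simp

lemma hier_finite_diff:
  assumes "x \<in> hier_lattice d L" "y \<in> hier_lattice d L"
  shows "finite {i. 1 \<le> i \<and> x i \<noteq> y i}"
proof -
  let ?o = "\<one>\<^bsub>product_group {..<d} (\<lambda>j. integer_mod_group L)\<^esub>"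
  have "finite ({i \<in> {1..}. x i \<noteq> ?o} \<union> {i \<in> {1..}. y i \<noteq> ?o})"
    using assms unfolding hier_lattice_iff by blast
  then show ?thesis by (rule finite_subset[rotated]) auto
qed

lemma hier_lattice_eqI:
  assumes "x \<in> hier_lattice d L" "y \<in> hier_lattice d L" "\<And>i. i \<ge> 1 \<Longrightarrow> x i = y i"
  shows "x = y"
  using assms unfolding hier_lattice_iff by (auto intro!: PiE_ext[of x "{1..}" _ y])

lemma hier_height_le_iff:
  assumes "x \<in> hier_lattice d L" "y \<in> hier_lattice d L" "x \<noteq> y"
  shows "hier_height x y \<le> n \<longleftrightarrow> (\<forall>i>n. x i = y i)"
proof -
  have ne: "{i. 1 \<le> i \<and> x i \<noteq> y i} \<noteq> {}" using hier_lattice_eqI[OF assms(1,2)] assms(3) by auto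
  show ?thesis unfolding hier_height_def Max_le_iff[OF hier_finite_diff[OF assms(1,2)] ne]
    by (auto, metis One_nat_def Suc_leI gr_zeroI leD leI not_less_zero order_less_le_trans)
qed

lemma hier_dist_le_iff:
  assumes "x \<in> hier_lattice d L" "y \<in> hier_lattice d L" "L \<ge> 2"
  shows "hier_dist L x y \<le> real L ^ n \<longleftrightarrow> (\<forall>i>n. x i = y i)"
  using hier_height_le_iff[OF assms(1,2), of n] assms(3)
  by (auto simp: hier_dist_def power_increasing_iff)

lemma hier_block_eq:
  assumes "x \<in> hier_lattice d L" "L \<ge> 2"
  shows "hier_block d L n x = {y \<in> hier_lattice d L. \<forall>i>n. x i = y i}"
  using assms hier_dist_le_iff[OF assms(1) _ assms(2)]
  by (cases "n = 0") (auto simp: hier_block_def intro: hier_lattice_eqI)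

lemma slots_pair_iff:
  assumes x: "x \<in> hier_lattice d L" and y: "y \<in> hier_lattice d L" and "x \<noteq> y" "L \<ge> 2"
  shows "(n, \<Lambda>, {x, y}) \<in> slots d L \<longleftrightarrow> hier_height x y \<le> n \<and> \<Lambda> = hier_block d L n x"
  using assms unfolding slots_def hier_blocks_def hier_height_le_iff[OF assms(1-3)]
  by (auto simp: hier_block_eq image_iff)

lemma prob_space_hier_perc: "prob_space (hier_perc d L \<alpha> \<beta>)"
  unfolding hier_perc_def by (intro prob_space_PiM prob_space_measure_pmf)

lemma prob_perc_edge:
  assumes x: "x \<in> hier_lattice d L" and y: "y \<in> hier_lattice d L" and xy: "x \<noteq> y" and L: "L \<ge> 2"
    and a: "\<alpha> > 0" and b: "\<beta> \<ge> 0"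
  shows "measure (hier_perc d L \<alpha> \<beta>) {c \<in> space (hier_perc d L \<alpha> \<beta>). {x, y} \<in> perc_edges d L c}
     = 1 - exp (- \<beta> * hier_kernel d L \<alpha> x y)"
proof -
  let ?P = "hier_perc d L \<alpha> \<beta>" and ?h = "hier_height x y"
  let ?B = "\<lambda>s. measure_pmf (bernoulli_pmf (slot_prob d L \<alpha> \<beta> s))"
  interpret P: prob_space ?P by (rule prob_space_hier_perc)
  interpret PP: product_prob_space ?B "slots d L" by unfold_locales
  define s where "s n = (n, hier_block d L n x, {x, y})" for n
  define q where "q = real L powr (- (d + \<alpha>))"
  have q: "0 < q" "q < 1" using L a by (auto simp: q_def powr_less_one)
  have sI: "s n \<in> slots d L" if "n \<ge> ?h" for n using slots_pair_iff[OF x y xy L] that by (simp add: s_def)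
  have mem: "{x, y} \<in> perc_edges d L c \<longleftrightarrow> (\<exists>n\<ge>?h. c (s n))" for c
  proof -
    have "{x, y} \<in> perc_edges d L c \<longleftrightarrow> (\<exists>n \<Lambda>. (n, \<Lambda>, {x, y}) \<in> slots d L \<and> c (n, \<Lambda>, {x, y}))"
      by (auto simp: perc_edges_def block_edges_def slots_def)
    then show ?thesis unfolding slots_pair_iff[OF x y xy L] s_def by auto
  qed
  define A where "A N = {c \<in> space ?P. \<forall>t\<in>s ` {?h..<N}. c t \<in> {False}}" for N
  have sp: "slot_prob d L \<alpha> \<beta> (s n) = 1 - exp (- \<beta> * q ^ n)" for n
    using L by (simp add: slot_prob_def s_def q_def powr_power mult.commute powr_realpow[symmetric] powr_powr)
  have Am: "A N \<in> sets ?P" for N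
  proof -
    have "A N = space ?P \<inter> (\<Inter>t\<in>s ` {?h..<N}. {c \<in> space ?P. c t \<in> {False}})"
      by (auto simp: A_def)
    moreover have "{c \<in> space ?P. c t \<in> {False}} \<in> sets ?P" if "t \<in> s ` {?h..<N}" for t
      unfolding hier_perc_def by (rule sets_Collect_single') (use that sI in \<open>auto\<close>)
    ultimately show ?thesis by (simp add: sets.Int sets.finite_INT)
  qed
  have "measure ?P (A N) = (\<Prod>n\<in>{?h..<N}. exp (- \<beta> * q ^ n))" for N
  proof -
    have "emeasure ?P (A N) = (\<Prod>t\<in>s ` {?h..<N}. emeasure (?B t) {False})"
      unfolding A_def hier_perc_def by (rule PP.emeasure_PiM_Collect) (auto simp: sI)
    also have "\<dots> = (\<Prod>n\<in>{?h..<N}. emeasure (?B (s n)) {False})"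
      by (subst prod.reindex) (auto simp: inj_on_def s_def)
    also have "\<dots> = (\<Prod>n\<in>{?h..<N}. ennreal (exp (- \<beta> * q ^ n)))"
      using b q by (intro prod.cong refl) (simp add: sp emeasure_pmf_single)
    finally show ?thesis by (simp add: prod_ennreal measure_def prod_nonneg)
  qed
  then have AN: "measure ?P (A N) = exp (- \<beta> * (\<Sum>n\<in>{?h..<N}. q ^ n))" for N
    by (simp add: exp_sum sum_distrib_left)
  have "(\<lambda>N. measure ?P (A N)) \<longlonglongrightarrow> measure ?P (\<Inter>N. A N)"
    by (rule P.finite_Lim_measure_decseq) (use Am in \<open>auto simp: decseq_def A_def\<close>)
  moreover have "(\<lambda>N. measure ?P (A N)) \<longlonglongrightarrow> exp (- \<beta> * (q ^ ?h / (1 - q)))"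
  proof -
    have "(\<lambda>n. q ^ (n + ?h)) sums (q ^ ?h / (1 - q))"
      using sums_mult[OF geometric_sums[of q], of "q ^ ?h"] q by (simp add: power_add mult.commute)
    then have "(\<lambda>N. \<Sum>n<N. q ^ (n + ?h)) \<longlonglongrightarrow> q ^ ?h / (1 - q)" by (simp add: sums_def)
    then have "(\<lambda>N. \<Sum>n\<in>{?h..<N + ?h}. q ^ n) \<longlonglongrightarrow> q ^ ?h / (1 - q)"
      using sum.shift_bounds_nat_ivl[of "\<lambda>n. q ^ n" 0 ?h] by (simp add: atLeast0LessThan)
    then have "(\<lambda>N. \<Sum>n\<in>{?h..<N}. q ^ n) \<longlonglongrightarrow> q ^ ?h / (1 - q)"
      by (rule LIMSEQ_offset)
    then show ?thesis unfolding AN by (intro tendsto_intros)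
  qed
  ultimately have lim: "measure ?P (\<Inter>N. A N) = exp (- \<beta> * (q ^ ?h / (1 - q)))"
    by (rule LIMSEQ_unique)
  have "{c \<in> space ?P. {x, y} \<in> perc_edges d L c} = space ?P - (\<Inter>N. A N)"
  proof -
    have *: "(\<exists>n\<ge>?h. c (s n)) \<longleftrightarrow> (\<exists>N. \<not> (\<forall>t\<in>s ` {?h..<N}. c t \<in> {False}))" for c
    proof
      assume "\<exists>n\<ge>?h. c (s n)"
      then obtain n where "n \<ge> ?h" "c (s n)" by blast
      then have "\<not> (\<forall>t\<in>s ` {?h..<Suc n}. c t \<in> {False})" by auto
      then show "\<exists>N. \<not> (\<forall>t\<in>s ` {?h..<N}. c t \<in> {False})" by blast
    qed auto
    have "{c \<in> S. P c} = S - (\<Inter>N. {c \<in> S. Q N c})"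
      if "\<And>c. P c \<longleftrightarrow> (\<exists>N. \<not> Q N c)" for S :: "(slot \<Rightarrow> bool) set" and P and Q :: "nat \<Rightarrow> _ \<Rightarrow> bool"
      using that by auto
    from this[OF *] show ?thesis unfolding mem A_def .
  qed
  moreover have "(\<Inter>N. A N) \<in> sets ?P" using Am by (intro sets.countable_INT) auto
  ultimately have "measure ?P {c \<in> space ?P. {x, y} \<in> perc_edges d L c} = 1 - measure ?P (\<Inter>N. A N)"
    by (simp only: P.prob_compl)
  moreover have "q ^ ?h / (1 - q) = hier_kernel d L \<alpha> x y"
  proof -
    have q': "q = inverse (real L powr (d + \<alpha>))" unfolding q_def by (rule powr_minus)
    have "real L powr (d + \<alpha>) > 1" using powr_less_mono[of 0 "d + \<alpha>" "real L"] L a by simp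
    moreover have "q ^ ?h = hier_dist L x y powr (- (d + \<alpha>))"
    proof -
      have "q ^ ?h = q powr real ?h" using q by (simp only: powr_realpow)
      also have "\<dots> = (real L powr real ?h) powr (- (d + \<alpha>))"
        unfolding q_def powr_powr by (simp only: mult.commute)
      also have "real L powr real ?h = hier_dist L x y"
        using L xy by (simp add: hier_dist_def powr_realpow)
      finally show ?thesis .
    qed
    moreover have "1 / (1 - q) = real L powr (d + \<alpha>) / (real L powr (d + \<alpha>) - 1)"
      using \<open>real L powr (d + \<alpha>) > 1\<close> L unfolding q' by (simp add: divide_simps)
    moreover have "q ^ ?h / (1 - q) = 1 / (1 - q) * q ^ ?h" by simp
    ultimately show ?thesis unfolding hier_kernel_def by (simp only:)
  qed
  ultimately show ?thesis using lim by simp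
qed

end

theory Submission
  imports Defs
begin

text \<open>
  The law of the clusters in \<open>\<Lambda>\<^sub>n\<^sub>+\<^sub>1\<close> is obtained from that of its independent sub-blocks by opening the
  top-level edges at rate \<open>t\<close>, where \<open>t\<close> runs from \<open>0\<close> to \<open>\<beta> L\<^sup>-\<^sup>(\<^sup>d\<^sup>+\<^sup>\<alpha>\<^sup>)\<^sup>(\<^sup>n\<^sup>+\<^sup>1\<^sup>)\<close>. Let \<open>s\<^sub>q\<close> be the mean
  of \<open>\<Sum>|K\<^sub>x|\<^sup>q\<close>. Russo's formula, the BK inequality and the Harris inequality give, as functions of \<open>t\<close>,
  \<open>s\<^sub>1\<^sup>2 - s\<^sub>3 \<le> s\<^sub>1' \<le> s\<^sub>1\<^sup>2\<close> and \<open>s\<^sub>2' \<ge> 3 (s\<^sub>1 s\<^sub>2 - s\<^sub>4)\<close>.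
  Cutting a cluster into two edge-disjoint connected pieces shows that cluster sizes have exponential
  tails on the scale \<open>M\<close> of the largest cluster, so that \<open>s\<^sub>3 \<le> C M\<^sup>2 s\<^sub>1\<close> and \<open>s\<^sub>4 \<le> C M\<^sup>2 s\<^sub>2\<close>.

  At \<open>\<beta>\<^sub>c\<close> the bound \<open>s\<^sub>1' \<le> s\<^sub>1\<^sup>2\<close> forces \<open>\<beta> L\<^sup>-\<^sup>\<alpha>\<^sup>n E|K\<^sub>n| \<ge> L\<^sup>\<alpha> - 1\<close>, since otherwise the susceptibility would
  stay bounded slightly above \<open>\<beta>\<^sub>c\<close>. If \<open>\<beta> (E max)\<^sup>2 L\<^sup>-\<^sup>(\<^sup>d\<^sup>+\<^sup>\<alpha>\<^sup>)\<^sup>n\<close> is large on one scale, then the largest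
  clusters of the sub-blocks merge on all later scales and percolation occurs; hence \<open>M\<^sub>n\<close> is at most of
  order \<open>L\<^sup>(\<^sup>d\<^sup>+\<^sup>\<alpha>\<^sup>)\<^sup>n\<^sup>/\<^sup>2\<close>, and the differential inequality then gives \<open>E|K\<^sub>n| \<le> C L\<^sup>\<alpha>\<^sup>n\<close>.
  For the lower bound, \<open>s\<^sub>2 / s\<^sub>1\<^sup>3\<close> is almost nondecreasing on scales where \<open>M\<^sub>n\<close> is small, so that
  \<open>E(|K\<^sub>n|\<^sup>2)\<close> would grow like \<open>L\<^sup>3\<^sup>\<alpha>\<^sup>n\<close>; this exceeds \<open>M\<^sub>n E|K\<^sub>n|\<close>, which is at most of order
  \<open>L\<^sup>(\<^sup>d\<^sup>+\<^sup>3\<^sup>\<alpha>\<^sup>)\<^sup>n\<^sup>/\<^sup>2\<close>, because \<open>d < 3 \<alpha>\<close>.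
\<close>

subsection \<open>Expectations over finitely many independent bits\<close>

text \<open>A configuration is the set \<open>A\<close> of open bits. As a finite sum the
  expectation is a polynomial in the \<open>p i\<close>, so derivatives and continuity need no
  measure theory.\<close>

definition bexp :: "'s set \<Rightarrow> ('s \<Rightarrow> real) \<Rightarrow> ('s set \<Rightarrow> real) \<Rightarrow> real" where
  "bexp I p f = (\<Sum>A\<in>Pow I. (\<Prod>i\<in>A. p i) * (\<Prod>i\<in>I - A. 1 - p i) * f A)"

lemma bexp_empty [simp]: "bexp {} p f = f {}"
  by (simp add: bexp_def)

lemma bexp_insert:
  assumes "finite I" "i \<notin> I"
  shows "bexp (insert i I) p f = p i * bexp I p (\<lambda>A. f (insert i A)) + (1 - p i) * bexp I p f"
proof -
  have disj: "Pow I \<inter> insert i ` Pow I = {}" using assms(2) by auto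
  have inj: "inj_on (insert i) (Pow I)" using assms(2) by (auto simp: inj_on_def)
  have closed: "(\<Prod>j\<in>insert i I - A. 1 - p j) = (1 - p i) * (\<Prod>j\<in>I - A. 1 - p j)" if "A \<in> Pow I" for A
  proof -
    have "insert i I - A = insert i (I - A)" using that assms(2) by auto
    then show ?thesis using assms by simp
  qed
  have opened: "(\<Prod>j\<in>insert i A. p j) * (\<Prod>j\<in>insert i I - insert i A. 1 - p j)
      = p i * ((\<Prod>j\<in>A. p j) * (\<Prod>j\<in>I - A. 1 - p j))" if "A \<in> Pow I" for A
  proof -
    have "insert i I - insert i A = I - A" "i \<notin> A" "finite A"
      using that assms by (auto intro: finite_subset)
    then show ?thesis by simp
  qed
  have "(\<Sum>A\<in>Pow I. (\<Prod>j\<in>A. p j) * (\<Prod>j\<in>insert i I - A. 1 - p j) * f A) = (1 - p i) * bexp I p f"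
    unfolding bexp_def sum_distrib_left by (intro sum.cong refl) (simp only: closed mult_ac)
  moreover have "(\<Sum>A\<in>insert i ` Pow I. (\<Prod>j\<in>A. p j) * (\<Prod>j\<in>insert i I - A. 1 - p j) * f A)
      = p i * bexp I p (\<lambda>A. f (insert i A))"
    unfolding bexp_def sum_distrib_left sum.reindex[OF inj] o_def
    by (intro sum.cong refl) (simp only: opened mult.assoc)
  ultimately show ?thesis
    unfolding bexp_def[of "insert i I"] Pow_insert
    by (subst sum.union_disjoint) (use assms disj in auto)
qed

lemma bexp_cong:
  assumes "\<And>A. A \<subseteq> I \<Longrightarrow> f A = g A" "\<And>i. i \<in> I \<Longrightarrow> p i = q i"
  shows "bexp I p f = bexp I q g"
  unfolding bexp_def
proof (intro sum.cong refl)
  fix A assume "A \<in> Pow I"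
  then show "(\<Prod>i\<in>A. p i) * (\<Prod>i\<in>I - A. 1 - p i) * f A = (\<Prod>i\<in>A. q i) * (\<Prod>i\<in>I - A. 1 - q i) * g A"
    using assms by (intro arg_cong2[where f = "(*)"] prod.cong) auto
qed

lemma bexp_mono:
  assumes "\<And>i. i \<in> I \<Longrightarrow> 0 \<le> p i" "\<And>i. i \<in> I \<Longrightarrow> p i \<le> 1" "\<And>A. A \<subseteq> I \<Longrightarrow> f A \<le> g A"
  shows "bexp I p f \<le> bexp I p g"
  unfolding bexp_def using assms
  by (intro sum_mono mult_left_mono mult_nonneg_nonneg prod_nonneg) auto

lemma bexp_add: "bexp I p (\<lambda>A. f A + g A) = bexp I p f + bexp I p g"
  by (simp add: bexp_def algebra_simps sum.distrib)

lemma bexp_cmult: "bexp I p (\<lambda>A. c * f A) = c * bexp I p f"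
  by (simp add: bexp_def algebra_simps sum_distrib_left)

lemma bexp_multc: "bexp I p (\<lambda>A. f A * c) = bexp I p f * c"
  by (simp add: bexp_def algebra_simps sum_distrib_left)

lemma bexp_diff: "bexp I p (\<lambda>A. f A - g A) = bexp I p f - bexp I p g"
  by (simp add: bexp_def algebra_simps sum_subtractf)

lemma bexp_sum: "bexp I p (\<lambda>A. \<Sum>x\<in>S. f x A) = (\<Sum>x\<in>S. bexp I p (f x))"
  by (simp add: bexp_def sum_distrib_left sum.swap[of _ S])

lemma bexp_const: "finite I \<Longrightarrow> bexp I p (\<lambda>A. c) = c"
  by (induction I rule: finite_induct) (simp_all add: bexp_insert algebra_simps)

lemma bexp_nonneg:
  assumes "\<And>i. i \<in> I \<Longrightarrow> 0 \<le> p i" "\<And>i. i \<in> I \<Longrightarrow> p i \<le> 1" "\<And>A. A \<subseteq> I \<Longrightarrow> 0 \<le> f A"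
  shows "0 \<le> bexp I p f"
  using bexp_mono[OF assms(1,2), where f = "\<lambda>_. 0" and g = f] assms(3) by (simp add: bexp_def)

section \<open>Independence, marginals and relabelling of bits\<close>

lemma bexp_union:
  assumes "finite I" "finite J" "I \<inter> J = {}"
  shows "bexp (I \<union> J) p f = bexp I p (\<lambda>A. bexp J p (\<lambda>B. f (A \<union> B)))"
  using assms(1,3)
proof (induction I arbitrary: f rule: finite_induct)
  case (insert i I)
  then have "bexp (insert i (I \<union> J)) p f =
      p i * bexp (I \<union> J) p (\<lambda>A. f (insert i A)) + (1 - p i) * bexp (I \<union> J) p f"
    using assms(2) by (intro bexp_insert) auto
  with insert show ?case by (simp add: bexp_insert)
qed simp

lemma bexp_marginal:
  assumes "finite I" "J \<subseteq> I"
  shows "bexp I p (\<lambda>A. f (A \<inter> J)) = bexp J p f"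
proof -
  have fin: "finite J" "finite (I - J)" using assms by (auto intro: finite_subset)
  have "bexp I p (\<lambda>A. f (A \<inter> J)) = bexp (J \<union> (I - J)) p (\<lambda>A. f (A \<inter> J))"
    using assms by (simp add: Un_absorb1)
  also have "\<dots> = bexp J p (\<lambda>A. bexp (I - J) p (\<lambda>B. f ((A \<union> B) \<inter> J)))"
    by (rule bexp_union) (use fin in auto)
  also have "\<dots> = bexp J p (\<lambda>A. bexp (I - J) p (\<lambda>B. f A))"
    by (intro bexp_cong refl arg_cong[of _ _ f]) auto
  finally show ?thesis using fin by (simp add: bexp_const)
qed

lemma bexp_zero_prob:
  assumes "finite I" "finite J" "I \<inter> J = {}" "\<And>j. j \<in> J \<Longrightarrow> p j = 0"
  shows "bexp (I \<union> J) p f = bexp I p f"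
proof -
  have "bexp J p g = g {}" for g
    using assms(2,4) by (induction J rule: finite_induct) (simp_all add: bexp_insert)
  then show ?thesis using assms(1-3) by (simp add: bexp_union)
qed

lemma bexp_reindex:
  assumes "inj_on h I"
  shows "bexp (h ` I) p f = bexp I (p \<circ> h) (\<lambda>A. f (h ` A))"
proof -
  have inj: "inj_on ((`) h) (Pow I)" using assms by (auto intro: inj_on_image_Pow)
  have "(\<Prod>i\<in>h ` A. p i) = (\<Prod>i\<in>A. p (h i))" "(\<Prod>i\<in>h ` I - h ` A. 1 - p i) = (\<Prod>i\<in>I - A. 1 - p (h i))"
    if "A \<in> Pow I" for A
  proof -
    have *: "h ` I - h ` A = h ` (I - A)" using that assms by (auto simp: inj_on_def)
    show "(\<Prod>i\<in>h ` A. p i) = (\<Prod>i\<in>A. p (h i))"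
      using that assms by (subst prod.reindex) (auto intro: inj_on_subset)
    show "(\<Prod>i\<in>h ` I - h ` A. 1 - p i) = (\<Prod>i\<in>I - A. 1 - p (h i))"
      unfolding * using that assms by (subst prod.reindex) (auto intro: inj_on_subset)
  qed
  moreover have "Pow (h ` I) = (`) h ` Pow I" by (simp add: image_Pow_surj)
  ultimately show ?thesis unfolding bexp_def
    by (simp add: sum.reindex[OF inj])
qed

lemma continuous_bexp:
  assumes "finite I" "\<And>i. i \<in> I \<Longrightarrow> continuous_on S (\<lambda>t. p t i)"
  shows "continuous_on S (\<lambda>t. bexp I (p t) f)"
  unfolding bexp_def using assms by (intro continuous_intros) auto

text \<open>The van den Berg--Kesten inequality. Applied to \<open>Q X Y \<longleftrightarrow> P X \<and> R Y\<close> it bounds the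
  probability of disjoint occurrence; the form with an arbitrary monotone \<open>Q\<close> is stable
  under splitting one bit into two independent copies, which is the induction step.\<close>

lemma bexp_disjoint_le_double:
  assumes "finite I" "\<And>i. i \<in> I \<Longrightarrow> 0 \<le> p i" "\<And>i. i \<in> I \<Longrightarrow> p i \<le> 1"
    and "\<And>X Y X' Y'. Q X Y \<Longrightarrow> X \<subseteq> X' \<Longrightarrow> Y \<subseteq> Y' \<Longrightarrow> Q X' Y'"
  shows "bexp I p (\<lambda>A. of_bool (\<exists>X Y. X \<subseteq> A \<and> Y \<subseteq> A \<and> X \<inter> Y = {} \<and> Q X Y))
      \<le> bexp I p (\<lambda>A. bexp I p (\<lambda>B. of_bool (Q A B)))"
  using assms
proof (induction I arbitrary: Q rule: finite_induct)
  case empty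
  then show ?case by simp
next
  case (insert i I)
  note mono = insert.prems(3)
  have p: "0 \<le> p i" "p i \<le> 1" "\<And>j. j \<in> I \<Longrightarrow> 0 \<le> p j" "\<And>j. j \<in> I \<Longrightarrow> p j \<le> 1"
    using insert.prems by auto
  \<comment> \<open>An open bit \<open>i\<close> can serve only one of two disjoint witnesses, so on
    \<open>insert i A\<close> the relation \<open>Q\<close> turns into \<open>Q1\<close>, which is
    again monotone.\<close>
  define Q1 where "Q1 X Y \<longleftrightarrow> Q (insert i X) Y \<or> Q X (insert i Y)" for X Y
  have Q1: "Q1 X' Y'" if "Q1 X Y" "X \<subseteq> X'" "Y \<subseteq> Y'" for X Y X' Y'
    using that mono[of "insert i X" Y "insert i X'" Y'] mono[of X "insert i Y" X' "insert i Y'"]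
    unfolding Q1_def by auto
  let ?D = "\<lambda>Q A. of_bool (\<exists>X Y. X \<subseteq> A \<and> Y \<subseteq> A \<and> X \<inter> Y = {} \<and> Q X Y) :: real"
  have D1: "?D Q (insert i A) = ?D Q1 A" if "A \<subseteq> I" for A
  proof -
    have split: "\<exists>X Y. X \<subseteq> A \<and> Y \<subseteq> A \<and> X \<inter> Y = {} \<and> Q1 X Y"
      if *: "X \<subseteq> insert i A" "Y \<subseteq> insert i A" "X \<inter> Y = {}" "Q X Y" for X Y
    proof (intro exI conjI)
      show "Q1 (X - {i}) (Y - {i})"
      proof (cases "i \<in> Y")
        case True
        then have "X - {i} = X" "insert i (Y - {i}) = Y" using * by auto
        then show ?thesis using *(4) by (simp add: Q1_def)
      next
        case False
        then have "Y - {i} = Y" by auto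
        moreover have "Q (insert i (X - {i})) Y" using mono[OF *(4), of "insert i (X - {i})" Y] by auto
        ultimately show ?thesis by (simp add: Q1_def)
      qed
    qed (use * in auto)
    have join: "\<exists>X Y. X \<subseteq> insert i A \<and> Y \<subseteq> insert i A \<and> X \<inter> Y = {} \<and> Q X Y"
      if *: "X \<subseteq> A" "Y \<subseteq> A" "X \<inter> Y = {}" "Q1 X Y" for X Y
    proof -
      have "i \<notin> X" "i \<notin> Y" using * \<open>A \<subseteq> I\<close> insert.hyps(2) by auto
      then have "insert i X \<inter> Y = {}" "X \<inter> insert i Y = {}" using *(3) by auto
      moreover have "insert i X \<subseteq> insert i A" "insert i Y \<subseteq> insert i A" "X \<subseteq> insert i A" "Y \<subseteq> insert i A"
        using * by auto
      ultimately show ?thesis using *(4) unfolding Q1_def by blast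
    qed
    have "(\<exists>X Y. X \<subseteq> insert i A \<and> Y \<subseteq> insert i A \<and> X \<inter> Y = {} \<and> Q X Y) \<longleftrightarrow>
        (\<exists>X Y. X \<subseteq> A \<and> Y \<subseteq> A \<and> X \<inter> Y = {} \<and> Q1 X Y)"
      by (rule iffI; elim exE conjE; (rule split | rule join); assumption)
    then show ?thesis by simp
  qed
  have "bexp (insert i I) p (?D Q) = p i * bexp I p (?D Q1) + (1 - p i) * bexp I p (?D Q)"
    unfolding bexp_insert[OF insert.hyps] by (simp only: bexp_cong[OF D1 refl])
  also have "\<dots> \<le> p i * bexp I p (\<lambda>A. bexp I p (\<lambda>B. of_bool (Q1 A B)))
      + (1 - p i) * bexp I p (\<lambda>A. bexp I p (\<lambda>B. of_bool (Q A B)))"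
    using p insert.IH[of Q] insert.IH[of Q1] mono Q1
    by (intro add_mono mult_left_mono) auto
  also have "\<dots> = bexp I p (\<lambda>A. bexp I p (\<lambda>B. p i * of_bool (Q1 A B) + (1 - p i) * of_bool (Q A B)))"
    by (simp add: bexp_add bexp_cmult)
  also have "\<dots> \<le> bexp I p (\<lambda>A. bexp I p (\<lambda>B.
      p i * (p i * of_bool (Q (insert i A) (insert i B)) + (1 - p i) * of_bool (Q (insert i A) B))
      + (1 - p i) * (p i * of_bool (Q A (insert i B)) + (1 - p i) * of_bool (Q A B))))"
  \<comment> \<open>If \<open>Q A B\<close> holds, both sides are 1. If not and exactly one of
    \<open>Q (insert i A) B\<close> and \<open>Q A (insert i B)\<close> holds, both sides are
    \<open>p i\<close>; if both hold, the right side is larger by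
    \<open>p i * (1 - p i)\<close>.\<close>
  proof (intro bexp_mono p)
    fix A B
    have up: "Q A B \<Longrightarrow> Q (insert i A) B" "Q A B \<Longrightarrow> Q A (insert i B)"
      "Q (insert i A) B \<Longrightarrow> Q (insert i A) (insert i B)" "Q A (insert i B) \<Longrightarrow> Q (insert i A) (insert i B)"
      by (auto elim!: mono)
    have *: "0 \<le> p i * (1 - p i)" using p by simp
    show "p i * of_bool (Q1 A B) + (1 - p i) * of_bool (Q A B)
      \<le> p i * (p i * of_bool (Q (insert i A) (insert i B)) + (1 - p i) * of_bool (Q (insert i A) B))
      + (1 - p i) * (p i * of_bool (Q A (insert i B)) + (1 - p i) * of_bool (Q A B))"
      using up * p(1,2) unfolding Q1_def
      by (cases "Q A B"; cases "Q (insert i A) B"; cases "Q A (insert i B)"; cases "Q (insert i A) (insert i B)")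
         (auto simp: algebra_simps)
  qed
  also have "\<dots> = bexp (insert i I) p (\<lambda>A. bexp (insert i I) p (\<lambda>B. of_bool (Q A B)))"
    unfolding bexp_insert[OF insert.hyps] by (simp only: bexp_add bexp_cmult distrib_left)
  finally show ?case .
qed

lemma BK_inequality:
  assumes "finite I" "\<And>i. i \<in> I \<Longrightarrow> 0 \<le> p i" "\<And>i. i \<in> I \<Longrightarrow> p i \<le> 1"
    and "\<And>X X'. P X \<Longrightarrow> X \<subseteq> X' \<Longrightarrow> P X'" "\<And>X X'. R X \<Longrightarrow> X \<subseteq> X' \<Longrightarrow> R X'"
  shows "bexp I p (\<lambda>A. of_bool (\<exists>X Y. X \<subseteq> A \<and> Y \<subseteq> A \<and> X \<inter> Y = {} \<and> P X \<and> R Y))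
      \<le> bexp I p (\<lambda>A. of_bool (P A)) * bexp I p (\<lambda>A. of_bool (R A))"
proof -
  have "bexp I p (\<lambda>A. of_bool (\<exists>X Y. X \<subseteq> A \<and> Y \<subseteq> A \<and> X \<inter> Y = {} \<and> P X \<and> R Y))
      \<le> bexp I p (\<lambda>A. bexp I p (\<lambda>B. of_bool (P A \<and> R B)))"
    using assms by (intro bexp_disjoint_le_double) blast+
  then show ?thesis by (simp add: of_bool_conj bexp_cmult bexp_multc)
qed

text \<open>Induction on the bits: averaging over bit \<open>i\<close> adds the covariance
  \<open>p i * (1 - p i) * ((f1 - f0) * (g1 - g0))\<close> of the conditional means, and both
  differences are nonnegative by monotonicity.\<close>

lemma Harris_inequality:
  assumes "finite I" "\<And>i. i \<in> I \<Longrightarrow> 0 \<le> p i" "\<And>i. i \<in> I \<Longrightarrow> p i \<le> 1"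
    and "\<And>X X'. X \<subseteq> X' \<Longrightarrow> X' \<subseteq> I \<Longrightarrow> f X \<le> f X'" "\<And>X X'. X \<subseteq> X' \<Longrightarrow> X' \<subseteq> I \<Longrightarrow> g X \<le> g X'"
  shows "bexp I p f * bexp I p g \<le> bexp I p (\<lambda>A. f A * g A)"
  using assms
proof (induction I arbitrary: f g rule: finite_induct)
  case (insert i I)
  note f = insert.prems(3) and g = insert.prems(4)
  have p: "0 \<le> p i" "p i \<le> 1" "\<And>j. j \<in> I \<Longrightarrow> 0 \<le> p j" "\<And>j. j \<in> I \<Longrightarrow> p j \<le> 1"
    using insert.prems by auto
  define f0 g0 f1 g1 where "f0 = bexp I p f" and "g0 = bexp I p g"
    and "f1 = bexp I p (\<lambda>A. f (insert i A))" and "g1 = bexp I p (\<lambda>A. g (insert i A))"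
  have "f0 \<le> f1" "g0 \<le> g1" unfolding f0_def f1_def g0_def g1_def
    by (rule bexp_mono; (rule p f g)?; blast)+
  then have "0 \<le> p i * (1 - p i) * ((f1 - f0) * (g1 - g0))" using p by simp
  then have "(p i * f1 + (1 - p i) * f0) * (p i * g1 + (1 - p i) * g0)
      \<le> p i * (f1 * g1) + (1 - p i) * (f0 * g0)" by (simp add: algebra_simps)
  also have "\<dots> \<le> p i * bexp I p (\<lambda>A. f (insert i A) * g (insert i A)) + (1 - p i) * bexp I p (\<lambda>A. f A * g A)"
    unfolding f0_def f1_def g0_def g1_def
    using p f g insert.IH[of f g] insert.IH[of "\<lambda>A. f (insert i A)" "\<lambda>A. g (insert i A)"]
    by (intro add_mono mult_left_mono insert.IH) (auto intro!: f g)
  finally show ?case unfolding bexp_insert[OF insert.hyps] f0_def f1_def g0_def g1_def .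
qed simp

section \<open>Differentiation in the common rate of a set of bits\<close>

definition dial :: "'s set \<Rightarrow> ('s \<Rightarrow> real) \<Rightarrow> real \<Rightarrow> 's \<Rightarrow> real" where
  "dial T p t i = (if i \<in> T then 1 - exp (- t) else p i)"

text \<open>The derivative of \<open>1 - exp (- t)\<close> is \<open>exp (- t)\<close>, the
  probability that a bit is closed, and \<open>f (insert e A) - f A\<close> vanishes where
  \<open>e\<close> is open; hence no prefactor remains. \<open>T'\<close> grows in the induction
  while the dial set \<open>T\<close> stays fixed.\<close>

lemma Russo_formula:
  assumes "finite J" "finite T'" "T' \<subseteq> T" "J \<inter> T = {}"
  shows "((\<lambda>t. bexp (J \<union> T') (dial T p t) f) has_real_derivative
     (\<Sum>e\<in>T'. bexp (J \<union> T') (dial T p t) (\<lambda>A. f (insert e A) - f A))) (at t)"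
  using assms(2,3)
proof (induction T' arbitrary: f rule: finite_induct)
  case empty
  have "bexp J (dial T p t) f = bexp J p f" for t
    using assms(4) by (intro bexp_cong) (auto simp: dial_def)
  then show ?case by simp
next
  case (insert i S)
  let ?I = "J \<union> S"
  let ?E = "\<lambda>I t. bexp I (dial T p t)"
  have i: "i \<in> T" "finite ?I" "i \<notin> ?I" using insert assms by auto
  have step: "?E (insert i ?I) t g = (1 - exp (- t)) * ?E ?I t (\<lambda>A. g (insert i A)) + exp (- t) * ?E ?I t g"
    for t g using i by (subst bexp_insert) (auto simp: dial_def)
  let ?d = "\<lambda>f t. \<Sum>e\<in>S. ?E ?I t (\<lambda>A. f (insert e A) - f A)"
  let ?f1 = "\<lambda>A. f (insert i A)"
  have IH: "((\<lambda>t. ?E ?I t g) has_real_derivative ?d g t) (at t)" for g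
    using insert by auto
  have "((\<lambda>t. (1 - exp (- t)) * ?E ?I t ?f1 + exp (- t) * ?E ?I t f) has_real_derivative
     (exp (- t) * ?E ?I t ?f1 + (1 - exp (- t)) * ?d ?f1 t - exp (- t) * ?E ?I t f + exp (- t) * ?d f t)) (at t)"
    by (rule derivative_eq_intros IH refl | simp)+
  moreover have "(\<Sum>e\<in>insert i S. ?E (insert i ?I) t (\<lambda>A. f (insert e A) - f A)) =
     exp (- t) * ?E ?I t ?f1 + (1 - exp (- t)) * ?d ?f1 t - exp (- t) * ?E ?I t f + exp (- t) * ?d f t"
    using insert.hyps
    by (simp add: step sum.distrib sum_distrib_left bexp_diff sum_subtractf insert_commute[of i] algebra_simps
        sum_negf bexp_const i)
  ultimately show ?case by (simp add: step)
qed

subsection \<open>Connected components of finite graphs\<close>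

text \<open>The component of \<open>x\<close> without reference to a vertex set; it agrees with
  \<open>cluster V E x\<close> once all edges lie in \<open>V\<close> and
  \<open>x \<in> V\<close>.\<close>

definition reach :: "'v set set \<Rightarrow> 'v \<Rightarrow> 'v set" where
  "reach E x = {y. (x, y) \<in> {(u, v). {u, v} \<in> E}\<^sup>*}"

lemma cluster_conv_reach: "cluster V E x = V \<inter> reach E x"
  by (auto simp: cluster_def reach_def)

lemma reach_refl [simp]: "x \<in> reach E x"
  by (simp add: reach_def)

lemma reach_step: "y \<in> reach E x \<Longrightarrow> {y, z} \<in> E \<Longrightarrow> z \<in> reach E x"
  by (auto simp: reach_def intro: rtrancl_into_rtrancl)

text \<open>Path induction in closed-set form; it yields the upper bounds on components
  below.\<close>

lemma reach_least:
  assumes "x \<in> S" "\<And>u v. u \<in> S \<Longrightarrow> {u, v} \<in> E \<Longrightarrow> v \<in> S"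
  shows "reach E x \<subseteq> S"
proof
  fix y assume "y \<in> reach E x"
  then have "(x, y) \<in> {(u, v). {u, v} \<in> E}\<^sup>*" by (simp add: reach_def)
  then show "y \<in> S" by (induction rule: rtrancl_induct) (use assms in auto)
qed

lemma reach_sym: "y \<in> reach E x \<Longrightarrow> x \<in> reach E y"
proof -
  have "sym ({(u, v). {u, v} \<in> E}\<^sup>*)"
    by (intro sym_rtrancl) (auto simp: sym_def insert_commute)
  then show "y \<in> reach E x \<Longrightarrow> x \<in> reach E y" by (auto simp: reach_def sym_def)
qed

lemma reach_trans: "y \<in> reach E x \<Longrightarrow> z \<in> reach E y \<Longrightarrow> z \<in> reach E x"
  by (auto simp: reach_def)

lemma reach_eq: "y \<in> reach E x \<Longrightarrow> reach E y = reach E x"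
  by (auto intro: reach_trans dest: reach_sym)

lemma reach_mono: "E \<subseteq> F \<Longrightarrow> reach E x \<subseteq> reach F x"
  by (rule reach_least) (auto intro: reach_step)

lemma reach_subset:
  assumes "\<And>e. e \<in> E \<Longrightarrow> e \<subseteq> V" "x \<in> V"
  shows "reach E x \<subseteq> V"
  using assms by (intro reach_least) auto

lemma cluster_eq_reach:
  assumes "\<And>e. e \<in> E \<Longrightarrow> e \<subseteq> V" "x \<in> V"
  shows "cluster V E x = reach E x"
  using reach_subset[OF assms] by (auto simp: cluster_conv_reach)

lemma reach_empty [simp]: "reach {} x = {x}"
  by (intro subset_antisym reach_least) auto

lemma finite_reach:
  assumes "finite E" "\<And>e. e \<in> E \<Longrightarrow> finite e"
  shows "finite (reach E x)"
proof -
  have "reach E x \<subseteq> insert x (\<Union>E)" by (rule reach_subset) auto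
  then show ?thesis by (rule finite_subset) (use assms in auto)
qed

lemma reach_insert:
  "reach (insert {u, v} E) x =
     (if u \<in> reach E x \<or> v \<in> reach E x then reach E u \<union> reach E v else reach E x)"
proof (cases "u \<in> reach E x \<or> v \<in> reach E x")
  case True
  let ?F = "insert {u, v} E"
  have uv: "v \<in> reach ?F u" "u \<in> reach ?F v"
    by (rule reach_step[OF reach_refl]; simp add: insert_commute)+
  have "u \<in> reach ?F x" using True uv reach_mono[of E ?F x] by (auto intro: reach_trans)
  moreover have "v \<in> reach ?F x" using calculation uv by (auto intro: reach_trans)
  ultimately have "reach E u \<union> reach E v \<subseteq> reach ?F x"
    using reach_mono[of E ?F] by (auto intro: reach_trans)
  moreover have "reach ?F x \<subseteq> reach E u \<union> reach E v"
  proof (rule reach_least)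
    show "x \<in> reach E u \<union> reach E v" using True by (auto dest: reach_sym)
    show "b \<in> reach E u \<union> reach E v" if "a \<in> reach E u \<union> reach E v" "{a, b} \<in> ?F" for a b
      using that by (auto simp: doubleton_eq_iff intro: reach_step)
  qed
  ultimately show ?thesis using True by auto
next
  case False
  have "reach (insert {u, v} E) x \<subseteq> reach E x"
    by (rule reach_least) (use False in \<open>auto simp: doubleton_eq_iff intro: reach_step\<close>)
  then show ?thesis using False reach_mono[of E "insert {u, v} E" x] by auto
qed

text \<open>A component is determined by the edges touching it; these later serve as witness in a
  disjoint occurrence.\<close>

lemma reach_restrict: "reach {e \<in> E. e \<inter> reach E x \<noteq> {}} x = reach E x"
proof
  let ?F = "{e \<in> E. e \<inter> reach E x \<noteq> {}}"
  show sub: "reach ?F x \<subseteq> reach E x" by (rule reach_mono) auto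
  show "reach E x \<subseteq> reach ?F x"
  proof (rule reach_least)
    fix u v assume "u \<in> reach ?F x" "{u, v} \<in> E"
    then have "{u, v} \<in> ?F" using sub by auto
    then show "v \<in> reach ?F x" using \<open>u \<in> reach ?F x\<close> by (rule reach_step[rotated])
  qed simp
qed

lemma reach_restrict_image: "reach (ed ` {s \<in> A. ed s \<inter> reach (ed ` A) x \<noteq> {}}) x = reach (ed ` A) x"
proof -
  have "ed ` {s \<in> A. ed s \<inter> reach (ed ` A) x \<noteq> {}} = {e \<in> ed ` A. e \<inter> reach (ed ` A) x \<noteq> {}}" by auto
  then show ?thesis by (simp only: reach_restrict)
qed

section \<open>Cutting a cluster into edge-disjoint pieces\<close>

lemma card2_obtain:
  assumes "card e = 2" "x \<in> e"
  obtains y where "e = {x, y}" "y \<noteq> x"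
  using assms by (auto simp: card_2_iff doubleton_eq_iff)

text \<open>An edge that touches a component lies inside it, so no slot can touch two different
  components.\<close>

lemma touching_disjoint:
  assumes "\<And>s. s \<in> A \<Longrightarrow> card (ed s) = 2" "v \<notin> reach (ed ` A) u"
  shows "{s \<in> A. ed s \<inter> reach (ed ` A) u \<noteq> {}} \<inter> {s \<in> A. ed s \<inter> reach (ed ` A) v \<noteq> {}} = {}"
proof -
  have "ed s \<subseteq> reach (ed ` A) w" if s: "s \<in> A" "ed s \<inter> reach (ed ` A) w \<noteq> {}" for s w
  proof -
    from s obtain a where a: "a \<in> ed s" "a \<in> reach (ed ` A) w" by auto
    obtain b where b: "ed s = {a, b}" using card2_obtain[OF assms(1)[OF s(1)] a(1)] .
    then have "{a, b} \<in> ed ` A" using s(1) by force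
    then show ?thesis using a b reach_step[OF a(2)] by auto
  qed
  moreover have "reach (ed ` A) u \<inter> reach (ed ` A) v = {}"
    using assms(2) by (auto intro: reach_trans dest: reach_sym)
  ultimately show ?thesis using assms(1) by fastforce
qed

text \<open>Deleting an edge at the root \<open>x\<close> either keeps the cluster or splits it into two parts. One
  recurses into a part with at least \<open>m\<close> vertices, the other part staying attached to the root;
  if both parts are smaller, then the whole cluster has fewer than \<open>2 m\<close> vertices.\<close>

lemma split_cluster:
  assumes "finite A" "\<And>s. s \<in> A \<Longrightarrow> card (ed s) = 2" "1 \<le> m" "m \<le> card (reach (ed ` A) x)"
  shows "\<exists>B C w. B \<subseteq> A \<and> C \<subseteq> A \<and> B \<inter> C = {} \<and> w \<in> reach (ed ` A) x \<and> m \<le> card (reach (ed ` B) w)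
      \<and> card (reach (ed ` A) x) < card (reach (ed ` C) x) + 2 * m"
  using assms(1,2,4)
proof (induction "card A" arbitrary: A x rule: less_induct)
  case less
  have fin: "finite (reach (ed ` B) w)" if "B \<subseteq> A" for B w
  proof (rule finite_reach)
    show "finite (ed ` B)" using that less.prems(1) by (auto intro: finite_subset)
    show "finite e" if "e \<in> ed ` B" for e
      using that \<open>B \<subseteq> A\<close> less.prems(2) by (metis card.infinite image_iff subsetD zero_neq_numeral)
  qed
  show ?case
  proof (cases "\<exists>s\<in>A. x \<in> ed s")
    case False
    then have "reach (ed ` A) x \<subseteq> {x}" by (intro reach_least) auto
    then have 1: "reach (ed ` A) x = {x}" using reach_refl by fast
    then show ?thesis using less.prems(3) \<open>1 \<le> m\<close>
      by (intro exI[of _ "{}"] exI[of _ x]) (auto simp: 1)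
  next
    case True
    then obtain s y where s: "s \<in> A" "ed s = {x, y}" "y \<noteq> x"
      using card2_obtain[OF less.prems(2)] by metis
    define A' where "A' = A - {s}"
    have A': "A = insert s A'" "finite A'" "s \<notin> A'" "A' \<subseteq> A" using s less.prems(1) by (auto simp: A'_def)
    have edA: "ed ` A = insert {x, y} (ed ` A')" using A' s by auto
    have R: "reach (ed ` A) x = reach (ed ` A') x \<union> reach (ed ` A') y"
      unfolding edA reach_insert by simp
    have card_less: "card B < card A" if "B \<subseteq> A'" for B
      using that A' by (metis card_mono card_insert_disjoint le_imp_less_Suc)
    have card2: "card (ed s) = 2" if "s \<in> A'" for s using that less.prems(2) A' by auto
    show ?thesis
    proof (cases "y \<in> reach (ed ` A') x")
      case True
      then have eq: "reach (ed ` A) x = reach (ed ` A') x" using R reach_eq by fastforce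
      from less.hyps[OF card_less[OF subset_refl] A'(2) card2] less.prems(3) eq
      obtain B C w where "B \<subseteq> A'" "C \<subseteq> A'" "B \<inter> C = {}" "w \<in> reach (ed ` A') x"
        "m \<le> card (reach (ed ` B) w)" "card (reach (ed ` A') x) < card (reach (ed ` C) x) + 2 * m" by metis
      then show ?thesis using A'(4) unfolding eq by (intro exI[of _ B] exI[of _ C] exI[of _ w]) auto
    next
      case False
      define A1 A2 where "A1 = {s \<in> A'. ed s \<inter> reach (ed ` A') x \<noteq> {}}"
        and "A2 = {s \<in> A'. ed s \<inter> reach (ed ` A') y \<noteq> {}}"
      have sub: "A1 \<subseteq> A'" "A2 \<subseteq> A'" by (auto simp: A1_def A2_def)
      have disj: "A1 \<inter> A2 = {}" unfolding A1_def A2_def by (rule touching_disjoint[OF card2 False])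
      have r1: "reach (ed ` A1) x = reach (ed ` A') x" and r2: "reach (ed ` A2) y = reach (ed ` A') y"
        unfolding A1_def A2_def by (rule reach_restrict_image)+
      have dR: "reach (ed ` A') x \<inter> reach (ed ` A') y = {}"
        using False by (auto intro: reach_trans dest: reach_sym)
      then have cR: "card (reach (ed ` A) x) = card (reach (ed ` A') x) + card (reach (ed ` A') y)"
        unfolding R using fin[OF A'(4)] by (intro card_Un_disjoint) auto
      have small: ?thesis if "card (reach (ed ` A') x) < m" "card (reach (ed ` A') y) < m"
        using that less.prems(3) cR by (intro exI[of _ A] exI[of _ "{}"] exI[of _ x]) auto
      \<comment> \<open>The recursion enters the part at \<open>a\<close>. The deleted slot
        \<open>s\<close> and the whole part \<open>Q\<close> at \<open>b\<close> go to
        \<open>C'\<close>, so the remaining piece stays attached to the root whichever of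
        \<open>x\<close> and \<open>y\<close> is \<open>a\<close>.\<close>
      have step: ?thesis
        if *: "P \<subseteq> A'" "Q \<subseteq> A'" "P \<inter> Q = {}" "reach (ed ` P) a = reach (ed ` A') a"
          "reach (ed ` Q) b = reach (ed ` A') b" "{a, b} = {x, y}" "m \<le> card (reach (ed ` A') a)" for P Q a b
      proof -
        have P: "finite P" "\<And>s. s \<in> P \<Longrightarrow> card (ed s) = 2"
          using *(1) card2 \<open>finite A'\<close> by (auto intro: finite_subset)
        from less.hyps[OF card_less[OF *(1)] P, where x = a] *(4,7)
        obtain B C w where BC: "B \<subseteq> P" "C \<subseteq> P" "B \<inter> C = {}" "w \<in> reach (ed ` A') a"
          "m \<le> card (reach (ed ` B) w)" "card (reach (ed ` A') a) < card (reach (ed ` C) a) + 2 * m" by metis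
        define C' where "C' = insert s (C \<union> Q)"
        have ed: "ed ` C' = insert {a, b} (ed ` (C \<union> Q))" using s(2) *(6) by (auto simp: C'_def)
        have "reach (ed ` C) a \<union> reach (ed ` Q) b \<subseteq> reach (ed ` (C \<union> Q)) a \<union> reach (ed ` (C \<union> Q)) b"
          by (intro Un_mono reach_mono image_mono) auto
        also have "\<dots> = reach (ed ` C') a" unfolding ed reach_insert by simp
        finally have "reach (ed ` C) a \<union> reach (ed ` Q) b \<subseteq> reach (ed ` C') a" .
        moreover have "b \<in> reach (ed ` C') a" by (rule reach_step[OF reach_refl]) (use ed in auto)
        then have "reach (ed ` C') a = reach (ed ` C') x" using *(6) reach_eq by (metis doubleton_eq_iff)
        moreover have "C' \<subseteq> A" using * BC sub A' by (auto simp: C'_def)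
        moreover have "reach (ed ` C) a \<inter> reach (ed ` Q) b = {}"
          using reach_mono[OF image_mono[OF BC(2), of ed], of a] *(4,5,6) dR by (auto simp: doubleton_eq_iff)
        moreover have "finite (reach (ed ` C) a)" "finite (reach (ed ` Q) b)"
          using BC(2) *(1,2) A'(4) by (auto intro!: fin)
        ultimately have "card (reach (ed ` C) a) + card (reach (ed ` Q) b) \<le> card (reach (ed ` C') x)"
          using card_mono[OF fin[of C' x]] by (metis card_Un_disjoint)
        moreover have "card (reach (ed ` A) x) = card (reach (ed ` A') a) + card (reach (ed ` A') b)"
          using *(6) cR by (auto simp: doubleton_eq_iff)
        ultimately have "card (reach (ed ` A) x) < card (reach (ed ` C') x) + 2 * m"
          using BC(6) *(5) by simp
        moreover have "B \<inter> C' = {}" using BC *(1-3) A'(3) by (auto simp: C'_def)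
        moreover have "w \<in> reach (ed ` A) x" using BC(4) *(6) unfolding R by (auto simp: doubleton_eq_iff)
        ultimately show ?thesis
          using BC *(1) A'(4) \<open>C' \<subseteq> A\<close> by (intro exI[of _ B] exI[of _ C'] exI[of _ w]) auto
      qed
      have "A2 \<inter> A1 = {}" "{y, x} = {x, y}" using disj by auto
      then show ?thesis
        using small step[OF sub disj r1 r2 refl] step[OF sub(2,1) _ r2 r1] not_le by blast
    qed
  qed
qed

section \<open>The largest cluster of a finite graph\<close>

lemma max_cluster_size_ge_iff:
  assumes "finite V" "V \<noteq> {}" "\<And>e. e \<in> E \<Longrightarrow> e \<subseteq> V"
  shows "m \<le> max_cluster_size V E \<longleftrightarrow> (\<exists>x\<in>V. m \<le> card (reach E x))"
proof -
  have "clusters V E = reach E ` V"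
    unfolding clusters_def by (intro image_cong refl cluster_eq_reach assms)
  then show ?thesis using assms(1,2)
    by (simp add: max_cluster_size_def image_image Max_ge_iff)
qed

lemma max_cluster_size_mono:
  assumes "finite V" "V \<noteq> {}" "\<And>e. e \<in> F \<Longrightarrow> e \<subseteq> V" "E \<subseteq> F"
  shows "max_cluster_size V E \<le> max_cluster_size V F"
proof -
  have E: "\<And>e. e \<in> E \<Longrightarrow> e \<subseteq> V" using assms(3,4) by auto
  obtain x where x: "x \<in> V" "max_cluster_size V E \<le> card (reach E x)"
    using max_cluster_size_ge_iff[OF assms(1,2) E] by blast
  have "card (reach E x) \<le> card (reach F x)"
    by (intro card_mono reach_mono[OF assms(4)] finite_subset[OF reach_subset[OF assms(3) x(1)] assms(1)])
  then show ?thesis using x max_cluster_size_ge_iff[OF assms(1,2,3)] order_trans by blast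
qed

subsection \<open>Percolation on a finite multigraph\<close>

text \<open>Telescoping layer-cake formula; \<open>1 \<le> q\<close> makes the lowest term
  \<open>0 ^ q\<close> vanish.\<close>

lemma power_eq_layer_sum:
  assumes "k \<le> N" "1 \<le> q"
  shows "real k ^ q = (\<Sum>j\<in>{1..N}. (real j ^ q - real (j - 1) ^ q) * of_bool (j \<le> k))"
proof -
  have "(\<Sum>j\<in>{1..k}. real j ^ q - real (j - 1) ^ q) = real k ^ q"
    using assms(2) by (induction k) auto
  moreover have "(\<Sum>j\<in>{1..N}. (real j ^ q - real (j - 1) ^ q) * of_bool (j \<le> k))
      = (\<Sum>j\<in>{1..k}. real j ^ q - real (j - 1) ^ q)"
    using assms(1) by (intro sum.mono_neutral_cong_right) auto
  ultimately show ?thesis by simp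
qed

text \<open>The factor 2 in front of \<open>a ^ q\<close> matters: it is below \<open>exp 1\<close>,
  so this term can be absorbed after a gain of \<open>exp (- 1)\<close>. For
  \<open>b \<le> a / 8\<close> it suffices that (9/8)^4 < 2; otherwise
  \<open>a + b < 9 * b\<close>.\<close>

lemma power_add_le:
  fixes a b :: real
  assumes "0 \<le> a" "0 \<le> b" "q \<le> 4"
  shows "(a + b) ^ q \<le> 2 * a ^ q + 9 ^ q * b ^ q"
proof (cases "b \<le> a / 8")
  case True
  have "(a + b) ^ q \<le> (9 / 8 * a) ^ q" using True assms by (intro power_mono) auto
  also have "\<dots> = (9 / 8) ^ q * a ^ q" by (rule power_mult_distrib)
  also have "(9 / 8 :: real) ^ q \<le> (9 / 8) ^ 4" using assms(3) by (intro power_increasing) auto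
  then have "(9 / 8) ^ q * a ^ q \<le> 2 * a ^ q"
    using assms(1) by (intro mult_right_mono) (auto simp: power4_eq_xxxx)
  also have "\<dots> \<le> 2 * a ^ q + 9 ^ q * b ^ q" using assms by simp
  finally show ?thesis .
next
  case False
  have "(a + b) ^ q \<le> (9 * b) ^ q" using False assms by (intro power_mono) auto
  also have "\<dots> = 9 ^ q * b ^ q" by (rule power_mult_distrib)
  also have "\<dots> \<le> 2 * a ^ q + 9 ^ q * b ^ q" using assms by simp
  finally show ?thesis .
qed

text \<open>A rational bound below 1/2: absorbing \<open>2 * (2 / 5)\<close> leaves 1/5, which is
  the factor 5 in \<open>size_moment\<close>.\<close>

lemma exp_minus_1_le: "exp (- 1 :: real) \<le> 2 / 5"
proof -
  have "5 / 2 \<le> exp (1 :: real)" using exp_lower_Taylor_quadratic[of 1] by simp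
  then show ?thesis by (simp add: exp_minus field_simps)
qed

text \<open>If the edges lie in \<open>V\<close>, this is the sum of |K|^(q+1) over the clusters K,
  since each vertex of K contributes |K|^q.\<close>

definition moment_sum :: "'v set \<Rightarrow> nat \<Rightarrow> 'v set set \<Rightarrow> real" where
  "moment_sum V q E = (\<Sum>x\<in>V. real (card (reach E x)) ^ q)"

text \<open>Joining clusters of sizes a and b replaces the contributions a^(q+1) and b^(q+1) by
  (a+b)^(q+1); an edge inside a cluster changes nothing.\<close>

lemma moment_sum_insert:
  assumes V: "finite V" and E: "\<And>e. e \<in> E \<Longrightarrow> e \<subseteq> V" and uv: "u \<in> V" "v \<in> V"
  defines "a \<equiv> real (card (reach E u))" and "b \<equiv> real (card (reach E v))"
  shows "moment_sum V q (insert {u, v} E) - moment_sum V q E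
     = of_bool (v \<notin> reach E u) * ((a + b) ^ Suc q - a ^ Suc q - b ^ Suc q)"
proof (cases "v \<in> reach E u")
  case True
  have "reach (insert {u, v} E) x = reach E x" for x
  proof (cases "u \<in> reach E x \<or> v \<in> reach E x")
    case True
    then have "reach E u = reach E x" "reach E v = reach E x"
      using \<open>v \<in> reach E u\<close> by (metis reach_eq)+
    then show ?thesis by (simp add: reach_insert)
  qed (simp add: reach_insert)
  then show ?thesis using True by (simp add: moment_sum_def)
next
  case False
  let ?U = "reach E u" and ?W = "reach E v"
  have sub: "?U \<subseteq> V" "?W \<subseteq> V" using reach_subset[of E V] E uv by blast+
  have fin: "finite ?U" "finite ?W" using sub V by (auto intro: finite_subset)
  have disj: "?U \<inter> ?W = {}" using False by (auto intro: reach_trans dest: reach_sym)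
  let ?d = "\<lambda>x. real (card (reach (insert {u, v} E) x)) ^ q - real (card (reach E x)) ^ q"
  have new: "real (card (reach (insert {u, v} E) x)) = a + b" if "x \<in> ?U \<union> ?W" for x
    using that fin disj by (auto simp: reach_insert card_Un_disjoint a_def b_def dest: reach_sym)
  have old: "real (card (reach E x)) = a" if "x \<in> ?U" for x using reach_eq[OF that] by (simp add: a_def)
  have old': "real (card (reach E x)) = b" if "x \<in> ?W" for x using reach_eq[OF that] by (simp add: b_def)
  have "moment_sum V q (insert {u, v} E) - moment_sum V q E = (\<Sum>x\<in>V. ?d x)"
    by (simp add: moment_sum_def sum_subtractf)
  also have "\<dots> = (\<Sum>x\<in>?U \<union> ?W. ?d x)"
    using V sub by (intro sum.mono_neutral_right) (auto simp: reach_insert dest: reach_sym)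
  also have "\<dots> = (\<Sum>x\<in>?U. ?d x) + (\<Sum>x\<in>?W. ?d x)"
    using fin disj by (intro sum.union_disjoint)
  also have "(\<Sum>x\<in>?U. ?d x) = (\<Sum>x\<in>?U. (a + b) ^ q - a ^ q)"
    by (intro sum.cong refl) (simp add: new old)
  also have "(\<Sum>x\<in>?W. ?d x) = (\<Sum>x\<in>?W. (a + b) ^ q - b ^ q)"
    by (intro sum.cong refl) (simp add: new old')
  finally show ?thesis using False by (simp add: a_def[symmetric] b_def[symmetric] algebra_simps)
qed

lemma sum_two_subsets:
  fixes f :: "'v set \<Rightarrow> real"
  assumes "finite V"
  shows "(\<Sum>e\<in>{e. e \<subseteq> V \<and> card e = 2}. f e) = (\<Sum>u\<in>V. \<Sum>v\<in>V - {u}. f {u, v}) / 2"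
proof -
  let ?P = "Sigma V (\<lambda>u. V - {u})" and ?h = "\<lambda>(u, v). {u, v}"
  have "?h ` ?P = {e. e \<subseteq> V \<and> card e = 2}"
    by (auto simp: card_2_iff image_iff)
  moreover have gen: "(\<Sum>z\<in>?P. f (?h z)) = (\<Sum>e\<in>?h ` ?P. \<Sum>z\<in>{z\<in>?P. ?h z = e}. f (?h z))"
    using assms by (intro sum.image_gen) auto
  moreover have fib: "(\<Sum>z\<in>{z\<in>?P. ?h z = e}. f (?h z)) = 2 * f e" (is "?fib e = _") if "e \<in> ?h ` ?P" for e
  proof -
    from that obtain u v where uv: "u \<in> V" "v \<in> V" "u \<noteq> v" "e = {u, v}" by auto
    then have "{z\<in>?P. ?h z = e} = {(u, v), (v, u)}" by (auto simp: doubleton_eq_iff)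
    then show ?thesis using uv by (simp add: insert_commute)
  qed
  then have "(\<Sum>e\<in>?h ` ?P. ?fib e) = (\<Sum>e\<in>?h ` ?P. 2 * f e)" by (intro sum.cong refl)
  ultimately have "(\<Sum>z\<in>?P. f (?h z)) = 2 * (\<Sum>e\<in>{e. e \<subseteq> V \<and> card e = 2}. f e)"
    by (simp only: sum_distrib_left)
  moreover have "(\<Sum>z\<in>?P. f (?h z)) = (\<Sum>u\<in>V. \<Sum>v\<in>V - {u}. f {u, v})"
    using assms by (subst sum.Sigma) (auto simp: split_def)
  ultimately show ?thesis by simp
qed

text \<open>\<open>ed\<close> need not be injective: a pair of points has one slot for each block
  containing it, and disjoint witnesses are disjoint sets of slots.\<close>

locale finite_percolation =
  fixes V :: "'v set" and I :: "'s set" and ed :: "'s \<Rightarrow> 'v set" and p :: "'s \<Rightarrow> real"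
  assumes finite_V: "finite V" and V_nonempty: "V \<noteq> {}" and finite_I: "finite I"
    and ed_subset: "\<And>s. s \<in> I \<Longrightarrow> ed s \<subseteq> V" and card_ed: "\<And>s. s \<in> I \<Longrightarrow> card (ed s) = 2"
    and p_nonneg: "\<And>s. s \<in> I \<Longrightarrow> 0 \<le> p s" and p_le_1: "\<And>s. s \<in> I \<Longrightarrow> p s \<le> 1"
begin

abbreviation expect :: "('s set \<Rightarrow> real) \<Rightarrow> real" where "expect \<equiv> bexp I p"

abbreviation size_at :: "'s set \<Rightarrow> 'v \<Rightarrow> nat" where "size_at A x \<equiv> card (reach (ed ` A) x)"

abbreviation largest :: "'s set \<Rightarrow> nat" where "largest A \<equiv> max_cluster_size V (ed ` A)"

lemmas expect_mono = bexp_mono[OF p_nonneg p_le_1]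
lemmas expect_nonneg = bexp_nonneg[OF p_nonneg p_le_1]

lemma edges_in_V: "A \<subseteq> I \<Longrightarrow> e \<in> ed ` A \<Longrightarrow> e \<subseteq> V"
  using ed_subset by auto

lemma reach_in_V: "A \<subseteq> I \<Longrightarrow> x \<in> V \<Longrightarrow> reach (ed ` A) x \<subseteq> V"
  using edges_in_V by (intro reach_subset)

lemma finite_reach_ed: "A \<subseteq> I \<Longrightarrow> finite (reach (ed ` A) x)"
proof (rule finite_reach)
  assume A: "A \<subseteq> I"
  show "finite (ed ` A)" using A finite_I by (auto intro: finite_subset)
  show "finite e" if "e \<in> ed ` A" for e using edges_in_V[OF A that] finite_V by (rule finite_subset)
qed

lemma size_at_mono: "A \<subseteq> B \<Longrightarrow> B \<subseteq> I \<Longrightarrow> size_at A x \<le> size_at B x"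
  by (intro card_mono finite_reach_ed reach_mono image_mono)

lemma size_at_le: "A \<subseteq> I \<Longrightarrow> x \<in> V \<Longrightarrow> size_at A x \<le> card V"
  by (intro card_mono finite_V reach_in_V)

lemma size_at_pos: "A \<subseteq> I \<Longrightarrow> 1 \<le> size_at A x"
  using finite_reach_ed[of A x] reach_refl[of x "ed ` A"] by (metis One_nat_def Suc_leI card_gt_0_iff empty_iff)

lemma size_at_sum: "A \<subseteq> I \<Longrightarrow> x \<in> V \<Longrightarrow> real (size_at A x) = (\<Sum>y\<in>V. of_bool (y \<in> reach (ed ` A) x))"
  using reach_in_V[of A x] finite_V by (simp add: sum_of_bool_eq Int_absorb1)

lemma largest_ge_iff: "A \<subseteq> I \<Longrightarrow> m \<le> largest A \<longleftrightarrow> (\<exists>x\<in>V. m \<le> size_at A x)"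
  using edges_in_V finite_V V_nonempty by (intro max_cluster_size_ge_iff) auto

lemma largest_mono: "A \<subseteq> B \<Longrightarrow> B \<subseteq> I \<Longrightarrow> largest A \<le> largest B"
  using edges_in_V finite_V V_nonempty by (intro max_cluster_size_mono) auto

text \<open>By \<open>split_cluster\<close>, a cluster of at least \<open>2 * m + j\<close> vertices
  contains disjoint witnesses for a cluster of size at least \<open>m\<close> somewhere and for one
  of size at least \<open>j\<close> at \<open>x\<close>; then the BK inequality applies.\<close>

lemma size_tail:
  assumes "1 \<le> m" "x \<in> V"
  shows "expect (\<lambda>A. of_bool (2 * m + j \<le> size_at A x))
     \<le> expect (\<lambda>A. of_bool (j \<le> size_at A x)) * expect (\<lambda>A. of_bool (m \<le> largest A))"
proof -
  \<comment> \<open>Intersecting with \<open>I\<close> makes both events monotone on all sets, as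
    \<open>BK_inequality\<close> requires.\<close>
  let ?P = "\<lambda>X. j \<le> size_at (X \<inter> I) x" and ?R = "\<lambda>X. m \<le> largest (X \<inter> I)"
  have "expect (\<lambda>A. of_bool (2 * m + j \<le> size_at A x))
     \<le> expect (\<lambda>A. of_bool (\<exists>X Y. X \<subseteq> A \<and> Y \<subseteq> A \<and> X \<inter> Y = {} \<and> ?P X \<and> ?R Y))"
  proof (rule expect_mono)
    fix A assume A: "A \<subseteq> I"
    have "\<exists>X Y. X \<subseteq> A \<and> Y \<subseteq> A \<and> X \<inter> Y = {} \<and> ?P X \<and> ?R Y" if big: "2 * m + j \<le> size_at A x"
    proof -
      have "finite A" "\<And>s. s \<in> A \<Longrightarrow> card (ed s) = 2"
        using A finite_I card_ed by (auto intro: finite_subset)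
      from split_cluster[of A ed m x, OF this assms(1)] big obtain B C w where
        BC: "B \<subseteq> A" "C \<subseteq> A" "B \<inter> C = {}" "w \<in> reach (ed ` A) x" "m \<le> size_at B w"
          "size_at A x < size_at C x + 2 * m" by auto
      have "w \<in> V" using BC(4) reach_in_V[OF A assms(2)] by auto
      then have "?R B" using BC A largest_ge_iff[of B m] by (auto simp: Int_absorb2)
      moreover have "?P C" using BC A big by (auto simp: Int_absorb2)
      ultimately show ?thesis using BC by blast
    qed
    then show "of_bool (2 * m + j \<le> size_at A x)
      \<le> (of_bool (\<exists>X Y. X \<subseteq> A \<and> Y \<subseteq> A \<and> X \<inter> Y = {} \<and> ?P X \<and> ?R Y) :: real)" by auto
  qed
  also have "\<dots> \<le> expect (\<lambda>A. of_bool (?P A)) * expect (\<lambda>A. of_bool (?R A))"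
  proof (rule BK_inequality[OF finite_I p_nonneg p_le_1])
    show "?P X'" if "?P X" "X \<subseteq> X'" for X X'
      using that(1) size_at_mono[of "X \<inter> I" "X' \<inter> I" x] that(2) by fastforce
    show "?R X'" if "?R X" "X \<subseteq> X'" for X X'
      using that(1) largest_mono[of "X \<inter> I" "X' \<inter> I"] that(2) by fastforce
  qed
  also have "expect (\<lambda>A. of_bool (?P A)) = expect (\<lambda>A. of_bool (j \<le> size_at A x))"
    by (intro bexp_cong) (simp_all add: Int_absorb2)
  also have "expect (\<lambda>A. of_bool (?R A)) = expect (\<lambda>A. of_bool (m \<le> largest A))"
    by (intro bexp_cong) (simp_all add: Int_absorb2)
  finally show ?thesis .
qed

text \<open>By \<open>size_tail\<close> the overshoot of |K| over 2m has a \<open>q\<close>-th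
  moment at most \<open>exp (- 1)\<close> times that of |K|. Writing |K| as overshoot plus min(|K|,
  2m) and absorbing the overshoot leaves \<open>q - r\<close> powers of 2m.\<close>

lemma size_moment:
  assumes m: "1 \<le> m" "expect (\<lambda>A. of_bool (m \<le> largest A)) \<le> exp (- 1)"
    and x: "x \<in> V" and rq: "1 \<le> r" "r \<le> q" "q \<le> 4"
  shows "expect (\<lambda>A. real (size_at A x) ^ q)
      \<le> 5 * 9 ^ q * (2 * real m) ^ (q - r) * expect (\<lambda>A. real (size_at A x) ^ r)"
proof -
  let ?K = "\<lambda>A. size_at A x" and ?N = "card V"
  let ?c = "\<lambda>j. real j ^ q - real (j - 1) ^ q"
  have q: "1 \<le> q" using rq by simp
  have layer: "expect (\<lambda>A. real (g (?K A)) ^ q) = (\<Sum>j\<in>{1..?N}. ?c j * expect (\<lambda>A. of_bool (j \<le> g (?K A))))"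
    if "\<And>k. g k \<le> k" for g
  proof -
    have "expect (\<lambda>A. real (g (?K A)) ^ q) = expect (\<lambda>A. \<Sum>j\<in>{1..?N}. ?c j * of_bool (j \<le> g (?K A)))"
      using size_at_le[OF _ x] that q
      by (intro bexp_cong power_eq_layer_sum refl) (auto intro: order_trans)
    then show ?thesis by (simp only: bexp_sum bexp_cmult)
  qed
  have "expect (\<lambda>A. real (?K A - 2 * m) ^ q)
      = (\<Sum>j\<in>{1..?N}. ?c j * expect (\<lambda>A. of_bool (j \<le> ?K A - 2 * m)))"
    by (rule layer) simp
  also have "\<dots> \<le> (\<Sum>j\<in>{1..?N}. ?c j * (exp (- 1) * expect (\<lambda>A. of_bool (j \<le> ?K A))))"
  proof (intro sum_mono mult_left_mono)
    fix j assume j: "j \<in> {1..?N}"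
    then have "expect (\<lambda>A. of_bool (j \<le> ?K A - 2 * m)) = expect (\<lambda>A. of_bool (2 * m + j \<le> ?K A))"
      by (intro bexp_cong arg_cong[of _ _ of_bool]) auto
    also have "\<dots> \<le> expect (\<lambda>A. of_bool (j \<le> ?K A)) * expect (\<lambda>A. of_bool (m \<le> largest A))"
      using m(1) x by (rule size_tail)
    also have "\<dots> \<le> expect (\<lambda>A. of_bool (j \<le> ?K A)) * exp (- 1)"
      by (intro mult_left_mono m(2) expect_nonneg) auto
    finally show "expect (\<lambda>A. of_bool (j \<le> ?K A - 2 * m)) \<le> exp (- 1) * expect (\<lambda>A. of_bool (j \<le> ?K A))"
      by (simp add: mult.commute)
    show "0 \<le> ?c j" by (simp add: power_mono)
  qed
  also have "\<dots> = exp (- 1) * expect (\<lambda>A. real (?K A) ^ q)"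
    using layer[of "\<lambda>k. k"] by (simp add: sum_distrib_left mult_ac)
  finally have tail: "expect (\<lambda>A. real (?K A - 2 * m) ^ q) \<le> exp (- 1) * expect (\<lambda>A. real (?K A) ^ q)" .
  have "expect (\<lambda>A. real (?K A) ^ q)
      \<le> expect (\<lambda>A. 2 * real (?K A - 2 * m) ^ q + 9 ^ q * (2 * real m) ^ (q - r) * real (?K A) ^ r)"
  proof (rule expect_mono)
    fix A
    let ?b = "min (real (?K A)) (2 * real m)"
    have "real (?K A) = real (?K A - 2 * m) + ?b" by (auto simp: min_def of_nat_diff)
    then have "real (?K A) ^ q \<le> 2 * real (?K A - 2 * m) ^ q + 9 ^ q * ?b ^ q"
      using power_add_le[of "real (?K A - 2 * m)" ?b q] rq by simp
    also have "?b ^ q = ?b ^ (q - r) * ?b ^ r" using rq by (simp flip: power_add)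
    also have "\<dots> \<le> (2 * real m) ^ (q - r) * real (?K A) ^ r"
      by (intro mult_mono power_mono) auto
    finally show "real (?K A) ^ q \<le> 2 * real (?K A - 2 * m) ^ q + 9 ^ q * (2 * real m) ^ (q - r) * real (?K A) ^ r"
      by (simp add: mult.assoc)
  qed
  also have "\<dots> \<le> 2 * (exp (- 1) * expect (\<lambda>A. real (?K A) ^ q))
      + 9 ^ q * (2 * real m) ^ (q - r) * expect (\<lambda>A. real (?K A) ^ r)"
    using tail by (simp add: bexp_add bexp_cmult)
  also have "\<dots> \<le> 2 * (2 / 5 * expect (\<lambda>A. real (?K A) ^ q))
      + 9 ^ q * (2 * real m) ^ (q - r) * expect (\<lambda>A. real (?K A) ^ r)"
    by (intro add_mono mult_left_mono mult_right_mono exp_minus_1_le expect_nonneg) auto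
  finally show ?thesis by (simp add: field_simps)
qed

text \<open>If \<open>u\<close> and \<open>v\<close> lie in different clusters, the connections from
  \<open>u\<close> to \<open>y\<close> and from \<open>v\<close> to \<open>z\<close> have disjoint
  witnesses, the slots touching each cluster. BK and summation over \<open>y\<close> and
  \<open>z\<close> give the product of the means.\<close>

lemma size_pair_upper:
  assumes "u \<in> V" "v \<in> V"
  shows "expect (\<lambda>A. of_bool (v \<notin> reach (ed ` A) u) * (real (size_at A u) * real (size_at A v)))
      \<le> expect (\<lambda>A. real (size_at A u)) * expect (\<lambda>A. real (size_at A v))"
proof -
  let ?D = "\<lambda>y z A. \<exists>X Y. X \<subseteq> A \<and> Y \<subseteq> A \<and> X \<inter> Y = {} \<and> y \<in> reach (ed ` X) u \<and> z \<in> reach (ed ` Y) v"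
  have "expect (\<lambda>A. of_bool (v \<notin> reach (ed ` A) u) * (real (size_at A u) * real (size_at A v)))
      \<le> expect (\<lambda>A. \<Sum>y\<in>V. \<Sum>z\<in>V. of_bool (?D y z A))"
  proof (rule expect_mono)
    fix A assume A: "A \<subseteq> I"
    have D: "?D y z A" if "v \<notin> reach (ed ` A) u" "y \<in> reach (ed ` A) u" "z \<in> reach (ed ` A) v" for y z
    proof (intro exI conjI)
      show "{s \<in> A. ed s \<inter> reach (ed ` A) u \<noteq> {}} \<inter> {s \<in> A. ed s \<inter> reach (ed ` A) v \<noteq> {}} = {}"
        using A card_ed that by (intro touching_disjoint) auto
    qed (use that in \<open>auto simp: reach_restrict_image\<close>)
    have "of_bool (v \<notin> reach (ed ` A) u) * (real (size_at A u) * real (size_at A v))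
      = (\<Sum>y\<in>V. \<Sum>z\<in>V. of_bool (v \<notin> reach (ed ` A) u) *
          (of_bool (y \<in> reach (ed ` A) u) * of_bool (z \<in> reach (ed ` A) v)))"
      by (simp only: size_at_sum[OF A assms(1)] size_at_sum[OF A assms(2)] sum_product, simp only: sum_distrib_left)
    also have "\<dots> \<le> (\<Sum>y\<in>V. \<Sum>z\<in>V. of_bool (?D y z A))"
    proof (intro sum_mono)
      have le_of_bool: "of_bool a * (of_bool b * of_bool c) \<le> (of_bool d :: real)" if d for a b c d
        using that by (simp add: of_bool_def)
      fix y z
      show "of_bool (v \<notin> reach (ed ` A) u) * (of_bool (y \<in> reach (ed ` A) u) * of_bool (z \<in> reach (ed ` A) v))
        \<le> (of_bool (?D y z A) :: real)"
      proof (cases "v \<notin> reach (ed ` A) u \<and> y \<in> reach (ed ` A) u \<and> z \<in> reach (ed ` A) v")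
        case True
        then have "?D y z A" by (elim conjE) (rule D)
        then show ?thesis by (rule le_of_bool)
      next
        case False
        then have "of_bool (v \<notin> reach (ed ` A) u) * (of_bool (y \<in> reach (ed ` A) u) * of_bool (z \<in> reach (ed ` A) v)) = (0 :: real)"
          by (auto simp del: ex_simps)
        then show ?thesis by (simp only: of_bool_def split: if_split) simp
      qed
    qed
    finally show "of_bool (v \<notin> reach (ed ` A) u) * (real (size_at A u) * real (size_at A v))
      \<le> (\<Sum>y\<in>V. \<Sum>z\<in>V. of_bool (?D y z A))" .
  qed
  also have "\<dots> = (\<Sum>y\<in>V. \<Sum>z\<in>V. expect (\<lambda>A. of_bool (?D y z A)))"
    by (simp only: bexp_sum)
  also have "\<dots> \<le> (\<Sum>y\<in>V. \<Sum>z\<in>V. expect (\<lambda>A. of_bool (y \<in> reach (ed ` A) u))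
      * expect (\<lambda>A. of_bool (z \<in> reach (ed ` A) v)))"
  proof (intro sum_mono BK_inequality[OF finite_I p_nonneg p_le_1])
    show "y \<in> reach (ed ` X') x" if "y \<in> reach (ed ` X) x" "X \<subseteq> X'" for X X' x y
      using reach_mono[OF image_mono[OF that(2)]] that(1) by (rule subsetD)
    then show "z \<in> reach (ed ` X') x" if "z \<in> reach (ed ` X) x" "X \<subseteq> X'" for X X' x z
      using that by this
  qed
  also have "\<dots> = (\<Sum>y\<in>V. expect (\<lambda>A. of_bool (y \<in> reach (ed ` A) u)))
      * (\<Sum>z\<in>V. expect (\<lambda>A. of_bool (z \<in> reach (ed ` A) v)))"
    by (simp only: sum_product)
  also have "\<dots> = expect (\<lambda>A. real (size_at A u)) * expect (\<lambda>A. real (size_at A v))"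
    unfolding bexp_sum[symmetric] using assms
    by (intro arg_cong2[where f = "(*)"] bexp_cong size_at_sum[symmetric] refl)
  finally show ?thesis .
qed

lemma size_pair_lower:
  "expect (\<lambda>A. real (size_at A u) ^ i) * expect (\<lambda>A. real (size_at A v) ^ j)
      \<le> expect (\<lambda>A. real (size_at A u) ^ i * real (size_at A v) ^ j)"
  by (intro Harris_inequality[OF finite_I p_nonneg p_le_1] power_mono)
     (auto simp: size_at_mono)

end

subsection \<open>Turning on the edges of the top block\<close>

text \<open>\<open>J\<close> stands for the slots inside the sub-blocks of \<open>V\<close> and
  \<open>T\<close> for those of \<open>V\<close> itself, one per pair; the time \<open>t\<close> is
  the rate at which the latter open.\<close>

locale block_step =
  fixes V :: "'v set" and J T :: "'s set" and ed :: "'s \<Rightarrow> 'v set" and p :: "'s \<Rightarrow> real"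
  assumes fin: "finite V" "V \<noteq> {}" "finite J" "finite T" and disj: "J \<inter> T = {}"
    and ed_sub: "\<And>s. s \<in> J \<Longrightarrow> ed s \<subseteq> V" and ed_card: "\<And>s. s \<in> J \<Longrightarrow> card (ed s) = 2"
    and inj: "inj_on ed T" and ed_T: "ed ` T = {e. e \<subseteq> V \<and> card e = 2}"
    and p: "\<And>s. s \<in> J \<Longrightarrow> 0 \<le> p s" "\<And>s. s \<in> J \<Longrightarrow> p s \<le> 1"
begin

abbreviation "ex t \<equiv> bexp (J \<union> T) (dial T p t)"
abbreviation "Kc A x \<equiv> real (card (reach (ed ` A) x))"
abbreviation "Lc A \<equiv> max_cluster_size V (ed ` A)"

definition mom :: "nat \<Rightarrow> real \<Rightarrow> real" where
  "mom q t = ex t (\<lambda>A. moment_sum V q (ed ` A))"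

lemma ed_T': "s \<in> T \<Longrightarrow> ed s \<subseteq> V \<and> card (ed s) = 2"
  using ed_T by auto

lemma perc: "0 \<le> t \<Longrightarrow> finite_percolation V (J \<union> T) ed (dial T p t)"
  using fin ed_sub ed_card ed_T' p by unfold_locales (auto simp: dial_def)

lemma ed_image_subset: "A \<subseteq> J \<union> T \<Longrightarrow> e \<in> ed ` A \<Longrightarrow> e \<subseteq> V"
  using ed_sub ed_T' by blast

lemma expect_mono_rate:
  assumes "0 \<le> t" "t \<le> t'" and f: "\<And>A B. A \<subseteq> B \<Longrightarrow> B \<subseteq> J \<union> T \<Longrightarrow> f A \<le> f B"
  shows "ex t f \<le> ex t' f"
proof (rule DERIV_nonneg_imp_nondecreasing[OF assms(2)])
  fix x assume "t \<le> x" "x \<le> t'"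
  then have x: "0 \<le> x" using assms(1) by simp
  interpret finite_percolation V "J \<union> T" ed "dial T p x" by (rule perc[OF x])
  have "0 \<le> (\<Sum>e\<in>T. ex x (\<lambda>A. f (insert e A) - f A))"
    by (intro sum_nonneg expect_nonneg) (auto intro!: f)
  then show "\<exists>y. ((\<lambda>t. ex t f) has_real_derivative y) (at x) \<and> 0 \<le> y"
    using Russo_formula[OF fin(3,4) subset_refl disj] by blast
qed

text \<open>Russo's formula with the increments of \<open>moment_sum_insert\<close>. Passing from
  unordered to ordered pairs gives the factor 1/2, and diagonal pairs drop out because
  \<open>u\<close> is connected to itself.\<close>

lemma mom_deriv:
  "(mom q has_real_derivative
     (\<Sum>u\<in>V. \<Sum>v\<in>V. ex t (\<lambda>A. of_bool (v \<notin> reach (ed ` A) u) *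
        ((Kc A u + Kc A v) ^ Suc q - Kc A u ^ Suc q - Kc A v ^ Suc q))) / 2) (at t)"
proof -
  let ?g = "\<lambda>u v A. of_bool (v \<notin> reach (ed ` A) u) *
        ((Kc A u + Kc A v) ^ Suc q - Kc A u ^ Suc q - Kc A v ^ Suc q)"
  have "(\<Sum>e\<in>T. moment_sum V q (ed ` insert e A) - moment_sum V q (ed ` A)) = (\<Sum>u\<in>V. \<Sum>v\<in>V. ?g u v A) / 2"
    if A: "A \<subseteq> J \<union> T" for A
  proof -
    let ?f = "\<lambda>e. moment_sum V q (insert e (ed ` A)) - moment_sum V q (ed ` A)"
    have "(\<Sum>e\<in>T. moment_sum V q (ed ` insert e A) - moment_sum V q (ed ` A)) = (\<Sum>e\<in>ed ` T. ?f e)"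
      by (simp add: sum.reindex[OF inj])
    also have "\<dots> = (\<Sum>u\<in>V. \<Sum>v\<in>V - {u}. ?f {u, v}) / 2"
      unfolding ed_T by (rule sum_two_subsets[OF fin(1)])
    also have "(\<Sum>u\<in>V. \<Sum>v\<in>V - {u}. ?f {u, v}) = (\<Sum>u\<in>V. \<Sum>v\<in>V - {u}. ?g u v A)"
      using ed_image_subset[OF A] by (intro sum.cong refl moment_sum_insert fin(1)) auto
    also have "\<dots> = (\<Sum>u\<in>V. \<Sum>v\<in>V. ?g u v A)"
      using fin(1) by (intro sum.cong refl sum.mono_neutral_left) auto
    finally show ?thesis .
  qed
  then have "(\<Sum>e\<in>T. ex t (\<lambda>A. moment_sum V q (ed ` insert e A) - moment_sum V q (ed ` A)))
      = ex t (\<lambda>A. (\<Sum>u\<in>V. \<Sum>v\<in>V. ?g u v A) / 2)"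
    unfolding bexp_sum[symmetric] by (intro bexp_cong refl)
  also have "\<dots> = (\<Sum>u\<in>V. \<Sum>v\<in>V. ex t (?g u v)) / 2"
    by (simp only: divide_inverse bexp_multc bexp_sum)
  finally have eq: "(\<Sum>e\<in>T. ex t (\<lambda>A. moment_sum V q (ed ` insert e A) - moment_sum V q (ed ` A)))
      = (\<Sum>u\<in>V. \<Sum>v\<in>V. ex t (?g u v)) / 2" .
  show ?thesis unfolding mom_def[abs_def] eq[symmetric]
    by (rule Russo_formula[OF fin(3,4) subset_refl disj])
qed

lemma mom_conv_sum: "mom q t = (\<Sum>x\<in>V. ex t (\<lambda>A. Kc A x ^ q))"
  by (simp add: mom_def moment_sum_def bexp_sum)

text \<open>A given \<open>u\<close> meets \<open>Kc A u\<close> vertices \<open>v\<close> in its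
  cluster, each contributing \<open>Kc A u ^ (i + 1)\<close>.\<close>

lemma same_cluster_sum:
  assumes "A \<subseteq> J \<union> T"
  shows "(\<Sum>u\<in>V. \<Sum>v\<in>V. of_bool (v \<in> reach (ed ` A) u) * (Kc A u ^ i * Kc A v)) = moment_sum V (i + 2) (ed ` A)"
  unfolding moment_sum_def
proof (intro sum.cong refl)
  fix u assume u: "u \<in> V"
  interpret finite_percolation V "J \<union> T" ed "dial T p 0" by (rule perc) simp
  have "(\<Sum>v\<in>V. of_bool (v \<in> reach (ed ` A) u) * (Kc A u ^ i * Kc A v))
      = (\<Sum>v\<in>V. of_bool (v \<in> reach (ed ` A) u) * (Kc A u ^ i * Kc A u))"
    by (intro sum.cong refl) (auto dest: reach_eq)
  also have "\<dots> = Kc A u * (Kc A u ^ i * Kc A u)"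
    using assms u by (simp only: size_at_sum sum_distrib_right)
  finally show "(\<Sum>v\<in>V. of_bool (v \<in> reach (ed ` A) u) * (Kc A u ^ i * Kc A v)) = Kc A u ^ (i + 2)"
    by (simp add: algebra_simps)
qed

text \<open>Harris bounds the sum over all pairs from below by a product of moments; the pairs in a
  common cluster, worth \<open>mom (i + 2) t\<close>, are then removed.\<close>

lemma distinct_pair_lower:
  assumes t: "0 \<le> t"
  shows "mom i t * mom 1 t - mom (i + 2) t
      \<le> (\<Sum>u\<in>V. \<Sum>v\<in>V. ex t (\<lambda>A. of_bool (v \<notin> reach (ed ` A) u) * (Kc A u ^ i * Kc A v)))"
proof -
  interpret finite_percolation V "J \<union> T" ed "dial T p t" by (rule perc[OF t])
  have "mom i t * mom 1 t = (\<Sum>u\<in>V. \<Sum>v\<in>V. ex t (\<lambda>A. Kc A u ^ i) * ex t (\<lambda>A. Kc A v ^ 1))"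
    unfolding mom_conv_sum by (rule sum_product)
  also have "\<dots> \<le> (\<Sum>u\<in>V. \<Sum>v\<in>V. ex t (\<lambda>A. Kc A u ^ i * Kc A v ^ 1))"
    by (intro sum_mono size_pair_lower)
  also have "\<dots> = (\<Sum>u\<in>V. \<Sum>v\<in>V. ex t (\<lambda>A. of_bool (v \<notin> reach (ed ` A) u) * (Kc A u ^ i * Kc A v)
      + of_bool (v \<in> reach (ed ` A) u) * (Kc A u ^ i * Kc A v)))"
    by (intro sum.cong refl bexp_cong) auto
  also have "\<dots> = (\<Sum>u\<in>V. \<Sum>v\<in>V. ex t (\<lambda>A. of_bool (v \<notin> reach (ed ` A) u) * (Kc A u ^ i * Kc A v)))
      + ex t (\<lambda>A. \<Sum>u\<in>V. \<Sum>v\<in>V. of_bool (v \<in> reach (ed ` A) u) * (Kc A u ^ i * Kc A v))"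
    by (simp only: bexp_add sum.distrib bexp_sum)
  also have "ex t (\<lambda>A. \<Sum>u\<in>V. \<Sum>v\<in>V. of_bool (v \<in> reach (ed ` A) u) * (Kc A u ^ i * Kc A v)) = mom (i + 2) t"
    unfolding mom_def by (intro bexp_cong same_cluster_sum refl)
  finally show ?thesis by simp
qed

text \<open>For \<open>q = 1\<close> the increment is 2ab, which cancels the factor 1/2. The sum
  over pairs in distinct clusters is bounded above by BK and below by Harris.\<close>

lemma mom1_deriv:
  assumes t: "0 \<le> t"
  obtains D where "(mom 1 has_real_derivative D) (at t)" "0 \<le> D" "D \<le> (mom 1 t)\<^sup>2" "(mom 1 t)\<^sup>2 - mom 3 t \<le> D"
proof -
  interpret finite_percolation V "J \<union> T" ed "dial T p t" by (rule perc[OF t])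
  define D where "D = (\<Sum>u\<in>V. \<Sum>v\<in>V. ex t (\<lambda>A. of_bool (v \<notin> reach (ed ` A) u) * (Kc A u * Kc A v)))"
  have eq: "of_bool P * ((a + b) ^ Suc 1 - a ^ Suc 1 - b ^ Suc 1) = (of_bool P * (a * b)) * 2"
    for P and a b :: real by (simp add: power2_eq_square algebra_simps)
  have "(mom 1 has_real_derivative D) (at t)"
    using mom_deriv[of 1 t] unfolding eq bexp_multc D_def sum_distrib_right[symmetric] by simp
  moreover have "0 \<le> D" unfolding D_def by (intro sum_nonneg expect_nonneg) auto
  moreover have "D \<le> (mom 1 t)\<^sup>2"
  proof -
    have "D \<le> (\<Sum>u\<in>V. \<Sum>v\<in>V. ex t (\<lambda>A. Kc A u) * ex t (\<lambda>A. Kc A v))"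
      unfolding D_def by (intro sum_mono size_pair_upper)
    also have "\<dots> = (mom 1 t)\<^sup>2" by (simp add: mom_conv_sum power2_eq_square sum_product)
    finally show ?thesis .
  qed
  moreover have "(mom 1 t)\<^sup>2 - mom 3 t \<le> D"
    using distinct_pair_lower[OF t, of 1] by (simp add: D_def power2_eq_square numeral_3_eq_3)
  ultimately show ?thesis using that by blast
qed

text \<open>The increment is 3a^2b + 3ab^2, and exchanging \<open>u\<close> and \<open>v\<close>
  shows that both halves have the same sum.\<close>

lemma mom2_deriv:
  assumes t: "0 \<le> t"
  obtains D where "(mom 2 has_real_derivative D) (at t)" "3 * (mom 2 t * mom 1 t - mom 4 t) \<le> D"
proof -
  let ?g = "\<lambda>u v A. of_bool (v \<notin> reach (ed ` A) u) * (Kc A u ^ 2 * Kc A v)"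
  define D where "D = (\<Sum>u\<in>V. \<Sum>v\<in>V. ex t (?g u v))"
  have "of_bool (v \<notin> reach (ed ` A) u) * ((Kc A u + Kc A v) ^ Suc 2 - Kc A u ^ Suc 2 - Kc A v ^ Suc 2)
      = 3 * ?g u v A + 3 * ?g v u A" for u v A
    by (auto simp: power2_eq_square algebra_simps eval_nat_numeral dest: reach_sym)
  then have "(mom 2 has_real_derivative (\<Sum>u\<in>V. \<Sum>v\<in>V. ex t (\<lambda>A. 3 * ?g u v A + 3 * ?g v u A)) / 2) (at t)"
    using mom_deriv[of 2 t] by simp
  also have "(\<Sum>u\<in>V. \<Sum>v\<in>V. ex t (\<lambda>A. 3 * ?g u v A + 3 * ?g v u A))
      = 3 * D + 3 * (\<Sum>u\<in>V. \<Sum>v\<in>V. ex t (?g v u))"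
    unfolding D_def by (simp only: bexp_add bexp_cmult sum.distrib sum_distrib_left)
  also have "(\<Sum>u\<in>V. \<Sum>v\<in>V. ex t (?g v u)) = D"
    unfolding D_def by (rule sum.swap)
  finally have "(mom 2 has_real_derivative 3 * D) (at t)" by simp
  moreover have "mom 2 t * mom 1 t - mom 4 t \<le> D"
    using distinct_pair_lower[OF t, of 2] by (simp add: D_def)
  ultimately show ?thesis using that by auto
qed

section \<open>Integrating the differential inequalities in time\<close>

lemma mom_pos: "0 \<le> t \<Longrightarrow> 0 < mom q t"
proof -
  assume t: "0 \<le> t"
  interpret finite_percolation V "J \<union> T" ed "dial T p t" by (rule perc[OF t])
  have "1 \<le> ex t (\<lambda>A. Kc A x ^ q)" for x
  proof -
    have "ex t (\<lambda>A. 1) \<le> ex t (\<lambda>A. Kc A x ^ q)"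
    proof (intro expect_mono one_le_power)
      fix A assume "A \<subseteq> J \<union> T"
      then have "1 \<le> card (reach (ed ` A) x)" by (rule size_at_pos)
      then show "1 \<le> Kc A x" by linarith
    qed
    then show ?thesis using finite_I by (simp add: bexp_const)
  qed
  then have "(\<Sum>x\<in>V. 1) \<le> mom q t" unfolding mom_conv_sum by (intro sum_mono)
  then show "0 < mom q t" using fin by (simp add: card_gt_0_iff order_less_le_trans[rotated])
qed

text \<open>This is s1' <= s1^2 in the form (1/s1)' >= -1, integrated. The reciprocal form remains
  meaningful when the comparison solution blows up.\<close>

lemma mom1_inverse_bound:
  assumes "0 \<le> \<tau>"
  shows "1 / mom 1 0 - \<tau> \<le> 1 / mom 1 \<tau>"
proof -
  have "1 / mom 1 0 + 0 \<le> 1 / mom 1 \<tau> + \<tau>"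
  proof (rule DERIV_nonneg_imp_nondecreasing[OF assms])
    fix x :: real assume x: "0 \<le> x"
    obtain D where D: "(mom 1 has_real_derivative D) (at x)" "D \<le> (mom 1 x)\<^sup>2" using mom1_deriv[OF x] .
    have "((\<lambda>t. 1 / mom 1 t + t) has_real_derivative (- D / (mom 1 x)\<^sup>2 + 1)) (at x)"
      using mom_pos[OF x, of 1] by (auto intro!: derivative_eq_intros D(1) simp: power2_eq_square simp del: One_nat_def)
    moreover have "0 \<le> - D / (mom 1 x)\<^sup>2 + 1" using D(2) mom_pos[OF x, of 1] by (simp add: field_simps)
    ultimately show "\<exists>y. ((\<lambda>t. 1 / mom 1 t + t) has_real_derivative y) (at x) \<and> 0 \<le> y" by blast
  qed
  then show ?thesis by simp
qed

text \<open>The constant is \<open>131220 = 5 * 9\<^sup>4 * 2\<^sup>2\<close>, from the tail bound for fourth moments.\<close>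

context
  fixes \<tau> :: real and m :: nat and b :: real
  assumes \<tau>: "0 \<le> \<tau>" and m: "1 \<le> m" and quantile: "ex \<tau> (\<lambda>A. of_bool (m \<le> Lc A)) \<le> exp (- 1)"
  defines "b \<equiv> 131220 * (real m)\<^sup>2"
begin

text \<open>The quantile bound at the final time also holds at earlier times, since the largest
  cluster grows with the rate; \<open>size_moment\<close> then trades two powers of the cluster size
  for \<open>b\<close>.\<close>

lemma mom_reduce:
  assumes t: "0 \<le> t" "t \<le> \<tau>" and r: "1 \<le> r" "r \<le> 2"
  shows "mom (r + 2) t \<le> b * mom r t"
proof -
  interpret finite_percolation V "J \<union> T" ed "dial T p t" by (rule perc[OF t(1)])
  have "ex t (\<lambda>A. of_bool (m \<le> Lc A)) \<le> ex \<tau> (\<lambda>A. of_bool (m \<le> Lc A))"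
    using t largest_mono by (intro expect_mono_rate) (auto intro: order_trans)
  then have q: "ex t (\<lambda>A. of_bool (m \<le> Lc A)) \<le> exp (- 1)" using quantile by simp
  have "mom (r + 2) t \<le> (\<Sum>x\<in>V. b * ex t (\<lambda>A. Kc A x ^ r))"
    unfolding mom_conv_sum
  proof (intro sum_mono)
    fix x assume x: "x \<in> V"
    have "ex t (\<lambda>A. Kc A x ^ (r + 2)) \<le> 5 * 9 ^ (r + 2) * (2 * real m) ^ (r + 2 - r) * ex t (\<lambda>A. Kc A x ^ r)"
      using r by (intro size_moment m q x) auto
    also have "\<dots> \<le> b * ex t (\<lambda>A. Kc A x ^ r)"
    proof (rule mult_right_mono)
      have "(9 :: real) ^ (r + 2) \<le> 9 ^ 4" using r by (intro power_increasing) auto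
      then have "20 * 9 ^ (r + 2) * (real m)\<^sup>2 \<le> 20 * 9 ^ 4 * (real m)\<^sup>2"
        by (intro mult_right_mono mult_left_mono) auto
      then show "5 * 9 ^ (r + 2) * (2 * real m) ^ (r + 2 - r) \<le> b"
        by (simp add: b_def power2_eq_square algebra_simps)
    qed (intro expect_nonneg, auto)
    finally show "ex t (\<lambda>A. Kc A x ^ (r + 2)) \<le> b * ex t (\<lambda>A. Kc A x ^ r)" .
  qed
  then show ?thesis by (simp add: mom_conv_sum sum_distrib_left)
qed

text \<open>If \<open>mom 1 0\<close> is at least \<open>2 * b\<close>, then s3 <= s1^2 / 2
  throughout, so 1/s1 decreases at rate at least 1/2. That it is still positive at \<tau> forces
  \<open>\<tau> * mom 1 0 < 2\<close>.\<close>

lemma mom1_start_bound: "\<tau> * mom 1 0 \<le> max 2 (2 * b * \<tau>)"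
proof (rule ccontr)
  assume "\<not> ?thesis"
  then have large: "2 < \<tau> * mom 1 0" "2 * b * \<tau> < \<tau> * mom 1 0" by auto
  then have "0 < \<tau>" using \<tau> by (cases "\<tau> = 0") auto
  then have b: "2 * b \<le> mom 1 0" using large(2) by (simp add: mult.commute)
  have up: "mom 1 0 \<le> mom 1 x" if "0 \<le> x" for x
  proof (rule DERIV_nonneg_imp_nondecreasing[OF that])
    fix y :: real assume "0 \<le> y"
    from mom1_deriv[OF this] show "\<exists>z. (mom 1 has_real_derivative z) (at y) \<and> 0 \<le> z" by metis
  qed
  have "1 / mom 1 \<tau> + \<tau> / 2 \<le> 1 / mom 1 0 + 0 / 2"
  proof (rule DERIV_nonpos_imp_nonincreasing[OF \<tau>])
    fix x :: real assume x: "0 \<le> x" "x \<le> \<tau>"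
    obtain D where D: "(mom 1 has_real_derivative D) (at x)" "(mom 1 x)\<^sup>2 - mom 3 x \<le> D"
      using mom1_deriv[OF x(1)] .
    have pos: "0 < mom 1 x" by (rule mom_pos[OF x(1)])
    have "mom 3 x \<le> b * mom 1 x" using mom_reduce[OF x, of 1] by (simp add: numeral_3_eq_3)
    also have "\<dots> \<le> mom 1 x / 2 * mom 1 x" using b up[OF x(1)] pos by (intro mult_right_mono) auto
    finally have D2: "(mom 1 x)\<^sup>2 / 2 \<le> D" using D(2) by (simp add: power2_eq_square)
    have "((\<lambda>t. 1 / mom 1 t + t / 2) has_real_derivative (- D / (mom 1 x)\<^sup>2 + 1 / 2)) (at x)"
      using pos by (auto intro!: derivative_eq_intros D(1) simp: power2_eq_square simp del: One_nat_def)
    moreover have "- D / (mom 1 x)\<^sup>2 + 1 / 2 \<le> 0" using D2 pos by (simp add: field_simps)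
    ultimately show "\<exists>y. ((\<lambda>t. 1 / mom 1 t + t / 2) has_real_derivative y) (at x) \<and> y \<le> 0" by blast
  qed
  moreover have "0 < 1 / mom 1 \<tau>" using mom_pos[OF \<tau>, of 1] by simp
  ultimately have "\<tau> / 2 < 1 / mom 1 0" by linarith
  then show False using large(1) mom_pos[of 0 1] by (simp add: field_simps)
qed

text \<open>The logarithmic derivative of s2/s1^3 is at least 3(s1 - b) - 3 s1 = -3b: the leading
  growth of s2 and of s1^3 cancels, and the factor \<open>exp (3 * b * t)\<close> restores
  monotonicity.\<close>

lemma mom_ratio_bound:
  "exp (- (3 * b * \<tau>)) * (mom 2 0 / mom 1 0 ^ 3) \<le> mom 2 \<tau> / mom 1 \<tau> ^ 3"
proof -
  let ?g = "\<lambda>t. mom 2 t / mom 1 t ^ 3 * exp (3 * b * t)"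
  have "?g 0 \<le> ?g \<tau>"
  proof (rule DERIV_nonneg_imp_nondecreasing[OF \<tau>])
    fix x :: real assume x: "0 \<le> x" "x \<le> \<tau>"
    obtain D where D: "(mom 1 has_real_derivative D) (at x)" "D \<le> (mom 1 x)\<^sup>2" using mom1_deriv[OF x(1)] .
    obtain F where F: "(mom 2 has_real_derivative F) (at x)" "3 * (mom 2 x * mom 1 x - mom 4 x) \<le> F"
      using mom2_deriv[OF x(1)] .
    define s1 s2 where "s1 = mom 1 x" and "s2 = mom 2 x"
    have pos: "0 < s1" "0 < s2" unfolding s1_def s2_def by (rule mom_pos[OF x(1)])+
    have "mom 4 x \<le> b * s2" using mom_reduce[OF x, of 2] by (simp add: s2_def)
    then have F2: "3 * (s2 * s1 - b * s2) \<le> F" using F(2) unfolding s1_def s2_def by (simp add: algebra_simps)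
    have d: "((\<lambda>t. mom 1 t ^ 3) has_real_derivative 3 * s1\<^sup>2 * D) (at x)"
      by (auto intro!: derivative_eq_intros D(1) simp: s1_def simp del: One_nat_def)
    have e: "((\<lambda>t. exp (3 * b * t)) has_real_derivative exp (3 * b * x) * (3 * b)) (at x)"
      by (auto intro!: derivative_eq_intros)
    have nz: "mom 1 x ^ 3 \<noteq> 0" using pos(1) by (simp add: s1_def)
    have "(?g has_real_derivative (F * s1 ^ 3 - s2 * (3 * s1\<^sup>2 * D)) / (s1 ^ 3 * s1 ^ 3) * exp (3 * b * x)
        + exp (3 * b * x) * (3 * b) * (s2 / s1 ^ 3)) (at x)"
      using DERIV_mult[OF DERIV_divide[OF F(1) d nz] e] unfolding s1_def s2_def .
    moreover have alg: "(X + 3 * b * Y * c) / (c * c) * E = X / (c * c) * E + E * (3 * b) * (Y / c)"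
      if "c \<noteq> 0" for X Y c E :: real
      using that by (simp add: field_simps)
    moreover have "0 \<le> (F * s1 ^ 3 - s2 * (3 * s1\<^sup>2 * D)) / (s1 ^ 3 * s1 ^ 3) * exp (3 * b * x)
        + exp (3 * b * x) * (3 * b) * (s2 / s1 ^ 3)"
    proof -
      have "s2 * (3 * s1\<^sup>2 * D) \<le> s2 * (3 * s1\<^sup>2 * s1\<^sup>2)"
        using D(2) pos unfolding s1_def[symmetric] by (intro mult_left_mono) auto
      moreover have "3 * (s2 * s1 - b * s2) * s1 ^ 3 \<le> F * s1 ^ 3"
        using F2 pos by (intro mult_right_mono) auto
      ultimately have "0 \<le> F * s1 ^ 3 - s2 * (3 * s1\<^sup>2 * D) + 3 * b * s2 * s1 ^ 3"
        by (simp add: algebra_simps power2_eq_square power3_eq_cube)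
      then have "0 \<le> (F * s1 ^ 3 - s2 * (3 * s1\<^sup>2 * D) + 3 * b * s2 * s1 ^ 3) / (s1 ^ 3 * s1 ^ 3) * exp (3 * b * x)"
        using pos by simp
      also have "\<dots> = (F * s1 ^ 3 - s2 * (3 * s1\<^sup>2 * D)) / (s1 ^ 3 * s1 ^ 3) * exp (3 * b * x)
        + exp (3 * b * x) * (3 * b) * (s2 / s1 ^ 3)"
        using pos by (intro alg) simp
      finally show ?thesis .
    qed
    ultimately show "\<exists>y. (?g has_real_derivative y) (at x) \<and> 0 \<le> y" by blast
  qed
  then have "mom 2 0 / mom 1 0 ^ 3 \<le> mom 2 \<tau> / mom 1 \<tau> ^ 3 * exp (3 * b * \<tau>)" by simp
  then have "exp (- (3 * b * \<tau>)) * (mom 2 0 / mom 1 0 ^ 3)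
      \<le> exp (- (3 * b * \<tau>)) * (mom 2 \<tau> / mom 1 \<tau> ^ 3 * exp (3 * b * \<tau>))"
    by (intro mult_left_mono) auto
  also have "\<dots> = mom 2 \<tau> / mom 1 \<tau> ^ 3 * (exp (- (3 * b * \<tau>)) * exp (3 * b * \<tau>))"
    by (simp only: mult_ac)
  also have "\<dots> = mom 2 \<tau> / mom 1 \<tau> ^ 3" by (simp flip: exp_add)
  finally show ?thesis .
qed

end

end

subsection \<open>Blocks of the hierarchical lattice\<close>

text \<open>Exchanging \<open>a i\<close> and \<open>b i\<close> in every coordinate is a symmetry of the block structure taking
  \<open>a\<close> to \<open>b\<close>; it plays the role of a translation and needs no group laws.\<close>

definition coord_swap :: "point \<Rightarrow> point \<Rightarrow> point \<Rightarrow> point" where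
  "coord_swap a b y = (\<lambda>i. if y i = a i then b i else if y i = b i then a i else y i)"

lemma coord_swap_self [simp]: "coord_swap a b a = b"
  by (simp add: coord_swap_def)

lemma coord_swap_involution [simp]: "coord_swap a b (coord_swap a b y) = y"
  by (auto simp: coord_swap_def)

lemma inj_coord_swap: "inj (coord_swap a b)"
  by (metis coord_swap_involution injI)

lemma coord_swap_eq_iff: "coord_swap a b y i = coord_swap a b z i \<longleftrightarrow> y i = z i"
  by (auto simp: coord_swap_def)

definition slot_edge :: "slot \<Rightarrow> point set" where
  "slot_edge s = snd (snd s)"

locale hierarchical =
  fixes d L :: nat and \<alpha> :: real
  assumes d: "1 \<le> d" and L: "2 \<le> L" and \<alpha>_pos: "0 < \<alpha>" and \<alpha>_less: "\<alpha> < real d"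
begin

abbreviation "H \<equiv> hier_lattice d L"
abbreviation "org \<equiv> hier_origin d L"
abbreviation "Bl \<equiv> hier_block d L"
abbreviation "Gd \<equiv> carrier (product_group {..<d} (\<lambda>j. integer_mod_group L))"
abbreviation "Go \<equiv> \<one>\<^bsub>product_group {..<d} (\<lambda>j. integer_mod_group L)\<^esub>"

section \<open>Geometry of blocks\<close>

lemma L1: "1 < real L" using L by simp

lemma card_Gd: "card Gd = L ^ d"
  using L by (simp add: card_PiE carrier_integer_mod_group)

lemma finite_Gd: "finite Gd"
  using L by (auto simp: carrier_integer_mod_group intro!: finite_PiE)

lemma Go_in: "Go \<in> Gd"
  using L by (auto simp: carrier_integer_mod_group)

lemma org_coord: "org i = (if 1 \<le> i then Go else undefined)"
  unfolding hier_origin_def hier_group_def by (auto simp: restrict_def)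

lemma in_H_iff:
  "x \<in> H \<longleftrightarrow> x 0 = undefined \<and> (\<forall>i\<ge>1. x i \<in> Gd) \<and> finite {i. 1 \<le> i \<and> x i \<noteq> org i}"
proof -
  have "{i \<in> {1..}. x i \<noteq> Go} = {i. 1 \<le> i \<and> x i \<noteq> org i}"
    by (auto simp: org_coord)
  then show ?thesis unfolding hier_lattice_iff mem_Collect_eq PiE_iff
    by (auto simp del: carrier_product_group one_product_group simp: extensional_def Suc_le_eq)
qed

lemma org_in_H: "org \<in> H"
  using Go_in by (auto simp: in_H_iff org_coord simp del: carrier_product_group one_product_group)

lemma coord_swap_in_H:
  assumes "a \<in> H" "b \<in> H" "y \<in> H"
  shows "coord_swap a b y \<in> H"
proof -
  let ?D = "\<lambda>x. {i. 1 \<le> i \<and> x i \<noteq> org i}"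
  have "finite (?D a \<union> ?D b \<union> ?D y)" using assms by (simp add: in_H_iff del: carrier_product_group)
  then have "finite (?D (coord_swap a b y))"
    by (rule finite_subset[rotated]) (auto simp: coord_swap_def)
  then show ?thesis
    using assms by (auto simp: in_H_iff coord_swap_def simp del: carrier_product_group)
qed

lemma Bl_eq: "x \<in> H \<Longrightarrow> Bl n x = {y \<in> H. \<forall>i>n. x i = y i}"
  by (rule hier_block_eq[OF _ L])

lemma Bl_self: "x \<in> H \<Longrightarrow> x \<in> Bl n x"
  by (simp add: Bl_eq)

lemma Bl_subset: "x \<in> H \<Longrightarrow> Bl n x \<subseteq> H"
  by (auto simp: Bl_eq)

lemma Bl_cong: "x \<in> H \<Longrightarrow> y \<in> Bl n x \<Longrightarrow> Bl n y = Bl n x"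
  by (auto simp: Bl_eq)

lemma Bl_mono: "x \<in> H \<Longrightarrow> m \<le> n \<Longrightarrow> Bl m x \<subseteq> Bl n x"
  by (auto simp: Bl_eq)

lemma coord_swap_Bl:
  assumes "a \<in> H" "b \<in> H" "x \<in> H"
  shows "coord_swap a b ` Bl n x = Bl n (coord_swap a b x)"
proof -
  have sub: "coord_swap a b ` Bl n x \<subseteq> Bl n (coord_swap a b x)" if "x \<in> H" for x
    using that assms by (auto simp: Bl_eq coord_swap_in_H coord_swap_eq_iff)
  have "Bl n (coord_swap a b x) \<subseteq> coord_swap a b ` Bl n x"
  proof
    fix y assume "y \<in> Bl n (coord_swap a b x)"
    then have "coord_swap a b y \<in> Bl n x"
      using sub[of "coord_swap a b x"] assms coord_swap_in_H by auto
    then show "y \<in> coord_swap a b ` Bl n x" by (metis coord_swap_involution image_eqI)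
  qed
  then show ?thesis using sub[OF assms(3)] by auto
qed

lemma card_Bl_org: "finite (Bl n org) \<and> card (Bl n org) = L ^ (d * n)"
proof -
  let ?F = "{1..n} \<rightarrow>\<^sub>E Gd"
  let ?g = "\<lambda>f i. if i \<in> {1..n} then f i else org i"
  have bij: "bij_betw ?g ?F (Bl n org)"
  proof (rule bij_betwI[where g = "\<lambda>y. restrict y {1..n}"])
    show "?g \<in> ?F \<rightarrow> Bl n org"
    proof
      fix f assume f: "f \<in> ?F"
      have "?g f \<in> H" unfolding in_H_iff
      proof (intro conjI allI impI)
        show "?g f 0 = undefined" by (simp add: org_coord)
        show "?g f i \<in> Gd" if "1 \<le> i" for i
          using f that Go_in by (auto simp: org_coord simp del: carrier_product_group one_product_group)
        show "finite {i. 1 \<le> i \<and> ?g f i \<noteq> org i}"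
          by (rule finite_subset[of _ "{1..n}"]) auto
      qed
      then show "?g f \<in> Bl n org" by (auto simp: Bl_eq[OF org_in_H])
    qed
    show "(\<lambda>y. restrict y {1..n}) \<in> Bl n org \<rightarrow> ?F"
      by (auto simp: Bl_eq[OF org_in_H] in_H_iff simp del: carrier_product_group)
    show "restrict (?g f) {1..n} = f" if "f \<in> ?F" for f
      using that by (auto simp: fun_eq_iff PiE_iff extensional_def simp del: carrier_product_group)
    show "?g (restrict y {1..n}) = y" if "y \<in> Bl n org" for y
    proof
      fix i
      have "y 0 = undefined" "\<forall>i>n. org i = y i" using that by (auto simp: Bl_eq[OF org_in_H] in_H_iff)
      then show "?g (restrict y {1..n}) i = y i"
        by (cases "i = 0") (auto simp: org_coord not_le Suc_le_eq)
    qed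
  qed
  have "finite (Bl n org) \<longleftrightarrow> finite ?F" "card (Bl n org) = card ?F"
    using bij_betw_finite[OF bij] bij_betw_same_card[OF bij] by (simp_all only:)
  moreover have "finite ?F" "card ?F = L ^ (d * n)"
    using finite_Gd by (auto intro!: finite_PiE simp: card_PiE card_Gd power_mult simp del: carrier_product_group)
  ultimately show ?thesis by simp
qed

lemma Bl_transport: "x \<in> H \<Longrightarrow> Bl n x = coord_swap org x ` Bl n org"
  using coord_swap_Bl[OF org_in_H _ org_in_H] by simp

lemma finite_Bl: "x \<in> H \<Longrightarrow> finite (Bl n x)"
  using card_Bl_org[of n] by (subst Bl_transport) auto

lemma card_Bl: "x \<in> H \<Longrightarrow> card (Bl n x) = L ^ (d * n)"
  using card_Bl_org[of n]
  by (subst Bl_transport) (simp_all add: card_image inj_on_subset[OF inj_coord_swap])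

lemma H_eq_Union: "H = (\<Union>n. Bl n org)"
proof -
  have "\<exists>n. x \<in> Bl n org" if x: "x \<in> H" for x
  proof -
    have "finite {i. 1 \<le> i \<and> x i \<noteq> org i}" using x by (simp add: in_H_iff del: carrier_product_group)
    then obtain n where "\<forall>i\<in>{i. 1 \<le> i \<and> x i \<noteq> org i}. i \<le> n"
      using finite_nat_set_iff_bounded_le by blast
    then have "org i = x i" if "n < i" for i
      using that by (metis (mono_tags, lifting) One_nat_def Suc_leI gr_implies_not0 gr0I leD mem_Collect_eq)
    then show ?thesis using x by (auto simp: Bl_eq[OF org_in_H])
  qed
  then show ?thesis using Bl_subset[OF org_in_H] by blast
qed

lemma countable_H: "countable H"
  unfolding H_eq_Union using finite_Bl[OF org_in_H] by (auto intro: countable_finite)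

lemma Bl_level_le:
  assumes x: "x \<in> H" and y: "y \<in> H" and sub: "Bl k y \<subseteq> Bl n x"
  shows "k \<le> n"
proof -
  have "L ^ (d * k) \<le> L ^ (d * n)"
    using card_mono[OF finite_Bl[OF x] sub] by (simp add: card_Bl x y)
  then show ?thesis using L d by (simp add: power_increasing_iff)
qed

section \<open>Slots of a block and the clusters they form\<close>

definition block_slots :: "nat \<Rightarrow> point \<Rightarrow> slot set" where
  "block_slots n x = {(k, \<Lambda>, e). (k, \<Lambda>, e) \<in> slots d L \<and> k \<le> n \<and> \<Lambda> \<subseteq> Bl n x}"

lemma slots_iff: "(k, \<Lambda>, e) \<in> slots d L \<longleftrightarrow> (\<exists>y\<in>H. \<Lambda> = Bl k y) \<and> e \<subseteq> \<Lambda> \<and> card e = 2"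
  by (auto simp: slots_def hier_blocks_def)

lemma block_slots_subset: "block_slots n x \<subseteq> slots d L"
  by (auto simp: block_slots_def)

lemma slot_edge_props:
  assumes "s \<in> block_slots n x"
  shows "slot_edge s \<subseteq> Bl n x" "card (slot_edge s) = 2"
  using assms by (auto simp: block_slots_def slots_iff slot_edge_def)

lemma finite_block_slots: "x \<in> H \<Longrightarrow> finite (block_slots n x)"
proof -
  assume x: "x \<in> H"
  have "block_slots n x \<subseteq> {..n} \<times> Pow (Bl n x) \<times> Pow (Bl n x)"
    by (auto simp: block_slots_def slots_iff)
  then show ?thesis by (rule finite_subset) (use finite_Bl[OF x] in auto)
qed

lemma block_slots_mono: "x \<in> H \<Longrightarrow> m \<le> n \<Longrightarrow> block_slots m x \<subseteq> block_slots n x"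
  using Bl_mono by (fastforce simp: block_slots_def)

lemma block_slots_cong: "x \<in> H \<Longrightarrow> y \<in> Bl n x \<Longrightarrow> block_slots n y = block_slots n x"
  by (simp add: block_slots_def Bl_cong)

text \<open>Ultrametric property: the block of the slot contains \<open>u\<close> and has level at
  most \<open>n\<close>, hence lies inside the \<open>n\<close>-block of \<open>u\<close>.\<close>

lemma slot_in_block_slots:
  assumes "(k, \<Lambda>, e) \<in> slots d L" "u \<in> e" "k \<le> n"
  shows "(k, \<Lambda>, e) \<in> block_slots n u"
proof -
  obtain y where y: "y \<in> H" "\<Lambda> = Bl k y" "e \<subseteq> \<Lambda>" using assms(1) by (auto simp: slots_iff)
  then have "u \<in> Bl k y" using assms(2) by auto
  then have "\<Lambda> = Bl k u" "u \<in> H" using y Bl_cong[of y u k] Bl_subset[of y k] by blast+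
  then have "\<Lambda> \<subseteq> Bl n u" using Bl_mono[OF _ assms(3)] by blast
  then show ?thesis using assms by (simp add: block_slots_def)
qed

lemma mem_slot_edge_image: "e \<in> slot_edge ` S \<longleftrightarrow> (\<exists>k \<Lambda>. (k, \<Lambda>, e) \<in> S)"
  by (force simp: slot_edge_def)

lemma eta_edges_eq: "eta_edges d L n c = slot_edge ` {s \<in> block_slots n org. c s}"
proof -
  have "k \<le> n" if "(k, \<Lambda>, e) \<in> slots d L" "\<Lambda> \<subseteq> Bl n org" for k \<Lambda> e
  proof -
    obtain y where "y \<in> H" "\<Lambda> = Bl k y" using \<open>(k, \<Lambda>, e) \<in> slots d L\<close> by (auto simp: slots_iff)
    then show ?thesis using that(2) by (intro Bl_level_le[OF org_in_H, of y]) auto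
  qed
  then have block: "(k, \<Lambda>, e) \<in> block_slots n org \<longleftrightarrow> (k, \<Lambda>, e) \<in> slots d L \<and> \<Lambda> \<subseteq> Bl n org" for k \<Lambda> e
    by (auto simp: block_slots_def)
  have "e \<in> eta_edges d L n c \<longleftrightarrow> (\<exists>k \<Lambda>. (k, \<Lambda>, e) \<in> slots d L \<and> \<Lambda> \<subseteq> Bl n org \<and> c (k, \<Lambda>, e))" for e
    by (auto simp: eta_edges_def block_edges_def origin_block_def slots_def)
  then show ?thesis by (auto simp: set_eq_iff mem_slot_edge_image block)
qed

lemma perc_edges_eq: "perc_edges d L c = slot_edge ` {s \<in> slots d L. c s}"
proof -
  have "e \<in> perc_edges d L c \<longleftrightarrow> (\<exists>k \<Lambda>. (k, \<Lambda>, e) \<in> slots d L \<and> c (k, \<Lambda>, e))" for e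
    by (auto simp: perc_edges_def block_edges_def slots_def)
  then show ?thesis by (auto simp: set_eq_iff mem_slot_edge_image)
qed

text \<open>Slots of level at most \<open>n\<close> never lead out of an \<open>n\<close>-block, so
  a cluster formed by them is decided inside the block of its starting point.\<close>

lemma reach_sub_block:
  assumes x: "x \<in> H" and A: "A \<subseteq> slots d L" "\<And>k \<Lambda> e. (k, \<Lambda>, e) \<in> A \<Longrightarrow> k \<le> n"
  shows "reach (slot_edge ` A) x = reach (slot_edge ` (A \<inter> block_slots n x)) x"
proof
  let ?R = "reach (slot_edge ` (A \<inter> block_slots n x)) x"
  have sub: "?R \<subseteq> Bl n x"
    using Bl_self[OF x] by (intro reach_subset) (auto dest!: subsetD[OF slot_edge_props(1)])
  show "reach (slot_edge ` A) x \<subseteq> ?R"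
  proof (rule reach_least)
    fix u v assume u: "u \<in> ?R" and "{u, v} \<in> slot_edge ` A"
    then obtain k \<Lambda> where s: "(k, \<Lambda>, {u, v}) \<in> A" by (auto simp: mem_slot_edge_image)
    then have "(k, \<Lambda>, {u, v}) \<in> block_slots n u" using A by (intro slot_in_block_slots) auto
    also have "block_slots n u = block_slots n x" using x u sub by (intro block_slots_cong) auto
    finally have "{u, v} \<in> slot_edge ` (A \<inter> block_slots n x)"
      using s by (auto simp: mem_slot_edge_image)
    then show "v \<in> ?R" using u by (rule reach_step[rotated])
  qed simp
  show "?R \<subseteq> reach (slot_edge ` A) x" by (intro reach_mono image_mono) auto
qed

section \<open>Invariance under exchanging the origin with another point\<close>

definition slot_swap :: "point \<Rightarrow> point \<Rightarrow> slot \<Rightarrow> slot" where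
  "slot_swap a b = (\<lambda>(k, \<Lambda>, e). (k, coord_swap a b ` \<Lambda>, coord_swap a b ` e))"

lemma inj_slot_swap: "inj (slot_swap a b)"
  by (auto simp: inj_def slot_swap_def inj_image_eq_iff[OF inj_coord_swap])

lemma slot_edge_swap: "slot_edge (slot_swap a b s) = coord_swap a b ` slot_edge s"
  by (auto simp: slot_edge_def slot_swap_def split: prod.splits)

lemma block_slots_transport:
  assumes x: "x \<in> H"
  shows "block_slots n x = slot_swap org x ` block_slots n org"
proof -
  let ?\<sigma> = "coord_swap org x"
  have image: "slot_swap org x ` block_slots n y \<subseteq> block_slots n (?\<sigma> y)" if y: "y \<in> H" for y
  proof (rule image_subsetI)
    fix s assume "s \<in> block_slots n y"
    then obtain k \<Lambda> e z where s: "s = (k, \<Lambda>, e)" "k \<le> n" "\<Lambda> \<subseteq> Bl n y" "z \<in> H" "\<Lambda> = Bl k z" "e \<subseteq> \<Lambda>" "card e = 2"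
      by (auto simp: block_slots_def slots_iff)
    have "?\<sigma> ` \<Lambda> = Bl k (?\<sigma> z)" "?\<sigma> ` Bl n y = Bl n (?\<sigma> y)" "?\<sigma> z \<in> H"
      using s(4,5) y x org_in_H by (simp_all add: coord_swap_Bl coord_swap_in_H)
    moreover have "card (?\<sigma> ` e) = 2"
      using s(7) by (subst card_image) (auto intro: inj_on_subset[OF inj_coord_swap])
    moreover have "?\<sigma> ` \<Lambda> \<subseteq> ?\<sigma> ` Bl n y" "?\<sigma> ` e \<subseteq> ?\<sigma> ` \<Lambda>" using s by auto
    ultimately show "slot_swap org x s \<in> block_slots n (?\<sigma> y)"
      using s(1,2) by (auto simp: slot_swap_def block_slots_def slots_iff)
  qed
  have "block_slots n x \<subseteq> slot_swap org x ` block_slots n org"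
  proof
    fix s assume "s \<in> block_slots n x"
    then have "slot_swap org x s \<in> block_slots n (?\<sigma> x)" using image[OF x] by auto
    moreover have "?\<sigma> x = org" by (metis coord_swap_involution coord_swap_self)
    moreover have "slot_swap org x (slot_swap org x s) = s"
      by (simp add: slot_swap_def image_image split: prod.splits)
    ultimately show "s \<in> slot_swap org x ` block_slots n org" by (metis image_eqI)
  qed
  then show ?thesis using image[OF org_in_H] by auto
qed

lemma reach_image:
  assumes "inj \<phi>"
  shows "reach ((`) \<phi> ` E) (\<phi> x) = \<phi> ` reach E x"
proof
  show "reach ((`) \<phi> ` E) (\<phi> x) \<subseteq> \<phi> ` reach E x"
  proof (rule reach_least)
    fix u v assume "u \<in> \<phi> ` reach E x" "{u, v} \<in> (`) \<phi> ` E"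
    then obtain a e where a: "a \<in> reach E x" "u = \<phi> a" and e: "e \<in> E" "{u, v} = \<phi> ` e" by auto
    then obtain b where b: "v = \<phi> b" by blast
    then have "\<phi> ` {a, b} = \<phi> ` e" using a e by simp
    then have "e = {a, b}" using assms by (metis inj_image_eq_iff)
    then have "b \<in> reach E x" using e(1) reach_step[OF a(1)] by blast
    then show "v \<in> \<phi> ` reach E x" using b by blast
  qed simp
  have "reach E x \<subseteq> {y. \<phi> y \<in> reach ((`) \<phi> ` E) (\<phi> x)}"
  proof (rule reach_least)
    fix u v assume u: "u \<in> {y. \<phi> y \<in> reach ((`) \<phi> ` E) (\<phi> x)}" and e: "{u, v} \<in> E"
    have "{\<phi> u, \<phi> v} \<in> (`) \<phi> ` E" using e by (intro image_eqI[where x = "{u, v}"]) auto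
    then show "v \<in> {y. \<phi> y \<in> reach ((`) \<phi> ` E) (\<phi> x)}" using u reach_step[of "\<phi> u"] by blast
  qed simp
  then show "\<phi> ` reach E x \<subseteq> reach ((`) \<phi> ` E) (\<phi> x)" by auto
qed

abbreviation "sp \<equiv> slot_prob d L \<alpha>"
abbreviation "Sz A x \<equiv> card (reach (slot_edge ` A) x)"

lemma sp_eq: "sp \<beta> (k, \<Lambda>, e) = 1 - exp (- (\<beta> * real L powr (- (d + \<alpha>) * k)))"
  by (simp add: slot_prob_def)

lemma sp_bounds: "0 \<le> \<beta> \<Longrightarrow> 0 \<le> sp \<beta> s" "sp \<beta> s \<le> 1"
  by (cases s; simp add: sp_eq)+

lemma Sz_transport: "Sz (slot_swap org x ` A) x = Sz A org"
proof -
  have "slot_edge ` slot_swap org x ` A = (`) (coord_swap org x) ` slot_edge ` A"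
    by (simp add: image_image slot_edge_swap)
  then have "reach (slot_edge ` slot_swap org x ` A) x = coord_swap org x ` reach (slot_edge ` A) org"
    using reach_image[OF inj_coord_swap, of org x "slot_edge ` A" org] by simp
  then show ?thesis by (simp add: card_image inj_on_subset[OF inj_coord_swap])
qed

text \<open>\<open>slot_prob\<close> depends only on the level of a slot, which
  \<open>slot_swap\<close> preserves.\<close>

lemma bexp_transport:
  assumes "x \<in> H"
  shows "bexp (block_slots n x) (sp \<beta>) f = bexp (block_slots n org) (sp \<beta>) (\<lambda>A. f (slot_swap org x ` A))"
proof -
  have "sp \<beta> (slot_swap org x s) = sp \<beta> s" for s by (cases s) (simp add: slot_swap_def sp_eq)
  then show ?thesis unfolding block_slots_transport[OF assms]
    by (subst bexp_reindex) (auto simp: o_def intro: inj_on_subset[OF inj_slot_swap])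
qed

lemma bexp_size_eq:
  assumes "x \<in> H"
  shows "bexp (block_slots n x) (sp \<beta>) (\<lambda>A. f (Sz A x)) = bexp (block_slots n org) (sp \<beta>) (\<lambda>A. f (Sz A org))"
  by (simp add: bexp_transport[OF assms] Sz_transport)

lemma bexp_size_block:
  assumes "x \<in> Bl n org"
  shows "bexp (block_slots n org) (sp \<beta>) (\<lambda>A. f (Sz A x)) = bexp (block_slots n org) (sp \<beta>) (\<lambda>A. f (Sz A org))"
proof -
  have "x \<in> H" using assms Bl_subset[OF org_in_H] by auto
  then show ?thesis
    using bexp_size_eq[of x n \<beta> f] block_slots_cong[OF org_in_H assms] by simp
qed

abbreviation "Mx n x A \<equiv> max_cluster_size (Bl n x) (slot_edge ` A)"

lemma fin_perc: "x \<in> H \<Longrightarrow> 0 \<le> \<beta> \<Longrightarrow> finite_percolation (Bl n x) (block_slots n x) slot_edge (sp \<beta>)"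
  using finite_Bl finite_block_slots Bl_self slot_edge_props sp_bounds by unfold_locales blast+

lemma max_cluster_size_image:
  assumes "inj \<phi>"
  shows "max_cluster_size (\<phi> ` V) ((`) \<phi> ` E) = max_cluster_size V E"
proof -
  have "card (cluster (\<phi> ` V) ((`) \<phi> ` E) (\<phi> y)) = card (cluster V E y)" for y
    unfolding cluster_conv_reach reach_image[OF assms] image_Int[OF assms, symmetric]
    by (intro card_image inj_on_subset[OF assms]) auto
  then have "card ` clusters (\<phi> ` V) ((`) \<phi> ` E) = card ` clusters V E"
    unfolding clusters_def image_image by (intro image_cong refl)
  then show ?thesis by (simp only: max_cluster_size_def)
qed

lemma bexp_largest_eq:
  assumes x: "x \<in> H"
  shows "bexp (block_slots n x) (sp \<beta>) (\<lambda>A. f (Mx n x A)) = bexp (block_slots n org) (sp \<beta>) (\<lambda>A. f (Mx n org A))"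
proof -
  have "Mx n x (slot_swap org x ` A) = Mx n org A" for A
  proof -
    have "slot_edge ` slot_swap org x ` A = (`) (coord_swap org x) ` slot_edge ` A"
      by (simp add: image_image slot_edge_swap)
    then show ?thesis
      unfolding Bl_transport[OF x] using max_cluster_size_image[OF inj_coord_swap] by (simp only:)
  qed
  then show ?thesis by (simp only: bexp_transport[OF x])
qed

end

subsection \<open>One hierarchical step\<close>

lemma bexp_none_open:
  assumes "finite I" "W \<subseteq> I"
  shows "bexp I p (\<lambda>A. of_bool (A \<inter> W = {})) = (\<Prod>s\<in>W. 1 - p s)"
proof -
  have fin: "finite W" using assms by (rule finite_subset[rotated])
  have "bexp I p (\<lambda>A. of_bool (A \<inter> W = {})) = bexp W p (\<lambda>A. of_bool (A = {}))"
    by (rule bexp_marginal[OF assms, where f = "\<lambda>A. of_bool (A = {})"])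
  also have "\<dots> = (\<Sum>A\<in>{{}}. (\<Prod>i\<in>A. p i) * (\<Prod>i\<in>W - A. 1 - p i) * of_bool (A = {}))"
    unfolding bexp_def using fin by (intro sum.mono_neutral_right) auto
  finally show ?thesis by simp
qed

context hierarchical
begin

definition mean_moment :: "nat \<Rightarrow> nat \<Rightarrow> real \<Rightarrow> real" where
  "mean_moment q n \<beta> = bexp (block_slots n org) (sp \<beta>) (\<lambda>A. real (Sz A org) ^ q)"

definition mean_largest :: "nat \<Rightarrow> real \<Rightarrow> real" where
  "mean_largest n \<beta> = bexp (block_slots n org) (sp \<beta>) (\<lambda>A. real (Mx n org A))"

definition prob_largest :: "nat \<Rightarrow> nat \<Rightarrow> real \<Rightarrow> real" where
  "prob_largest n m \<beta> = bexp (block_slots n org) (sp \<beta>) (\<lambda>A. of_bool (m \<le> Mx n org A))"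

definition low_slots :: "nat \<Rightarrow> slot set" where
  "low_slots n = {(k, \<Lambda>, e). (k, \<Lambda>, e) \<in> block_slots (Suc n) org \<and> k \<le> n}"

definition top_slots :: "nat \<Rightarrow> slot set" where
  "top_slots n = (\<lambda>e. (Suc n, Bl (Suc n) org, e)) ` {e. e \<subseteq> Bl (Suc n) org \<and> card e = 2}"

text \<open>The time at which \<open>dial\<close> gives the top slots their true probability
  \<open>sp \<beta>\<close>.\<close>

definition top_rate :: "nat \<Rightarrow> real \<Rightarrow> real" where
  "top_rate n \<beta> = \<beta> * real L powr (- (d + \<alpha>) * Suc n)"

lemma block_slots_Suc: "block_slots (Suc n) org = low_slots n \<union> top_slots n"
proof -
  have "(k, \<Lambda>, e) \<in> low_slots n \<union> top_slots n" if "(k, \<Lambda>, e) \<in> block_slots (Suc n) org" for k \<Lambda> e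
  proof (cases "k \<le> n")
    case False
    then have k: "k = Suc n" using that by (auto simp: block_slots_def)
    with that obtain y where y: "k = Suc n" "y \<in> H" "\<Lambda> = Bl (Suc n) y" "\<Lambda> \<subseteq> Bl (Suc n) org" "e \<subseteq> \<Lambda>" "card e = 2"
      by (auto simp: block_slots_def slots_iff)
    then have "Bl (Suc n) y = Bl (Suc n) org" using Bl_self[of y "Suc n"] by (intro Bl_cong[OF org_in_H]) auto
    then show ?thesis using y by (auto simp: top_slots_def)
  qed (use that in \<open>auto simp: low_slots_def\<close>)
  moreover have "low_slots n \<subseteq> block_slots (Suc n) org" by (auto simp: low_slots_def)
  moreover have "top_slots n \<subseteq> block_slots (Suc n) org"
    using org_in_H by (auto simp: top_slots_def block_slots_def slots_iff)
  ultimately show ?thesis by auto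
qed

lemma low_top_disjoint: "low_slots n \<inter> top_slots n = {}"
  by (auto simp: low_slots_def top_slots_def)

lemma finite_low_top: "finite (low_slots n)" "finite (top_slots n)"
  using finite_block_slots[OF org_in_H, of "Suc n"] unfolding block_slots_Suc by auto

lemma block_slots_sub_low:
  assumes "x \<in> Bl (Suc n) org"
  shows "block_slots n x \<subseteq> low_slots n"
proof -
  have x: "x \<in> H" using assms Bl_subset[OF org_in_H] by auto
  have "block_slots n x \<subseteq> block_slots (Suc n) org"
    using block_slots_mono[OF x, of n "Suc n"] block_slots_cong[OF org_in_H assms] by simp
  then show ?thesis by (auto simp: low_slots_def block_slots_def)
qed

lemma reach_low:
  assumes "A \<subseteq> low_slots n" "x \<in> H"
  shows "reach (slot_edge ` A) x = reach (slot_edge ` (A \<inter> block_slots n x)) x"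
  using assms by (intro reach_sub_block) (auto simp: low_slots_def block_slots_def)

lemma step: "0 \<le> \<beta> \<Longrightarrow> block_step (Bl (Suc n) org) (low_slots n) (top_slots n) slot_edge (sp \<beta>)"
proof -
  assume \<beta>: "0 \<le> \<beta>"
  have low: "s \<in> low_slots n \<Longrightarrow> s \<in> block_slots (Suc n) org" for s by (auto simp: low_slots_def)
  show ?thesis
  proof
    show "Bl (Suc n) org \<noteq> {}" using Bl_self[OF org_in_H] by auto
    show "inj_on slot_edge (top_slots n)" by (auto simp: inj_on_def top_slots_def slot_edge_def)
    show "slot_edge ` top_slots n = {e. e \<subseteq> Bl (Suc n) org \<and> card e = 2}"
      by (simp add: top_slots_def image_image slot_edge_def)
  qed (use finite_Bl[OF org_in_H] finite_low_top low_top_disjoint slot_edge_props[OF low] sp_bounds \<beta> in auto)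
qed

lemma dial_top_rate: "s \<in> block_slots (Suc n) org \<Longrightarrow> dial (top_slots n) (sp \<beta>) (top_rate n \<beta>) s = sp \<beta> s"
  by (auto simp: dial_def top_slots_def top_rate_def sp_eq)

lemma bexp_top_rate:
  "bexp (low_slots n \<union> top_slots n) (dial (top_slots n) (sp \<beta>) (top_rate n \<beta>)) f = bexp (block_slots (Suc n) org) (sp \<beta>) f"
  unfolding block_slots_Suc[symmetric] by (intro bexp_cong dial_top_rate refl)

abbreviation "vol n \<equiv> real (L ^ (d * n))"

lemma vol_pos: "0 < vol n"
  using L by simp

lemma bexp_moment_sum:
  "bexp (block_slots n org) (sp \<beta>) (\<lambda>A. moment_sum (Bl n org) q (slot_edge ` A)) = vol n * mean_moment q n \<beta>"
proof -
  have "bexp (block_slots n org) (sp \<beta>) (\<lambda>A. moment_sum (Bl n org) q (slot_edge ` A))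
      = (\<Sum>x\<in>Bl n org. bexp (block_slots n org) (sp \<beta>) (\<lambda>A. real (Sz A x) ^ q))"
    by (simp add: moment_sum_def bexp_sum)
  also have "\<dots> = (\<Sum>x\<in>Bl n org. mean_moment q n \<beta>)"
    unfolding mean_moment_def by (intro sum.cong refl bexp_size_block)
  finally show ?thesis by (simp add: card_Bl[OF org_in_H])
qed

text \<open>Without top slots the cluster of each point lives in its own \<open>n\<close>-block, and
  by symmetry it contributes the moment of the origin at level \<open>n\<close>.\<close>

lemma bexp_low_moment_sum:
  "bexp (low_slots n) (sp \<beta>) (\<lambda>A. moment_sum (Bl (Suc n) org) q (slot_edge ` A)) = vol (Suc n) * mean_moment q n \<beta>"
proof -
  have "bexp (low_slots n) (sp \<beta>) (\<lambda>A. real (Sz A x) ^ q) = mean_moment q n \<beta>" if x: "x \<in> Bl (Suc n) org" for x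
  proof -
    have xH: "x \<in> H" using x Bl_subset[OF org_in_H] by auto
    have "bexp (low_slots n) (sp \<beta>) (\<lambda>A. real (Sz A x) ^ q)
        = bexp (low_slots n) (sp \<beta>) (\<lambda>A. real (Sz (A \<inter> block_slots n x) x) ^ q)"
      by (intro bexp_cong refl) (simp add: reach_low[OF _ xH, symmetric])
    also have "\<dots> = bexp (block_slots n x) (sp \<beta>) (\<lambda>A. real (Sz A x) ^ q)"
      by (rule bexp_marginal[OF finite_low_top(1) block_slots_sub_low[OF x], where f = "\<lambda>A. real (Sz A x) ^ q"])
    also have "\<dots> = mean_moment q n \<beta>"
      unfolding mean_moment_def by (rule bexp_size_eq[OF xH])
    finally show ?thesis .
  qed
  then have "(\<Sum>x\<in>Bl (Suc n) org. bexp (low_slots n) (sp \<beta>) (\<lambda>A. real (Sz A x) ^ q))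
      = (\<Sum>x\<in>Bl (Suc n) org. mean_moment q n \<beta>)" by (intro sum.cong refl)
  then show ?thesis by (simp add: moment_sum_def bexp_sum card_Bl[OF org_in_H])
qed

text \<open>At time 0 all top slots are closed. Together with \<open>mom_end\<close> this turns the
  time-integrated inequalities into relations between levels \<open>n\<close> and
  \<open>Suc n\<close>.\<close>

lemma mom_start:
  assumes "0 \<le> \<beta>"
  shows "block_step.mom (Bl (Suc n) org) (low_slots n) (top_slots n) slot_edge (sp \<beta>) q 0 = vol (Suc n) * mean_moment q n \<beta>"
proof -
  interpret block_step "Bl (Suc n) org" "low_slots n" "top_slots n" slot_edge "sp \<beta>" by (rule step[OF assms])
  have "mom q 0 = bexp (low_slots n) (dial (top_slots n) (sp \<beta>) 0) (\<lambda>A. moment_sum (Bl (Suc n) org) q (slot_edge ` A))"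
    unfolding mom_def using finite_low_top low_top_disjoint by (intro bexp_zero_prob) (auto simp: dial_def)
  also have "\<dots> = bexp (low_slots n) (sp \<beta>) (\<lambda>A. moment_sum (Bl (Suc n) org) q (slot_edge ` A))"
    using low_top_disjoint by (intro bexp_cong refl) (auto simp: dial_def)
  finally show ?thesis by (simp only: bexp_low_moment_sum)
qed

lemma mom_end:
  assumes "0 \<le> \<beta>"
  shows "block_step.mom (Bl (Suc n) org) (low_slots n) (top_slots n) slot_edge (sp \<beta>) q (top_rate n \<beta>)
    = vol (Suc n) * mean_moment q (Suc n) \<beta>"
proof -
  interpret block_step "Bl (Suc n) org" "low_slots n" "top_slots n" slot_edge "sp \<beta>" by (rule step[OF assms])
  show ?thesis unfolding mom_def bexp_top_rate by (rule bexp_moment_sum)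
qed

section \<open>Moment inequalities between consecutive scales\<close>

lemma top_rate_nonneg: "0 \<le> \<beta> \<Longrightarrow> 0 \<le> top_rate n \<beta>"
  by (simp add: top_rate_def)

lemma mean_moment_ge_1:
  assumes "0 \<le> \<beta>"
  shows "1 \<le> mean_moment q n \<beta>"
proof -
  interpret finite_percolation "Bl n org" "block_slots n org" slot_edge "sp \<beta>" by (rule fin_perc[OF org_in_H assms])
  have "expect (\<lambda>A. 1) \<le> mean_moment q n \<beta>"
    unfolding mean_moment_def
  proof (intro expect_mono one_le_power)
    fix A assume "A \<subseteq> block_slots n org"
    then have "1 \<le> Sz A org" by (rule size_at_pos)
    then show "1 \<le> real (Sz A org)" by linarith
  qed
  then show ?thesis using finite_I by (simp add: bexp_const)
qed

lemma susceptibility_upper: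
  assumes "0 \<le> \<beta>"
  shows "1 / (vol (Suc n) * mean_moment 1 n \<beta>) - top_rate n \<beta> \<le> 1 / (vol (Suc n) * mean_moment 1 (Suc n) \<beta>)"
  using block_step.mom1_inverse_bound[OF step[OF assms] top_rate_nonneg[OF assms], of n n]
  unfolding mom_start[OF assms] mom_end[OF assms] .

lemma quantile_top:
  assumes "prob_largest (Suc n) m \<beta> \<le> exp (- 1)"
  shows "bexp (low_slots n \<union> top_slots n) (dial (top_slots n) (sp \<beta>) (top_rate n \<beta>)) (\<lambda>A. of_bool (m \<le> Mx (Suc n) org A)) \<le> exp (- 1)"
  using assms unfolding bexp_top_rate prob_largest_def .

lemma susceptibility_bound:
  assumes "0 \<le> \<beta>" "1 \<le> m" "prob_largest (Suc n) m \<beta> \<le> exp (- 1)"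
  shows "top_rate n \<beta> * (vol (Suc n) * mean_moment 1 n \<beta>) \<le> max 2 (2 * (131220 * (real m)\<^sup>2) * top_rate n \<beta>)"
  using block_step.mom1_start_bound[OF step[OF assms(1)] top_rate_nonneg[OF assms(1)] assms(2) quantile_top[OF assms(3)]]
  unfolding mom_start[OF assms(1)] .

lemma moment_ratio_step:
  assumes "0 \<le> \<beta>" "1 \<le> m" "prob_largest (Suc n) m \<beta> \<le> exp (- 1)"
  shows "exp (- (3 * (131220 * (real m)\<^sup>2) * top_rate n \<beta>)) * (mean_moment 2 n \<beta> / mean_moment 1 n \<beta> ^ 3)
     \<le> mean_moment 2 (Suc n) \<beta> / mean_moment 1 (Suc n) \<beta> ^ 3"
proof -
  let ?v = "vol (Suc n)"
  \<comment> \<open>The volume enters both ratios through the same factor, which cancels at the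
    end.\<close>
  have v: "?v * a / (?v * b) ^ 3 = a / b ^ 3 / ?v\<^sup>2" for a b
    using vol_pos[of "Suc n"] by (simp add: power_mult_distrib power2_eq_square power3_eq_cube)
  have "exp (- (3 * (131220 * (real m)\<^sup>2) * top_rate n \<beta>)) * (mean_moment 2 n \<beta> / mean_moment 1 n \<beta> ^ 3 / ?v\<^sup>2)
     \<le> mean_moment 2 (Suc n) \<beta> / mean_moment 1 (Suc n) \<beta> ^ 3 / ?v\<^sup>2"
    using block_step.mom_ratio_bound[OF step[OF assms(1)] top_rate_nonneg[OF assms(1)] assms(2) quantile_top[OF assms(3)]]
    unfolding mom_start[OF assms(1)] mom_end[OF assms(1)] v .
  moreover have "E * X \<le> Y" if "E * (X / w) \<le> Y / w" "0 < w" for E X Y w :: real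
    using that by (simp add: field_simps)
  ultimately show ?thesis using vol_pos[of "Suc n"] by (metis zero_less_power)
qed

lemma second_moment_upper:
  assumes "0 \<le> \<beta>" "1 \<le> m" "prob_largest n m \<beta> \<le> exp (- 1)"
  shows "mean_moment 2 n \<beta> \<le> 810 * real m * mean_moment 1 n \<beta>"
proof -
  interpret finite_percolation "Bl n org" "block_slots n org" slot_edge "sp \<beta>" by (rule fin_perc[OF org_in_H assms(1)])
  \<comment> \<open>810 = 5 * 9^2 * 2 from \<open>size_moment\<close> with \<open>q = 2\<close> and
    \<open>r = 1\<close>.\<close>
  show ?thesis
    using size_moment[OF assms(2) _ Bl_self[OF org_in_H], of 1 2] assms(3)
    unfolding mean_moment_def prob_largest_def by simp
qed

text \<open>A cluster of size at least \<open>m\<close> has at least \<open>m\<close> vertices with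
  squared cluster size at least m^2, so it alone contributes m^3 to the second moment sum.\<close>

lemma second_moment_lower:
  assumes "0 \<le> \<beta>"
  shows "real m ^ 3 * prob_largest n m \<beta> \<le> vol n * mean_moment 2 n \<beta>"
proof -
  interpret finite_percolation "Bl n org" "block_slots n org" slot_edge "sp \<beta>" by (rule fin_perc[OF org_in_H assms])
  have "expect (\<lambda>A. real m ^ 3 * of_bool (m \<le> largest A)) \<le> expect (\<lambda>A. moment_sum (Bl n org) 2 (slot_edge ` A))"
  proof (rule expect_mono)
    fix A assume A: "A \<subseteq> block_slots n org"
    show "real m ^ 3 * of_bool (m \<le> largest A) \<le> moment_sum (Bl n org) 2 (slot_edge ` A)"
    proof (cases "m \<le> largest A")
      case True
      then obtain x where x: "x \<in> Bl n org" "m \<le> size_at A x" using largest_ge_iff[OF A] by auto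
      have "real m ^ 3 \<le> real (size_at A x) ^ 3" using x(2) by (intro power_mono) auto
      also have "\<dots> = (\<Sum>y\<in>reach (slot_edge ` A) x. real (size_at A x) ^ 2)"
        by (simp add: power3_eq_cube power2_eq_square)
      also have "\<dots> = (\<Sum>y\<in>reach (slot_edge ` A) x. real (size_at A y) ^ 2)"
        by (intro sum.cong refl) (metis reach_eq)
      also have "\<dots> \<le> moment_sum (Bl n org) 2 (slot_edge ` A)"
        unfolding moment_sum_def using finite_V reach_in_V[OF A x(1)] by (intro sum_mono2) auto
      finally show ?thesis using True by simp
    qed (simp add: moment_sum_def sum_nonneg)
  qed
  then show ?thesis unfolding bexp_cmult bexp_moment_sum prob_largest_def .
qed

lemma largest_Markov:
  assumes "0 \<le> \<beta>"
  shows "real m * prob_largest n m \<beta> \<le> mean_largest n \<beta>"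
proof -
  interpret finite_percolation "Bl n org" "block_slots n org" slot_edge "sp \<beta>" by (rule fin_perc[OF org_in_H assms])
  show ?thesis unfolding prob_largest_def mean_largest_def bexp_cmult[symmetric]
    by (rule expect_mono) auto
qed

subsection \<open>Merging the largest clusters of the sub-blocks\<close>

lemma sub_blocks:
  fixes n :: nat
  defines "\<B> \<equiv> Bl n ` Bl (Suc n) org"
  shows "finite \<B>" "card \<B> = L ^ d" "\<And>B. B \<in> \<B> \<Longrightarrow> B \<subseteq> Bl (Suc n) org"
    "\<And>B B'. B \<in> \<B> \<Longrightarrow> B' \<in> \<B> \<Longrightarrow> B \<noteq> B' \<Longrightarrow> B \<inter> B' = {}"
proof -
  let ?V = "Bl (Suc n) org"
  have VH: "x \<in> H" if "x \<in> ?V" for x using that Bl_subset[OF org_in_H] by auto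
  show fin: "finite \<B>" unfolding \<B>_def using finite_Bl[OF org_in_H] by auto
  show sub: "B \<subseteq> ?V" if "B \<in> \<B>" for B
  proof -
    from that obtain x where x: "x \<in> ?V" "B = Bl n x" unfolding \<B>_def by auto
    then show ?thesis using Bl_mono[OF VH, of x n "Suc n"] Bl_cong[OF org_in_H x(1)] by simp
  qed
  show disj: "B \<inter> B' = {}" if BB: "B \<in> \<B>" "B' \<in> \<B>" "B \<noteq> B'" for B B'
  proof (rule ccontr)
    assume "B \<inter> B' \<noteq> {}"
    then obtain z where z: "z \<in> B" "z \<in> B'" by auto
    from BB obtain x y where "x \<in> ?V" "B = Bl n x" "y \<in> ?V" "B' = Bl n y" unfolding \<B>_def by auto
    then have "Bl n z = B" "Bl n z = B'" using z Bl_cong VH by blast+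
    then show False using BB(3) by simp
  qed
  have "card (\<Union>\<B>) = (\<Sum>B\<in>\<B>. card B)"
    using disj finite_subset[OF sub finite_Bl[OF org_in_H]]
    by (intro card_Union_disjoint) (auto simp: pairwise_def disjnt_def)
  also have "\<dots> = (\<Sum>B\<in>\<B>. L ^ (d * n))"
    using VH by (intro sum.cong refl) (auto simp: \<B>_def card_Bl)
  also have "\<Union>\<B> = ?V" using sub Bl_self VH by (fastforce simp: \<B>_def)
  finally have "L ^ (d * n) * L ^ d = L ^ (d * n) * card \<B>" by (simp add: card_Bl[OF org_in_H] power_add mult.commute)
  then show "card \<B> = L ^ d" using L by simp
qed

text \<open>Condition on the sub-blocks and keep those whose largest cluster has size at least
  \<open>a\<close>. Each such cluster joins a fixed reference cluster by a direct top edge with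
  probability at least \<open>1 - exp (- (top_rate n \<beta> * a\<^sup>2))\<close>; by linearity of
  expectation at least this fraction of their total size lies in one cluster on average.\<close>

lemma mean_largest_step:
  assumes \<beta>: "0 \<le> \<beta>" and a: "0 \<le> a"
  shows "(1 - exp (- (top_rate n \<beta> * a\<^sup>2))) * (real (L ^ d) * (mean_largest n \<beta> - a)) \<le> mean_largest (Suc n) \<beta>"
proof -
  define V where "V = Bl (Suc n) org"
  define \<B> where "\<B> = Bl n ` V"
  note SB = sub_blocks[where n = n, folded V_def, folded \<B>_def]
  define low top \<tau> where "low = low_slots n" and "top = top_slots n" and "\<tau> = top_rate n \<beta>"
  define sl where "sl B = {(k, \<Lambda>, e). (k, \<Lambda>, e) \<in> slots d L \<and> k \<le> n \<and> \<Lambda> \<subseteq> B}" for B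
  have sl: "sl (Bl n x) = block_slots n x" for x by (simp add: sl_def block_slots_def)
  define D where "D B A = max_cluster_size B (slot_edge ` (A \<inter> sl B))" for B A
  define \<theta> where "\<theta> = 1 - exp (- (\<tau> * a\<^sup>2))"
  have \<tau>: "0 \<le> \<tau>" unfolding \<tau>_def by (rule top_rate_nonneg[OF \<beta>])
  have \<theta>: "0 \<le> \<theta>" "\<theta> \<le> 1" using \<tau> by (auto simp: \<theta>_def)
  interpret full: finite_percolation V "block_slots (Suc n) org" slot_edge "sp \<beta>"
    unfolding V_def by (rule fin_perc[OF org_in_H \<beta>])
  have slots: "block_slots (Suc n) org = low \<union> top" unfolding low_def top_def by (rule block_slots_Suc)
  have VH: "x \<in> H" if "x \<in> V" for x using that Bl_subset[OF org_in_H] by (auto simp: V_def)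
  have fin: "finite low" "finite top" "low \<inter> top = {}"
    unfolding low_def top_def by (rule finite_low_top low_top_disjoint)+
  \<comment> \<open>The bound conditional on the configuration \<open>A\<close> of the sub-blocks,
    with only the top slots random.\<close>
  have inner: "\<theta> * (\<Sum>B\<in>{B \<in> \<B>. a \<le> D B A}. real (D B A)) \<le> bexp top (sp \<beta>) (\<lambda>T. real (max_cluster_size V (slot_edge ` (A \<union> T))))"
    if A: "A \<subseteq> low" for A
  proof -
    let ?G = "{B \<in> \<B>. a \<le> D B A}"
    have ex: "\<exists>v. v \<in> B \<and> D B A \<le> Sz A v \<and> reach (slot_edge ` A) v \<subseteq> B" if "B \<in> \<B>" for B
    proof -
      from that obtain x where x: "x \<in> V" "B = Bl n x" by (auto simp: \<B>_def)
      note xH = VH[OF x(1)]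
      interpret sub: finite_percolation B "block_slots n x" slot_edge "sp \<beta>"
        unfolding x(2) by (rule fin_perc[OF xH \<beta>])
      have "D B A \<le> sub.largest (A \<inter> block_slots n x)" by (simp add: D_def x(2) sl)
      then obtain v where v: "v \<in> B" "D B A \<le> Sz (A \<inter> block_slots n x) v"
        using sub.largest_ge_iff by blast
      have vx: "v \<in> H" "block_slots n v = block_slots n x"
        using v(1) x(2) xH Bl_subset[OF xH] block_slots_cong[OF xH] by auto
      have "reach (slot_edge ` A) v = reach (slot_edge ` (A \<inter> block_slots n x)) v"
        using reach_low[of A n v] A vx by (simp add: low_def)
      moreover have "reach (slot_edge ` (A \<inter> block_slots n x)) v \<subseteq> B"
        using v(1) by (intro sub.reach_in_V) auto
      ultimately show ?thesis using v by (intro exI[of _ v] conjI) (simp_all only:)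
    qed
    define v where "v B = (SOME v. v \<in> B \<and> D B A \<le> Sz A v \<and> reach (slot_edge ` A) v \<subseteq> B)" for B
    have v: "v B \<in> B" "D B A \<le> Sz A (v B)" "reach (slot_edge ` A) (v B) \<subseteq> B" if "B \<in> \<B>" for B
      using someI_ex[OF ex[OF that]] unfolding v_def by blast+
    have vV: "v B \<in> V" if "B \<in> \<B>" for B using v(1)[OF that] SB(3)[OF that] by auto
    show ?thesis
    proof (cases "?G = {}")
      case True
      then have "(\<Sum>B\<in>?G. real (D B A)) = 0" by (simp only: sum.empty)
      moreover have "0 \<le> bexp top (sp \<beta>) (\<lambda>T. real (max_cluster_size V (slot_edge ` (A \<union> T))))"
        using sp_bounds \<beta> by (intro bexp_nonneg) auto
      ultimately show ?thesis by simp
    next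
      case False
      \<comment> \<open>The reference sub-block; all others are tested for connection to the cluster
        of \<open>v B0\<close>.\<close>
      then obtain B0 where B0: "B0 \<in> \<B>" "a \<le> D B0 A" by auto
      let ?c = "\<lambda>B T. v B \<in> reach (slot_edge ` (A \<union> T)) (v B0)"
      have merged: "(\<Sum>B\<in>?G. real (D B A) * of_bool (?c B T)) \<le> real (max_cluster_size V (slot_edge ` (A \<union> T)))"
        if T: "T \<subseteq> top" for T
      proof -
        have AT: "A \<union> T \<subseteq> block_slots (Suc n) org" using A T slots by auto
        let ?S = "{B \<in> ?G. ?c B T}"
        have finS: "finite ?S" using SB(1) by simp
        have "(\<Sum>B\<in>?G. real (D B A) * of_bool (?c B T)) = (\<Sum>B\<in>?S. real (D B A))"
          using SB(1) by (intro sum.mono_neutral_cong_right) auto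
        also have "\<dots> \<le> (\<Sum>B\<in>?S. real (Sz A (v B)))"
          using v(2) by (intro sum_mono) auto
        also have "\<dots> = real (\<Sum>B\<in>?S. Sz A (v B))" by simp
        also have "(\<Sum>B\<in>?S. Sz A (v B)) = card (\<Union>B\<in>?S. reach (slot_edge ` A) (v B))"
        proof (rule card_UN_disjoint[symmetric, OF finS])
          show "\<forall>B\<in>?S. finite (reach (slot_edge ` A) (v B))"
            using AT by (auto intro!: full.finite_reach_ed)
          show "\<forall>B\<in>?S. \<forall>B'\<in>?S. B \<noteq> B' \<longrightarrow> reach (slot_edge ` A) (v B) \<inter> reach (slot_edge ` A) (v B') = {}"
          proof (intro ballI impI)
            fix B B' assume "B \<in> ?S" "B' \<in> ?S" "B \<noteq> B'"
            then have "reach (slot_edge ` A) (v B) \<subseteq> B" "reach (slot_edge ` A) (v B') \<subseteq> B'" "B \<inter> B' = {}"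
              using v(3)[of B] v(3)[of B'] SB(4)[of B B'] by simp_all
            then show "reach (slot_edge ` A) (v B) \<inter> reach (slot_edge ` A) (v B') = {}" by blast
          qed
        qed
        also have "\<dots> \<le> Sz (A \<union> T) (v B0)"
        proof (rule card_mono)
          show "finite (reach (slot_edge ` (A \<union> T)) (v B0))" by (rule full.finite_reach_ed[OF AT])
          have "reach (slot_edge ` A) (v B) \<subseteq> reach (slot_edge ` (A \<union> T)) (v B0)" if "?c B T" for B
            using reach_mono[OF image_mono, of A "A \<union> T" slot_edge "v B"] reach_eq[OF that] by auto
          then show "(\<Union>B\<in>?S. reach (slot_edge ` A) (v B)) \<subseteq> reach (slot_edge ` (A \<union> T)) (v B0)" by auto
        qed
        also have "Sz (A \<union> T) (v B0) \<le> full.largest (A \<union> T)"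
          using full.largest_ge_iff[OF AT] vV[OF B0(1)] by blast
        finally show ?thesis by simp
      qed
      have conn: "\<theta> \<le> bexp top (sp \<beta>) (\<lambda>T. of_bool (?c B T))" if B: "B \<in> ?G" for B
      proof (cases "B = B0")
        case True
        then show ?thesis using \<theta> fin by (simp add: bexp_const)
      next
        case False
        let ?X = "reach (slot_edge ` A) (v B)" and ?Y = "reach (slot_edge ` A) (v B0)"
        have CB: "?X \<subseteq> B" "?Y \<subseteq> B0" using v(3)[of B] v(3)[of B0] B B0(1) by simp_all
        have CV: "?X \<subseteq> V" "?Y \<subseteq> V" using CB SB(3)[of B] SB(3)[of B0] B B0(1) by simp_all
        have "B \<inter> B0 = {}" using SB(4)[of B B0] False B B0(1) by simp
        then have dis: "?X \<inter> ?Y = {}" using CB by blast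
        \<comment> \<open>All top slots between the two clusters; disjointness of the clusters makes
          them distinct, so there are at least a^2 of them.\<close>
        define W where "W = (\<lambda>(x, y). (Suc n, V, {x, y})) ` (?X \<times> ?Y)"
        have "inj_on (\<lambda>(x, y). (Suc n, V, {x, y})) (?X \<times> ?Y)"
        proof (rule inj_onI, clarify)
          fix x y x' y' assume "x \<in> ?X" "y' \<in> ?Y" "{x, y} = {x', y'}"
          moreover from this dis have "x \<noteq> y'" by blast
          ultimately show "x = x' \<and> y = y'" by (simp add: doubleton_eq_iff)
        qed
        then have cardW: "card W = Sz A (v B) * Sz A (v B0)"
          unfolding W_def by (simp add: card_image card_cartesian_product)
        have Wtop: "W \<subseteq> top"
        proof -
          have "(Suc n, V, {x, y}) \<in> top" if "x \<in> ?X" "y \<in> ?Y" for x y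
          proof -
            have "x \<noteq> y" "{x, y} \<subseteq> V" using that CV dis by blast+
            then show ?thesis unfolding top_def top_slots_def V_def[symmetric] by (intro imageI) simp
          qed
          then show ?thesis by (auto simp only: W_def)
        qed
        have open_conn: "?c B T" if "T \<inter> W \<noteq> {}" for T
        proof -
          from that obtain x y where xy: "x \<in> ?X" "y \<in> ?Y" "(Suc n, V, {x, y}) \<in> T" by (auto simp: W_def)
          let ?R = "\<lambda>z. reach (slot_edge ` (A \<union> T)) z"
          have up: "reach (slot_edge ` A) z \<subseteq> ?R z" for z by (intro reach_mono image_mono) auto
          have "slot_edge (Suc n, V, {x, y}) = {y, x}" by (auto simp: slot_edge_def)
          then have "{y, x} \<in> slot_edge ` (A \<union> T)" using xy(3) by (metis UnI2 imageI)
          moreover have "y \<in> ?R (v B0)" using up xy(2) by (rule subsetD)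
          ultimately have "x \<in> ?R (v B0)" by (rule reach_step[rotated])
          moreover have "x \<in> ?R (v B)" using up xy(1) by (rule subsetD)
          then have "v B \<in> ?R x" by (rule reach_sym)
          ultimately show ?thesis by (rule reach_trans)
        qed
        have "a * a \<le> real (Sz A (v B)) * real (Sz A (v B0))"
          using B B0 v(2)[of B] v(2)[of B0] a by (intro mult_mono) auto
        then have "exp (- (\<tau> * real (card W))) \<le> exp (- (\<tau> * a\<^sup>2))"
          using \<tau> by (simp add: cardW power2_eq_square mult_left_mono)
        moreover have "(\<Prod>s\<in>W. 1 - sp \<beta> s) = (\<Prod>s\<in>W. exp (- \<tau>))"
          using Wtop by (intro prod.cong refl) (auto simp: top_def top_slots_def sp_eq \<tau>_def top_rate_def)
        moreover have "(\<Prod>s\<in>W. exp (- \<tau>)) = exp (- (\<tau> * real (card W)))"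
          by (simp add: exp_of_nat_mult[symmetric] mult.commute)
        ultimately have "bexp top (sp \<beta>) (\<lambda>T. of_bool (T \<inter> W = {})) \<le> exp (- (\<tau> * a\<^sup>2))"
          using bexp_none_open[OF fin(2) Wtop, of "sp \<beta>"] by simp
        then have "\<theta> \<le> bexp top (sp \<beta>) (\<lambda>T. 1 - of_bool (T \<inter> W = {}))"
          using fin by (simp add: \<theta>_def bexp_diff bexp_const)
        also have "\<dots> \<le> bexp top (sp \<beta>) (\<lambda>T. of_bool (?c B T))"
          using sp_bounds \<beta> open_conn by (intro bexp_mono) (auto simp: of_bool_def)
        finally show ?thesis .
      qed
      have "\<theta> * (\<Sum>B\<in>?G. real (D B A)) = (\<Sum>B\<in>?G. real (D B A) * \<theta>)"
        by (simp add: sum_distrib_left mult.commute)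
      also have "\<dots> \<le> (\<Sum>B\<in>?G. real (D B A) * bexp top (sp \<beta>) (\<lambda>T. of_bool (?c B T)))"
        by (intro sum_mono mult_left_mono conn) auto
      also have "\<dots> = bexp top (sp \<beta>) (\<lambda>T. \<Sum>B\<in>?G. real (D B A) * of_bool (?c B T))"
        by (simp only: bexp_sum bexp_cmult)
      also have "\<dots> \<le> bexp top (sp \<beta>) (\<lambda>T. real (max_cluster_size V (slot_edge ` (A \<union> T))))"
        using sp_bounds \<beta> by (intro bexp_mono merged) auto
      finally show ?thesis .
    qed
  qed
  have mean: "bexp low (sp \<beta>) (\<lambda>A. real (D B A)) = mean_largest n \<beta>" if "B \<in> \<B>" for B
  proof -
    from that obtain x where x: "x \<in> V" "B = Bl n x" by (auto simp: \<B>_def)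
    have "bexp low (sp \<beta>) (\<lambda>A. real (D B A)) = bexp (block_slots n x) (sp \<beta>) (\<lambda>A. real (Mx n x A))"
      unfolding D_def x(2) sl low_def
      by (rule bexp_marginal[OF finite_low_top(1) block_slots_sub_low, where f = "\<lambda>A. real (Mx n x A)"])
         (use x in \<open>simp add: V_def\<close>)
    also have "\<dots> = mean_largest n \<beta>"
      unfolding mean_largest_def by (rule bexp_largest_eq[OF VH[OF x(1)]])
    finally show ?thesis .
  qed
  have "\<theta> * (real (L ^ d) * (mean_largest n \<beta> - a)) = \<theta> * (\<Sum>B\<in>\<B>. mean_largest n \<beta> - a)"
    by (simp add: SB(2))
  also have "(\<Sum>B\<in>\<B>. mean_largest n \<beta> - a) = bexp low (sp \<beta>) (\<lambda>A. \<Sum>B\<in>\<B>. real (D B A) - a)"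
    by (simp add: bexp_sum bexp_diff bexp_const[OF fin(1)] mean)
  also have "\<theta> * \<dots> = bexp low (sp \<beta>) (\<lambda>A. \<theta> * (\<Sum>B\<in>\<B>. real (D B A) - a))" by (simp only: bexp_cmult)
  also have "\<dots> \<le> bexp low (sp \<beta>) (\<lambda>A. bexp top (sp \<beta>) (\<lambda>T. real (max_cluster_size V (slot_edge ` (A \<union> T)))))"
  proof (rule bexp_mono)
    fix A assume A: "A \<subseteq> low"
    \<comment> \<open>Dropping a sub-block below the threshold costs at most
      \<open>a\<close>.\<close>
    have "(\<Sum>B\<in>\<B>. real (D B A) - a) \<le> (\<Sum>B\<in>\<B>. if a \<le> D B A then real (D B A) else 0)"
      using a by (intro sum_mono) auto
    also have "\<dots> = (\<Sum>B\<in>{B \<in> \<B>. a \<le> D B A}. real (D B A))"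
      using SB(1) by (simp add: sum.inter_filter)
    finally show "\<theta> * (\<Sum>B\<in>\<B>. real (D B A) - a) \<le> bexp top (sp \<beta>) (\<lambda>T. real (max_cluster_size V (slot_edge ` (A \<union> T))))"
      using inner[OF A] \<theta>(1) by (meson mult_left_mono order_trans)
  qed (use sp_bounds \<beta> in auto)
  also have "\<dots> = mean_largest (Suc n) \<beta>"
    unfolding mean_largest_def slots V_def[symmetric] by (rule bexp_union[OF fin, symmetric])
  finally show ?thesis by (simp only: \<theta>_def \<tau>_def)
qed

subsection \<open>Local events and infinite clusters\<close>

abbreviation "PP \<beta> \<equiv> hier_perc d L \<alpha> \<beta>"

text \<open>Bridge from the product measure to \<open>bexp\<close>: an event determined by the
  finite set \<open>I\<close> is a finite disjoint union of cylinders, one for each admissible set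
  of open slots.\<close>

lemma local_event:
  assumes \<beta>: "0 \<le> \<beta>" and I: "finite I" "I \<subseteq> slots d L"
  shows "{c \<in> space (PP \<beta>). P {s \<in> I. c s}} \<in> sets (PP \<beta>)" (is ?meas)
    and "measure (PP \<beta>) {c \<in> space (PP \<beta>). P {s \<in> I. c s}} = bexp I (sp \<beta>) (\<lambda>A. of_bool (P A))" (is ?eq)
proof -
  let ?B = "\<lambda>s. measure_pmf (bernoulli_pmf (sp \<beta> s))"
  interpret P: prob_space "PP \<beta>" by (rule prob_space_hier_perc)
  interpret B: product_prob_space ?B "slots d L" by unfold_locales
  define cyl where "cyl A = {c \<in> space (PP \<beta>). \<forall>s\<in>I. c s \<in> {s \<in> A}}" for A
  have cyl_iff: "c \<in> cyl A \<longleftrightarrow> c \<in> space (PP \<beta>) \<and> {s \<in> I. c s} = A" if "A \<subseteq> I" for A c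
    using that by (auto simp: cyl_def)
  have cyl_sets: "cyl A \<in> sets (PP \<beta>)" for A
  proof -
    have "cyl A = space (PP \<beta>) \<inter> (\<Inter>s\<in>I. {c \<in> space (PP \<beta>). c s \<in> {s \<in> A}})" by (auto simp: cyl_def)
    moreover have "{c \<in> space (PP \<beta>). c s \<in> {s \<in> A}} \<in> sets (PP \<beta>)" if "s \<in> I" for s
      unfolding hier_perc_def by (rule sets_Collect_single') (use that I in auto)
    ultimately show ?thesis using I(1) by (cases "I = {}") (auto intro!: sets.Int sets.finite_INT)
  qed
  have cyl_measure: "measure (PP \<beta>) (cyl A) = (\<Prod>i\<in>A. sp \<beta> i) * (\<Prod>i\<in>I - A. 1 - sp \<beta> i)" if A: "A \<subseteq> I" for A
  proof -
    have "emeasure (PP \<beta>) (cyl A) = (\<Prod>s\<in>I. emeasure (?B s) {s \<in> A})"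
      unfolding cyl_def hier_perc_def by (rule B.emeasure_PiM_Collect) (use I in auto)
    also have "\<dots> = (\<Prod>s\<in>I. ennreal (if s \<in> A then sp \<beta> s else 1 - sp \<beta> s))"
      using sp_bounds \<beta> by (intro prod.cong refl) (simp add: emeasure_pmf_single)
    also have "\<dots> = ennreal (\<Prod>s\<in>I. if s \<in> A then sp \<beta> s else 1 - sp \<beta> s)"
      using sp_bounds \<beta> by (intro prod_ennreal) auto
    finally have "measure (PP \<beta>) (cyl A) = (\<Prod>s\<in>I. if s \<in> A then sp \<beta> s else 1 - sp \<beta> s)"
      using sp_bounds \<beta> by (simp add: measure_def prod_nonneg)
    also have "\<dots> = (\<Prod>i\<in>I \<inter> A. sp \<beta> i) * (\<Prod>i\<in>I \<inter> - A. 1 - sp \<beta> i)"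
      using I(1) by (subst prod.If_cases) auto
    also have "I \<inter> A = A" using A by auto
    also have "I \<inter> - A = I - A" by auto
    finally show ?thesis .
  qed
  let ?S = "{A \<in> Pow I. P A}"
  have fin: "finite ?S" using I(1) by simp
  have event: "{c \<in> space (PP \<beta>). P {s \<in> I. c s}} = (\<Union>A\<in>?S. cyl A)"
  proof -
    have "c \<in> (\<Union>A\<in>?S. cyl A) \<longleftrightarrow> c \<in> space (PP \<beta>) \<and> P {s \<in> I. c s}" for c
      using cyl_iff[of _ c] by auto
    then show ?thesis by blast
  qed
  show ?meas unfolding event using fin cyl_sets by (intro sets.finite_UN) auto
  have "measure (PP \<beta>) (\<Union>A\<in>?S. cyl A) = (\<Sum>A\<in>?S. measure (PP \<beta>) (cyl A))"
  proof (rule P.finite_measure_finite_Union[OF fin])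
    show "disjoint_family_on cyl ?S"
      using cyl_iff unfolding disjoint_family_on_def by auto
  qed (use cyl_sets in auto)
  also have "\<dots> = (\<Sum>A\<in>?S. (\<Prod>i\<in>A. sp \<beta> i) * (\<Prod>i\<in>I - A. 1 - sp \<beta> i) * of_bool (P A))"
    using cyl_measure by (intro sum.cong refl) auto
  also have "\<dots> = bexp I (sp \<beta>) (\<lambda>A. of_bool (P A))"
    unfolding bexp_def using I(1) by (intro sum.mono_neutral_left) auto
  finally show ?eq unfolding event .
qed

section \<open>The full cluster as a limit of local clusters\<close>

abbreviation "om n x c \<equiv> {s \<in> block_slots n x. c s}"

lemma reach_om_mono: "x \<in> H \<Longrightarrow> m \<le> n \<Longrightarrow> reach (slot_edge ` om m x c) x \<subseteq> reach (slot_edge ` om n x c) x"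
  using block_slots_mono[of x m n] by (intro reach_mono image_mono) auto

lemma reach_om_subset: "x \<in> H \<Longrightarrow> reach (slot_edge ` om n x c) x \<subseteq> Bl n x"
  using Bl_self[of x n] by (intro reach_subset) (auto dest!: subsetD[OF slot_edge_props(1)])

lemma finite_reach_om: "x \<in> H \<Longrightarrow> finite (reach (slot_edge ` om n x c) x)"
  using finite_subset[OF reach_om_subset finite_Bl] .

text \<open>An open edge at a vertex reached at level \<open>n\<close> has a slot of some level
  \<open>k\<close>, so it is seen at level \<open>max n k\<close>; hence the union over levels is
  closed under open edges.\<close>

lemma cluster_eq_Union:
  assumes x: "x \<in> H"
  shows "cluster H (perc_edges d L c) x = (\<Union>n. reach (slot_edge ` om n x c) x)"
proof -
  let ?U = "\<Union>n. reach (slot_edge ` om n x c) x"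
  have "reach (perc_edges d L c) x \<subseteq> ?U"
  proof (rule reach_least)
    show "x \<in> ?U" by simp
    fix u v assume "u \<in> ?U" and e: "{u, v} \<in> perc_edges d L c"
    then obtain n where u: "u \<in> reach (slot_edge ` om n x c) x" by auto
    obtain k \<Lambda> where s: "(k, \<Lambda>, {u, v}) \<in> slots d L" "c (k, \<Lambda>, {u, v})"
      using e by (auto simp: perc_edges_eq mem_slot_edge_image)
    let ?N = "max n k"
    have u': "u \<in> reach (slot_edge ` om ?N x c) x" using reach_om_mono[OF x, of n ?N c] u by auto
    then have "u \<in> Bl ?N x" using reach_om_subset[OF x] by blast
    then have "block_slots ?N u = block_slots ?N x" by (rule block_slots_cong[OF x])
    moreover have "(k, \<Lambda>, {u, v}) \<in> block_slots ?N u" by (rule slot_in_block_slots[OF s(1)]) auto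
    ultimately have "{u, v} \<in> slot_edge ` om ?N x c" using s(2) by (auto simp: mem_slot_edge_image)
    then have "v \<in> reach (slot_edge ` om ?N x c) x" using u' by (rule reach_step[rotated])
    then show "v \<in> ?U" by blast
  qed
  moreover have "reach (slot_edge ` om n x c) x \<subseteq> reach (perc_edges d L c) x" for n
    unfolding perc_edges_eq using block_slots_subset by (intro reach_mono image_mono) auto
  moreover have "reach (slot_edge ` om n x c) x \<subseteq> H" for n
    using reach_om_subset[OF x] Bl_subset[OF x] by blast
  ultimately show ?thesis unfolding cluster_conv_reach by blast
qed

lemma infinite_cluster_iff:
  assumes x: "x \<in> H"
  shows "infinite (cluster H (perc_edges d L c) x) \<longleftrightarrow> (\<forall>R. \<exists>n. R \<le> Sz (om n x c) x)"
proof
  assume "infinite (cluster H (perc_edges d L c) x)"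
  show "\<forall>R. \<exists>n. R \<le> Sz (om n x c) x"
  proof
    fix R
    obtain B where B: "finite B" "card B = R" "B \<subseteq> cluster H (perc_edges d L c) x"
      using infinite_arbitrarily_large[OF \<open>infinite _\<close>] by blast
    have "\<forall>b\<in>B. \<exists>n. b \<in> reach (slot_edge ` om n x c) x" using B(3) unfolding cluster_eq_Union[OF x] by blast
    from bchoice[OF this] obtain f where f: "\<forall>b\<in>B. b \<in> reach (slot_edge ` om (f b) x c) x" ..
    define N where "N = Max (insert 0 (f ` B))"
    have "B \<subseteq> reach (slot_edge ` om N x c) x"
    proof
      fix b assume b: "b \<in> B"
      have le: "f b \<le> N" unfolding N_def using B(1) b by (intro Max_ge) auto
      show "b \<in> reach (slot_edge ` om N x c) x"
        using reach_om_mono[OF x le] bspec[OF f b] by (rule subsetD)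
    qed
    then have "R \<le> Sz (om N x c) x" unfolding B(2)[symmetric] by (rule card_mono[OF finite_reach_om[OF x]])
    then show "\<exists>n. R \<le> Sz (om n x c) x" ..
  qed
next
  assume R: "\<forall>R. \<exists>n. R \<le> Sz (om n x c) x"
  show "infinite (cluster H (perc_edges d L c) x)"
  proof
    assume fin: "finite (cluster H (perc_edges d L c) x)"
    obtain n where "Suc (card (cluster H (perc_edges d L c) x)) \<le> Sz (om n x c) x" using R by blast
    moreover have "Sz (om n x c) x \<le> card (cluster H (perc_edges d L c) x)"
      using fin by (intro card_mono) (auto simp: cluster_eq_Union[OF x])
    ultimately show False by simp
  qed
qed

definition large_ev :: "real \<Rightarrow> point \<Rightarrow> nat \<Rightarrow> nat \<Rightarrow> (slot \<Rightarrow> bool) set" where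
  "large_ev \<beta> x R n = {c \<in> space (PP \<beta>). R \<le> Sz (om n x c) x}"

lemma large_ev_sets: "0 \<le> \<beta> \<Longrightarrow> x \<in> H \<Longrightarrow> large_ev \<beta> x R n \<in> sets (PP \<beta>)"
  unfolding large_ev_def
  by (rule local_event(1)[where P = "\<lambda>A. R \<le> Sz A x"]) (use finite_block_slots block_slots_subset in auto)

lemma measure_large_ev:
  assumes "0 \<le> \<beta>" "x \<in> H"
  shows "measure (PP \<beta>) (large_ev \<beta> x R n) = bexp (block_slots n org) (sp \<beta>) (\<lambda>A. of_bool (R \<le> Sz A org))"
proof -
  have "measure (PP \<beta>) (large_ev \<beta> x R n) = bexp (block_slots n x) (sp \<beta>) (\<lambda>A. of_bool (R \<le> Sz A x))"
    unfolding large_ev_def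
    by (rule local_event(2)[where P = "\<lambda>A. R \<le> Sz A x"]) (use assms finite_block_slots block_slots_subset in auto)
  also have "\<dots> = bexp (block_slots n org) (sp \<beta>) (\<lambda>A. of_bool (R \<le> Sz A org))"
    using assms(2) by (rule bexp_size_eq)
  finally show ?thesis .
qed

lemma large_ev_incseq: "x \<in> H \<Longrightarrow> incseq (large_ev \<beta> x R)"
  unfolding incseq_def large_ev_def
  using card_mono[OF finite_reach_om reach_om_mono] by (auto intro: order_trans)

text \<open>The event that the cluster of \<open>x\<close> is infinite, expressed by countably many
  local events to make it measurable.\<close>

definition inf_ev :: "real \<Rightarrow> point \<Rightarrow> (slot \<Rightarrow> bool) set" where
  "inf_ev \<beta> x = (\<Inter>R. \<Union>n. large_ev \<beta> x R n)"

lemma inf_ev_sets: "0 \<le> \<beta> \<Longrightarrow> x \<in> H \<Longrightarrow> inf_ev \<beta> x \<in> sets (PP \<beta>)"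
  unfolding inf_ev_def using large_ev_sets by (intro sets.countable_INT sets.countable_UN) auto

lemma prob_infinite_cluster_eq:
  "prob_infinite_cluster d L \<alpha> \<beta> = measure (PP \<beta>) (\<Union>x\<in>H. inf_ev \<beta> x)"
proof -
  have "c \<in> inf_ev \<beta> x \<longleftrightarrow> c \<in> space (PP \<beta>) \<and> infinite (cluster H (perc_edges d L c) x)" if "x \<in> H" for c x
    unfolding infinite_cluster_iff[OF that] by (auto simp: inf_ev_def large_ev_def)
  then have "{c \<in> space (PP \<beta>). \<exists>K\<in>clusters H (perc_edges d L c). infinite K} = (\<Union>x\<in>H. inf_ev \<beta> x)"
    unfolding clusters_def by auto
  then show ?thesis by (simp add: prob_infinite_cluster_def)
qed

text \<open>Markov's inequality bounds the probability of a cluster of size at least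
  \<open>Suc R\<close> by \<open>C / real (Suc R)\<close>, uniformly in the scale. Let
  \<open>R\<close> grow, then take the union over the countably many points.\<close>

lemma prob_infinite_cluster_zero:
  assumes \<beta>: "0 \<le> \<beta>" and bound: "\<And>n. n0 \<le> n \<Longrightarrow> mean_moment 1 n \<beta> \<le> C"
  shows "prob_infinite_cluster d L \<alpha> \<beta> = 0"
proof -
  interpret P: prob_space "PP \<beta>" by (rule prob_space_hier_perc)
  have C: "0 \<le> C" using bound[of n0] mean_moment_ge_1[OF \<beta>, of 1 n0] by simp
  have "measure (PP \<beta>) (inf_ev \<beta> x) = 0" if x: "x \<in> H" for x
  proof -
    have "measure (PP \<beta>) (inf_ev \<beta> x) \<le> C / real (Suc R)" for R
    proof -
      have le: "measure (PP \<beta>) (large_ev \<beta> x (Suc R) n) \<le> C / real (Suc R)" if "n0 \<le> n" for n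
      proof -
        have "real (Suc R) * measure (PP \<beta>) (large_ev \<beta> x (Suc R) n) \<le> mean_moment 1 n \<beta>"
          unfolding measure_large_ev[OF \<beta> x] mean_moment_def bexp_cmult[symmetric]
          using sp_bounds \<beta> by (intro bexp_mono) auto
        then show ?thesis using bound[OF that] by (simp add: field_simps)
      qed
      have "measure (PP \<beta>) (inf_ev \<beta> x) \<le> measure (PP \<beta>) (\<Union>n. large_ev \<beta> x (Suc R) n)"
        using large_ev_sets[OF \<beta> x] by (intro P.finite_measure_mono) (auto simp: inf_ev_def)
      moreover have "(\<lambda>n. measure (PP \<beta>) (large_ev \<beta> x (Suc R) n)) \<longlonglongrightarrow> measure (PP \<beta>) (\<Union>n. large_ev \<beta> x (Suc R) n)"
        using large_ev_sets[OF \<beta> x] by (intro P.finite_Lim_measure_incseq large_ev_incseq[OF x]) auto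
      then have "measure (PP \<beta>) (\<Union>n. large_ev \<beta> x (Suc R) n) \<le> C / real (Suc R)"
        by (rule LIMSEQ_le_const2) (use le in blast)
      ultimately show ?thesis by simp
    qed
    moreover have "(\<lambda>R. C / real (Suc R)) \<longlonglongrightarrow> 0"
      using tendsto_mult_right_zero[OF LIMSEQ_inverse_real_of_nat, of C] by (simp add: divide_inverse)
    ultimately have "measure (PP \<beta>) (inf_ev \<beta> x) \<le> 0" by (intro LIMSEQ_le_const) auto
    then show ?thesis by (simp add: measure_le_0_iff)
  qed
  then have "inf_ev \<beta> x \<in> null_sets (PP \<beta>)" if "x \<in> H" for x
    using that inf_ev_sets[OF \<beta> that] by (intro null_setsI) (simp_all add: P.emeasure_eq_measure)
  then have "(\<Union>x\<in>H. inf_ev \<beta> x) \<in> null_sets (PP \<beta>)"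
    using countable_H by (intro null_sets_UN') auto
  then show ?thesis unfolding prob_infinite_cluster_eq by (simp add: measure_def null_setsD1)
qed

text \<open>The events that size \<open>R\<close> is reached at some scale decrease in
  \<open>R\<close> and keep probability at least \<delta>, hence so does their intersection.\<close>

lemma prob_infinite_cluster_pos:
  assumes \<beta>: "0 \<le> \<beta>" and \<delta>: "0 < \<delta>"
    and large: "\<And>R. \<exists>n. \<delta> \<le> bexp (block_slots n org) (sp \<beta>) (\<lambda>A. of_bool (R \<le> Sz A org))"
  shows "0 < prob_infinite_cluster d L \<alpha> \<beta>"
proof -
  interpret P: prob_space "PP \<beta>" by (rule prob_space_hier_perc)
  note sets = large_ev_sets[OF \<beta> org_in_H]
  let ?U = "\<lambda>R. \<Union>n. large_ev \<beta> org R n"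
  have U: "\<delta> \<le> measure (PP \<beta>) (?U R)" for R
  proof -
    obtain n where "\<delta> \<le> measure (PP \<beta>) (large_ev \<beta> org R n)"
      using large measure_large_ev[OF \<beta> org_in_H] by metis
    also have "\<dots> \<le> measure (PP \<beta>) (?U R)" using sets by (intro P.finite_measure_mono) auto
    finally show ?thesis .
  qed
  have "(\<lambda>R. measure (PP \<beta>) (?U R)) \<longlonglongrightarrow> measure (PP \<beta>) (\<Inter>R. ?U R)"
    using sets by (intro P.finite_Lim_measure_decseq) (auto simp: decseq_def large_ev_def intro: order_trans)
  then have "\<delta> \<le> measure (PP \<beta>) (inf_ev \<beta> org)"
    unfolding inf_ev_def by (rule LIMSEQ_le_const) (use U in auto)
  also have "\<dots> \<le> measure (PP \<beta>) (\<Union>x\<in>H. inf_ev \<beta> x)"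
    using inf_ev_sets[OF \<beta>] org_in_H countable_H by (intro P.finite_measure_mono sets.countable_UN') auto
  finally show ?thesis using \<delta> by (simp add: prob_infinite_cluster_eq)
qed

subsection \<open>Criteria for percolation and for its absence\<close>

text \<open>Either the largest cluster has size at most \<open>\<delta> / 2 * vol n\<close>, or all
  its vertices lie in clusters of size at least \<open>k\<close>. Since every vertex has the law of
  the origin, the mean density becomes a probability at the origin.\<close>

lemma density_bound:
  assumes \<beta>: "0 \<le> \<beta>" and \<delta>: "\<delta> * vol n \<le> mean_largest n \<beta>" and k: "real k \<le> \<delta> / 2 * vol n"
  shows "\<delta> / 2 \<le> bexp (block_slots n org) (sp \<beta>) (\<lambda>A. of_bool (k \<le> Sz A org))"
proof -
  interpret finite_percolation "Bl n org" "block_slots n org" slot_edge "sp \<beta>" by (rule fin_perc[OF org_in_H \<beta>])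
  have "mean_largest n \<beta> \<le> expect (\<lambda>A. \<delta> / 2 * vol n + (\<Sum>x\<in>Bl n org. of_bool (k \<le> Sz A x)))"
    unfolding mean_largest_def
  proof (rule expect_mono)
    fix A assume A: "A \<subseteq> block_slots n org"
    show "real (largest A) \<le> \<delta> / 2 * vol n + (\<Sum>x\<in>Bl n org. of_bool (k \<le> Sz A x))"
    proof (cases "real (largest A) \<le> \<delta> / 2 * vol n")
      case True
      then show ?thesis by (simp add: add_increasing2 sum_nonneg)
    next
      case False
      obtain x where x: "x \<in> Bl n org" "largest A \<le> Sz A x" using largest_ge_iff[OF A] by blast
      then have kx: "k \<le> Sz A x" using False k by linarith
      have "real (largest A) \<le> real (Sz A x)" using x(2) by simp
      also have "\<dots> = (\<Sum>y\<in>reach (slot_edge ` A) x. 1)" by simp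
      also have "\<dots> = (\<Sum>y\<in>reach (slot_edge ` A) x. of_bool (k \<le> Sz A y))"
        using kx by (intro sum.cong refl) (auto dest: reach_eq)
      also have "\<dots> \<le> (\<Sum>y\<in>Bl n org. of_bool (k \<le> Sz A y))"
        using finite_V reach_in_V[OF A x(1)] by (intro sum_mono2) auto
      finally show ?thesis using k by linarith
    qed
  qed
  also have "\<dots> = \<delta> / 2 * vol n + (\<Sum>x\<in>Bl n org. expect (\<lambda>A. of_bool (k \<le> Sz A x)))"
    using finite_I by (simp add: bexp_add bexp_const bexp_sum)
  also have "(\<Sum>x\<in>Bl n org. expect (\<lambda>A. of_bool (k \<le> Sz A x))) = (\<Sum>x\<in>Bl n org. expect (\<lambda>A. of_bool (k \<le> Sz A org)))"
    by (intro sum.cong refl bexp_size_block)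
  also have "\<dots> = vol n * expect (\<lambda>A. of_bool (k \<le> Sz A org))" by (simp add: card_Bl[OF org_in_H])
  finally have "\<delta> / 2 * vol n \<le> expect (\<lambda>A. of_bool (k \<le> Sz A org)) * vol n"
    using \<delta> by (simp add: field_simps)
  then show ?thesis using vol_pos[of n] by simp
qed

lemma mean_largest_ge_1:
  assumes "0 \<le> \<beta>"
  shows "1 \<le> mean_largest n \<beta>"
proof -
  interpret finite_percolation "Bl n org" "block_slots n org" slot_edge "sp \<beta>" by (rule fin_perc[OF org_in_H assms])
  have "1 \<le> largest A" if "A \<subseteq> block_slots n org" for A
    using largest_ge_iff[OF that] size_at_pos[OF that] Bl_self[OF org_in_H] by blast
  then have "expect (\<lambda>A. 1) \<le> mean_largest n \<beta>" unfolding mean_largest_def by (intro expect_mono) auto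
  then show ?thesis using finite_I by (simp add: bexp_const)
qed

text \<open>The cube root of L^(-(d-\<alpha>)). A threshold shrinking like \<rho>^j costs a factor
  \<rho>^(2j) in the number of top edges and still leaves growth like \<rho>^(-j).\<close>

definition "\<rho> = real L powr (- (d - \<alpha>) / 3)"
text \<open>Makes the total loss \<kappa> / (1 - \<rho>) equal to 1/2.\<close>

definition "\<kappa> = (1 - \<rho>) / 2"
text \<open>Chosen so that the lower bound for \<open>?y\<close> in
  \<open>mean_largest_growth\<close> is exactly \<open>1 / \<epsilon>\<close>.\<close>

definition "\<Theta> = 32 * real L powr (d + \<alpha>) / \<kappa> ^ 3"

lemma \<rho>_bounds: "0 < \<rho>" "\<rho> < 1"
  using L1 \<alpha>_less by (auto simp: \<rho>_def powr_less_one)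

lemma \<kappa>_bounds: "0 < \<kappa>" "\<kappa> < 1"
  using \<rho>_bounds by (auto simp: \<kappa>_def)

lemma geometric_loss: "0 \<le> \<kappa> * (\<Sum>i<j. \<rho> ^ i)" "\<kappa> * (\<Sum>i<j. \<rho> ^ i) \<le> 1 / 2"
proof -
  show "0 \<le> \<kappa> * (\<Sum>i<j. \<rho> ^ i)" using \<kappa>_bounds \<rho>_bounds by (simp add: sum_nonneg)
  have "(\<Sum>i<j. \<rho> ^ i) \<le> 1 / (1 - \<rho>)"
    using \<rho>_bounds by (simp add: sum_gp_strict divide_right_mono)
  then have "\<kappa> * (\<Sum>i<j. \<rho> ^ i) \<le> \<kappa> * (1 / (1 - \<rho>))" using \<kappa>_bounds by (intro mult_left_mono) auto
  also have "\<dots> = 1 / 2" using \<rho>_bounds by (simp add: \<kappa>_def field_simps)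
  finally show "\<kappa> * (\<Sum>i<j. \<rho> ^ i) \<le> 1 / 2" .
qed

lemma \<Theta>_pos: "0 < \<Theta>"
  using L1 \<kappa>_bounds by (simp add: \<Theta>_def)

text \<open>Cutting at a fraction \<open>\<epsilon> \<propto> \<rho>\<^sup>j\<close> of the mean loses a summable proportion of the density,
  since the mean number of top edges between two such clusters grows like \<open>\<rho>\<^sup>-\<^sup>3\<^sup>j\<close>.\<close>

lemma mean_largest_growth:
  assumes \<beta>: "0 \<le> \<beta>" and start: "\<Theta> \<le> \<beta> * (mean_largest n \<beta>)\<^sup>2 * real L powr (- (d + \<alpha>) * n)"
  shows "(1 - \<kappa> * (\<Sum>i<j. \<rho> ^ i)) * (mean_largest n \<beta> * real (L ^ d) ^ j) \<le> mean_largest (n + j) \<beta>"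
proof (induction j)
  case (Suc j)
  define \<mu> where "\<mu> = mean_largest (n + j) \<beta>"
  define S where "S = \<kappa> * (\<Sum>i<j. \<rho> ^ i)"
  \<comment> \<open>Half of the loss \<kappa> \<rho>^j allowed at this scale: one \<epsilon> pays
    for the cut at \<open>\<epsilon> * \<mu>\<close>, the other for failed connections, as
    \<open>exp (- ?y) \<le> \<epsilon>\<close>.\<close>
  define \<epsilon> where "\<epsilon> = \<kappa> / 2 * \<rho> ^ j"
  let ?m = "mean_largest n \<beta>" and ?N = "real (L ^ d)"
  have m: "1 \<le> ?m" by (rule mean_largest_ge_1[OF \<beta>])
  have \<rho>j: "0 < \<rho> ^ j" "\<rho> ^ j \<le> 1" using \<rho>_bounds by (auto intro: power_le_one)
  have \<epsilon>: "0 < \<epsilon>" "\<epsilon> < 1" 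
  proof -
    show "0 < \<epsilon>" using \<rho>j \<kappa>_bounds by (simp add: \<epsilon>_def)
    have "\<epsilon> \<le> \<kappa> / 2 * 1" unfolding \<epsilon>_def using \<rho>j \<kappa>_bounds by (intro mult_left_mono) auto
    then show "\<epsilon> < 1" using \<kappa>_bounds by simp
  qed
  have S: "0 \<le> S" "S \<le> 1 / 2" unfolding S_def by (rule geometric_loss)+
  have IH: "(1 - S) * (?m * ?N ^ j) \<le> \<mu>" using Suc.IH by (simp add: \<mu>_def S_def)
  have half: "?m * ?N ^ j / 2 \<le> \<mu>"
  proof -
    have "1 / 2 * (?m * ?N ^ j) \<le> (1 - S) * (?m * ?N ^ j)" using S m by (intro mult_right_mono) auto
    then show ?thesis using IH by simp
  qed
  let ?y = "top_rate (n + j) \<beta> * (\<epsilon> * \<mu>)\<^sup>2"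
  have y: "1 / \<epsilon> \<le> ?y"
  proof -
    have scale: "real L powr (- (d + \<alpha>) * Suc (n + j)) * (?N ^ j)\<^sup>2
        = real L powr (- (d + \<alpha>) * n) * real L powr (- (d + \<alpha>)) / (\<rho> ^ j * \<rho> ^ j * \<rho> ^ j)"
    proof -
      have "?N ^ j = real L powr (real d * j)"
        using L1 by (simp add: powr_realpow[symmetric] powr_powr)
      moreover have "\<rho> ^ j * \<rho> ^ j * \<rho> ^ j = real L powr (- (d - \<alpha>) * j)"
      proof -
        let ?e = "- (d - \<alpha>) / 3 * j"
        have "\<rho> ^ j = real L powr ?e"
          unfolding \<rho>_def using L1 by (simp add: powr_powr powr_realpow[symmetric])
        then have "\<rho> ^ j * \<rho> ^ j * \<rho> ^ j = real L powr (?e + ?e + ?e)" by (simp only: powr_add)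
        also have "?e + ?e + ?e = - (d - \<alpha>) * j" by (simp add: field_simps)
        finally show ?thesis .
      qed
      ultimately show ?thesis
        using L1 by (simp add: power2_eq_square powr_add[symmetric] powr_diff[symmetric] algebra_simps)
    qed
    have "real L powr (d + \<alpha>) * real L powr (- (d + \<alpha>)) = 1"
      using L1 by (simp only: powr_add[symmetric]) simp
    then have T: "\<Theta> * real L powr (- (d + \<alpha>)) = 32 / \<kappa> ^ 3"
      unfolding \<Theta>_def by (metis (no_types, opaque_lifting) mult.assoc mult.right_neutral times_divide_eq_left)
    have "1 / \<epsilon> = 2 / (\<kappa> * \<rho> ^ j)" by (simp add: \<epsilon>_def)
    also have "\<dots> = \<Theta> * real L powr (- (d + \<alpha>)) * (\<epsilon>\<^sup>2 / 4) / (\<rho> ^ j * \<rho> ^ j * \<rho> ^ j)"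
      unfolding T using \<kappa>_bounds \<rho>j by (simp add: \<epsilon>_def power2_eq_square power3_eq_cube field_simps)
    also have "\<dots> \<le> \<beta> * ?m\<^sup>2 * real L powr (- (d + \<alpha>) * n) * real L powr (- (d + \<alpha>)) * (\<epsilon>\<^sup>2 / 4) / (\<rho> ^ j * \<rho> ^ j * \<rho> ^ j)"
      using start \<rho>j by (intro divide_right_mono mult_right_mono) auto
    also have "\<dots> = \<beta> * (real L powr (- (d + \<alpha>) * Suc (n + j)) * (?N ^ j)\<^sup>2) * ?m\<^sup>2 * (\<epsilon>\<^sup>2 / 4)"
      unfolding scale by (simp add: mult_ac)
    also have "\<dots> = top_rate (n + j) \<beta> * (\<epsilon> * (?m * ?N ^ j / 2))\<^sup>2"
      by (simp add: top_rate_def power_mult_distrib power_divide)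
    also have "\<dots> \<le> ?y"
      using half \<epsilon> m top_rate_nonneg[OF \<beta>] by (intro mult_left_mono power_mono) auto
    finally show ?thesis .
  qed
  have "exp (- ?y) \<le> \<epsilon>"
  proof -
    have "0 < ?y" using y \<epsilon> by (smt (verit) divide_pos_pos)
    moreover have "?y \<le> exp ?y" using exp_ge_add_one_self[of ?y] by linarith
    ultimately have "exp (- ?y) \<le> 1 / ?y" by (simp add: exp_minus inverse_eq_divide frac_le)
    also have "\<dots> \<le> \<epsilon>" using y \<epsilon> \<open>0 < ?y\<close> by (simp add: field_simps)
    finally show ?thesis .
  qed
  have \<mu>: "0 \<le> \<mu>" using mean_largest_ge_1[OF \<beta>, of "n + j"] by (simp add: \<mu>_def)
  have "(1 - \<kappa> * (\<Sum>i<Suc j. \<rho> ^ i)) = 1 - S - 2 * \<epsilon>" by (simp add: S_def \<epsilon>_def algebra_simps)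
  also have "\<dots> \<le> (1 - S) * ((1 - \<epsilon>) * (1 - \<epsilon>))"
  proof -
    have "(1 - S) * ((1 - \<epsilon>) * (1 - \<epsilon>)) - (1 - S - 2 * \<epsilon>) = 2 * S * \<epsilon> + (1 - S) * (\<epsilon> * \<epsilon>)"
      by (simp add: algebra_simps)
    moreover have "0 \<le> 2 * S * \<epsilon> + (1 - S) * (\<epsilon> * \<epsilon>)" using S \<epsilon> by simp
    ultimately show ?thesis by linarith
  qed
  finally have "(1 - \<kappa> * (\<Sum>i<Suc j. \<rho> ^ i)) * (?m * ?N ^ Suc j) \<le> (1 - S) * ((1 - \<epsilon>) * (1 - \<epsilon>)) * (?m * ?N ^ Suc j)"
    using m by (intro mult_right_mono) auto
  also have "\<dots> = (1 - \<epsilon>) * (?N * ((1 - \<epsilon>) * ((1 - S) * (?m * ?N ^ j))))" by (simp add: algebra_simps)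
  also have "\<dots> \<le> (1 - \<epsilon>) * (?N * ((1 - \<epsilon>) * \<mu>))"
    using IH \<epsilon> by (intro mult_left_mono) auto
  also have "\<dots> = (1 - \<epsilon>) * (?N * (\<mu> - \<epsilon> * \<mu>))" by (simp add: algebra_simps)
  also have "\<dots> \<le> (1 - exp (- ?y)) * (?N * (\<mu> - \<epsilon> * \<mu>))"
  proof (rule mult_right_mono)
    have "\<mu> - \<epsilon> * \<mu> = (1 - \<epsilon>) * \<mu>" by (simp add: algebra_simps)
    then show "0 \<le> ?N * (\<mu> - \<epsilon> * \<mu>)" using \<epsilon> \<mu> by simp
  qed (use \<open>exp (- ?y) \<le> \<epsilon>\<close> in simp)
  also have "\<dots> \<le> mean_largest (n + Suc j) \<beta>"
    using mean_largest_step[OF \<beta>, of "\<epsilon> * \<mu>" "n + j"] \<epsilon> \<mu> by (simp add: \<mu>_def)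
  finally show ?case .
qed simp

text \<open>By \<open>mean_largest_growth\<close> at least half of the initial density survives on
  all later scales, so \<open>density_bound\<close> gives the origin arbitrarily large clusters with
  probability bounded below.\<close>

lemma percolation_criterion:
  assumes \<beta>: "0 \<le> \<beta>" and start: "\<Theta> \<le> \<beta> * (mean_largest n \<beta>)\<^sup>2 * real L powr (- (d + \<alpha>) * n)"
  shows "0 < prob_infinite_cluster d L \<alpha> \<beta>"
proof -
  define \<delta> where "\<delta> = mean_largest n \<beta> / (2 * vol n)"
  have m: "1 \<le> mean_largest n \<beta>" by (rule mean_largest_ge_1[OF \<beta>])
  have \<delta>: "0 < \<delta>" using m vol_pos[of n] by (simp add: \<delta>_def)
  have dens: "\<delta> * vol (n + j) \<le> mean_largest (n + j) \<beta>" for j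
  proof -
    have "1 / 2 * (mean_largest n \<beta> * real (L ^ d) ^ j)
        \<le> (1 - \<kappa> * (\<Sum>i<j. \<rho> ^ i)) * (mean_largest n \<beta> * real (L ^ d) ^ j)"
      using m geometric_loss(2)[of j] by (intro mult_right_mono) auto
    also have "\<dots> \<le> mean_largest (n + j) \<beta>" by (rule mean_largest_growth[OF assms])
    also have "1 / 2 * (mean_largest n \<beta> * real (L ^ d) ^ j) = \<delta> * vol (n + j)"
      using L by (simp add: \<delta>_def power_add power_mult distrib_left)
    finally show ?thesis .
  qed
  show ?thesis
  proof (rule prob_infinite_cluster_pos[OF \<beta>])
    show "0 < \<delta> / 2" using \<delta> by simp
    fix R :: nat
    have Ld: "1 < real L ^ d" using L1 d by (simp add: one_less_power)
    obtain j where "real R / (\<delta> / 2) < (real L ^ d) ^ j" using real_arch_pow[OF Ld] by blast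
    then have "real R \<le> \<delta> / 2 * (real L ^ d) ^ j" using \<delta> by (simp add: field_simps)
    also have "(real L ^ d) ^ j \<le> vol (n + j)"
      using L1 by (simp add: power_mult[symmetric] power_increasing)
    finally have "real R \<le> \<delta> / 2 * vol (n + j)" using \<delta> by simp
    from density_bound[OF \<beta> dens this]
    show "\<exists>n. \<delta> / 2 \<le> bexp (block_slots n org) (sp \<beta>) (\<lambda>A. of_bool (R \<le> Sz A org))" by blast
  qed
qed

text \<open>The reciprocal of E|K| drops by at most \<beta> L^(-\<alpha>(m+1)) from scale
  \<open>m\<close> to the next, in total by at most \<beta> L^(-\<alpha>n) / (L^\<alpha> - 1) after
  scale \<open>n\<close>. The hypothesis keeps it above a positive constant.\<close>

lemma susceptibility_criterion:
  assumes \<beta>: "0 \<le> \<beta>" and small: "\<beta> * mean_moment 1 n \<beta> * real L powr (- \<alpha> * n) < real L powr \<alpha> - 1"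
  shows "prob_infinite_cluster d L \<alpha> \<beta> = 0"
proof -
  let ?z = "\<lambda>m. 1 / mean_moment 1 m \<beta>" and ?h = "real L powr \<alpha> - 1"
  have h: "0 < ?h" using L1 \<alpha>_pos by simp
  have pm: "1 \<le> mean_moment 1 m \<beta>" for m by (rule mean_moment_ge_1[OF \<beta>])
  have step: "?z m - \<beta> * real L powr (- \<alpha> * Suc m) \<le> ?z (Suc m)" for m
  proof -
    let ?v = "vol (Suc m)"
    have rate: "?v * top_rate m \<beta> = \<beta> * real L powr (- \<alpha> * Suc m)"
    proof -
      have "?v = real L powr real (d * Suc m)" using L1 by (subst powr_realpow) auto
      then show ?thesis using L1 by (simp add: top_rate_def powr_add[symmetric] algebra_simps)
    qed
    have "?v * (1 / (?v * mean_moment 1 m \<beta>) - top_rate m \<beta>) \<le> ?v * (1 / (?v * mean_moment 1 (Suc m) \<beta>))"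
      using vol_pos[of "Suc m"] by (intro mult_left_mono susceptibility_upper[OF \<beta>]) auto
    then show ?thesis using L rate by (simp add: right_diff_distrib)
  qed
  have low: "?z n - \<beta> / ?h * (real L powr (- \<alpha> * n) - real L powr (- \<alpha> * (n + j))) \<le> ?z (n + j)" for j
  proof (induction j)
    case (Suc j)
    have "real L powr (- \<alpha> * (n + j)) = real L powr \<alpha> * real L powr (- \<alpha> * Suc (n + j))"
      using L1 by (simp add: powr_add[symmetric] algebra_simps)
    then have "\<beta> / ?h * (real L powr (- \<alpha> * (n + j)) - real L powr (- \<alpha> * Suc (n + j)))
        = \<beta> * real L powr (- \<alpha> * Suc (n + j))"
      using h by (simp add: field_simps)
    then have "?z n - \<beta> / ?h * (real L powr (- \<alpha> * n) - real L powr (- \<alpha> * Suc (n + j)))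
        = ?z n - \<beta> / ?h * (real L powr (- \<alpha> * n) - real L powr (- \<alpha> * (n + j))) - \<beta> * real L powr (- \<alpha> * Suc (n + j))"
      by (simp add: right_diff_distrib)
    then show ?case using Suc.IH step[of "n + j"] by simp
  qed simp
  define \<delta> where "\<delta> = ?z n - \<beta> / ?h * real L powr (- \<alpha> * n)"
  have "\<beta> / ?h * real L powr (- \<alpha> * n) < ?z n" using small h pm[of n] by (simp add: field_simps)
  then have \<delta>: "0 < \<delta>" by (simp add: \<delta>_def)
  show ?thesis
  proof (rule prob_infinite_cluster_zero[OF \<beta>])
    fix m assume "n \<le> m"
    then obtain j where m: "m = n + j" using le_Suc_ex by blast
    have "0 \<le> \<beta> / ?h * real L powr (- \<alpha> * (n + j))" using \<beta> h by simp
    then have "\<delta> \<le> ?z m" using low[of j] unfolding m \<delta>_def right_diff_distrib by linarith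
    then show "mean_moment 1 m \<beta> \<le> 1 / \<delta>" using \<delta> pm[of m] by (simp add: field_simps)
  qed
qed

subsection \<open>Bounds at the critical point\<close>

lemma continuous_bexp_sp:
  assumes "x \<in> H"
  shows "continuous_on S (\<lambda>\<beta>. bexp (block_slots n x) (sp \<beta>) f)"
proof (rule continuous_bexp[OF finite_block_slots[OF assms]])
  fix s :: slot
  show "continuous_on S (\<lambda>\<beta>. sp \<beta> s)"
    by (cases s) (auto simp: sp_eq intro!: continuous_intros)
qed

abbreviation "bc \<equiv> beta_c d L \<alpha>"
abbreviation "PS \<equiv> {\<beta>. 0 \<le> \<beta> \<and> prob_infinite_cluster d L \<alpha> \<beta> > 0}"

text \<open>At \<beta> = \<Theta> the percolation criterion holds already on scale 0, because
  clusters have at least one vertex. This makes the infimum \<open>bc\<close> meaningful.\<close>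

lemma PS_nonempty: "PS \<noteq> {}"
proof -
  have "\<Theta> * 1 \<le> \<Theta> * (mean_largest 0 \<Theta>)\<^sup>2"
    using \<Theta>_pos mean_largest_ge_1[of \<Theta> 0] by (intro mult_left_mono one_le_power) auto
  then have "\<Theta> \<in> PS" using \<Theta>_pos L1 percolation_criterion[of \<Theta> 0] by simp
  then show ?thesis by blast
qed

lemma bc_le: "\<beta> \<in> PS \<Longrightarrow> bc \<le> \<beta>"
  unfolding beta_c_def by (rule cInf_lower) (auto intro!: bdd_belowI[of _ 0])

lemma bc_nonneg: "0 \<le> bc"
  unfolding beta_c_def using PS_nonempty by (intro cInf_greatest) auto

text \<open>By continuity in \<beta>, a strict violation at \<open>bc\<close> would persist slightly
  below it, where \<open>percolation_criterion\<close> contradicts the infimum.\<close>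

lemma critical_largest: "bc * (mean_largest n bc)\<^sup>2 * real L powr (- (d + \<alpha>) * n) \<le> \<Theta>"
proof (rule ccontr)
  let ?h = "\<lambda>\<beta>. \<beta> * (mean_largest n \<beta>)\<^sup>2 * real L powr (- (d + \<alpha>) * n)"
  assume "\<not> ?thesis"
  then have gt: "\<Theta> < ?h bc" by simp
  then have pos: "0 < bc" using bc_nonneg \<Theta>_pos by (cases "bc = 0") auto
  have "continuous_on UNIV ?h"
    unfolding mean_largest_def by (intro continuous_intros continuous_bexp_sp org_in_H)
  then have "isCont ?h bc" by (simp add: continuous_on_eq_continuous_at)
  then have "\<forall>\<^sub>F \<beta> in at_left bc. \<Theta> < ?h \<beta>"
    using gt by (auto simp: isCont_def filterlim_at_split intro: order_tendstoD(1))
  then obtain b where b: "b < bc" "\<And>\<beta>. b < \<beta> \<Longrightarrow> \<beta> < bc \<Longrightarrow> \<Theta> < ?h \<beta>"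
    unfolding eventually_at_left_field by blast
  obtain \<beta> where "max b 0 < \<beta>" "\<beta> < bc" using dense[of "max b 0" bc] b(1) pos by auto
  then have "\<Theta> < ?h \<beta>" "0 < \<beta>" "\<beta> < bc" using b(2) by auto
  then show False using percolation_criterion[of \<beta> n] bc_le[of \<beta>] by auto
qed

text \<open>A strict violation would persist slightly above \<open>bc\<close>, but some \<beta>
  there, or \<open>bc\<close> itself, percolates.\<close>

lemma critical_susceptibility: "real L powr \<alpha> - 1 \<le> bc * mean_moment 1 n bc * real L powr (- \<alpha> * n)"
proof (rule ccontr)
  let ?h = "\<lambda>\<beta>. \<beta> * mean_moment 1 n \<beta> * real L powr (- \<alpha> * n)"
  assume "\<not> ?thesis"
  then have lt: "?h bc < real L powr \<alpha> - 1" by simp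
  have "continuous_on UNIV ?h"
    unfolding mean_moment_def by (intro continuous_intros continuous_bexp_sp org_in_H)
  then have "isCont ?h bc" by (simp add: continuous_on_eq_continuous_at)
  then have "\<forall>\<^sub>F \<beta> in at_right bc. ?h \<beta> < real L powr \<alpha> - 1"
    using lt by (auto simp: isCont_def filterlim_at_split intro: order_tendstoD(2))
  then obtain b where b: "bc < b" "\<And>\<beta>. bc < \<beta> \<Longrightarrow> \<beta> < b \<Longrightarrow> ?h \<beta> < real L powr \<alpha> - 1"
    unfolding eventually_at_right_field by blast
  obtain \<beta> where \<beta>: "\<beta> \<in> PS" "\<beta> < b"
    using cInf_lessD[OF PS_nonempty, of b] b(1) unfolding beta_c_def by blast
  have "?h \<beta> < real L powr \<alpha> - 1" using b(2)[OF _ \<beta>(2)] lt bc_le[OF \<beta>(1)] by (cases "\<beta> = bc") auto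
  then show False using susceptibility_criterion[of \<beta> n] \<beta>(1) by simp
qed

subsection \<open>The typical size of the largest cluster\<close>

abbreviation "tm \<equiv> typical_max d L \<alpha>"

lemma largest_event_prob:
  "measure (PP bc) {c \<in> space (PP bc). m \<le> max_cluster_size (origin_block d L n) (eta_edges d L n c)} = prob_largest n m bc"
  unfolding prob_largest_def eta_edges_eq origin_block_def
  by (rule local_event(2)[where P = "\<lambda>A. m \<le> Mx n org A"])
     (use bc_nonneg finite_block_slots[OF org_in_H] block_slots_subset in auto)

lemma typical_max_eq: "tm n = (LEAST m. prob_largest n m bc \<le> exp (- 1))"
  unfolding typical_max_def largest_event_prob ..

text \<open>The largest cluster never exceeds the volume, so the least \<open>m\<close> exists. Size
  1 is reached with certainty, so \<open>tm n - 1\<close> is a true predecessor and minimality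
  applies to it.\<close>

lemma typical_max:
  shows "prob_largest n (tm n) bc \<le> exp (- 1)" and "2 \<le> tm n" and "exp (- 1) < prob_largest n (tm n - 1) bc"
proof -
  interpret finite_percolation "Bl n org" "block_slots n org" slot_edge "sp bc" by (rule fin_perc[OF org_in_H bc_nonneg])
  have "largest A < Suc (L ^ (d * n))" if A: "A \<subseteq> block_slots n org" for A
  proof -
    obtain x where "x \<in> Bl n org" "largest A \<le> size_at A x" using largest_ge_iff[OF A] by blast
    then show ?thesis using size_at_le[OF A] by (fastforce simp: card_Bl[OF org_in_H])
  qed
  then have "prob_largest n (Suc (L ^ (d * n))) bc = expect (\<lambda>A. 0)"
    unfolding prob_largest_def by (intro bexp_cong) (auto simp: not_le)
  then have "prob_largest n (Suc (L ^ (d * n))) bc \<le> exp (- 1)" by (simp add: bexp_const finite_I)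
  then show small: "prob_largest n (tm n) bc \<le> exp (- 1)" unfolding typical_max_eq by (rule LeastI)
  have "1 \<le> largest A" if "A \<subseteq> block_slots n org" for A
    using largest_ge_iff[OF that] size_at_pos[OF that] Bl_self[OF org_in_H] by blast
  then have "prob_largest n m bc = expect (\<lambda>A. 1)" if "m \<le> 1" for m
    unfolding prob_largest_def using that by (intro bexp_cong) (auto intro: order_trans)
  then have one: "prob_largest n m bc = 1" if "m \<le> 1" for m using that by (simp add: bexp_const finite_I)
  show two: "2 \<le> tm n"
  proof (rule ccontr)
    assume "\<not> 2 \<le> tm n"
    then have "prob_largest n (tm n) bc = 1" by (intro one) simp
    then show False using small by simp
  qed
  have "\<not> prob_largest n (tm n - 1) bc \<le> exp (- 1)"
    using not_less_Least[of "tm n - 1" "\<lambda>m. prob_largest n m bc \<le> exp (- 1)"] two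
    unfolding typical_max_eq[symmetric] by simp
  then show "exp (- 1) < prob_largest n (tm n - 1) bc" by simp
qed

lemma typical_max_pred: "real (tm n) / 2 \<le> real (tm n - 1)"
  using typical_max(2)[of n] by (simp add: of_nat_diff)

lemma bc_pos: "0 < bc"
proof -
  have "0 < real L powr \<alpha> - 1" using L1 \<alpha>_pos by simp
  also have "\<dots> \<le> bc * mean_moment 1 0 bc * real L powr (- \<alpha> * 0)" using critical_susceptibility[of 0] by simp
  finally show ?thesis using bc_nonneg by (cases "bc = 0") auto
qed

section \<open>Upper bounds at criticality\<close>

lemma scale_sq: "(real L powr ((d + \<alpha>) / 2 * real n))\<^sup>2 = real L powr ((d + \<alpha>) * real n)"
proof -
  have "(d + \<alpha>) / 2 * real n + (d + \<alpha>) / 2 * real n = (d + \<alpha>) * real n" by (simp add: field_simps)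
  then show ?thesis by (simp only: power2_eq_square powr_add[symmetric])
qed

lemma top_rate_scale: "top_rate n \<beta> = \<beta> / (real L powr ((d + \<alpha>) / 2 * Suc n))\<^sup>2"
  unfolding scale_sq top_rate_def mult_minus_left powr_minus_divide by simp

lemma typical_max_upper:
  "\<exists>C>0. \<forall>n. real (tm n) \<le> C * real L powr ((d + \<alpha>) / 2 * n)"
proof (intro exI conjI allI)
  \<comment> \<open>The factors come from \<open>tm n \<le> 2 * (tm n - 1)\<close>, from the level
    \<open>exp (- 1)\<close> in Markov's inequality, and from
    \<open>critical_largest\<close>.\<close>
  let ?C = "2 * exp 1 * sqrt (\<Theta> / bc)"
  show "0 < ?C" using \<Theta>_pos bc_pos by simp
  fix n :: nat
  let ?r = "real L powr ((d + \<alpha>) / 2 * n)"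
  have sq: "real L powr (- (d + \<alpha>) * n) = 1 / ?r\<^sup>2"
    unfolding scale_sq mult_minus_left powr_minus_divide ..
  have r: "0 < ?r" using L1 by simp
  have "bc * (mean_largest n bc)\<^sup>2 \<le> \<Theta> * ?r\<^sup>2"
    using critical_largest[of n] r unfolding sq by (simp add: field_simps)
  then have "(mean_largest n bc)\<^sup>2 \<le> \<Theta> / bc * ?r\<^sup>2" using bc_pos by (simp add: field_simps)
  also have "\<dots> = (sqrt (\<Theta> / bc) * ?r)\<^sup>2" using \<Theta>_pos bc_pos by (simp add: power_mult_distrib)
  finally have mean: "mean_largest n bc \<le> sqrt (\<Theta> / bc) * ?r"
    by (rule power2_le_imp_le) (use \<Theta>_pos bc_pos in simp)
  have "real (tm n - 1) * exp (- 1) \<le> real (tm n - 1) * prob_largest n (tm n - 1) bc"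
    using typical_max(3)[of n] by (intro mult_left_mono) auto
  also have "\<dots> \<le> mean_largest n bc" by (rule largest_Markov[OF bc_nonneg])
  finally have "real (tm n - 1) \<le> exp 1 * mean_largest n bc"
    by (simp add: exp_minus field_simps)
  also have "\<dots> \<le> exp 1 * (sqrt (\<Theta> / bc) * ?r)" using mean by (rule mult_left_mono) simp
  finally have "real (tm n - 1) \<le> exp 1 * (sqrt (\<Theta> / bc) * ?r)" .
  then show "real (tm n) \<le> ?C * ?r" using typical_max_pred[of n] by simp
qed

text \<open>By \<open>typical_max_upper\<close> the square of \<open>tm (Suc n)\<close> times
  \<open>top_rate n bc\<close> is bounded, so both terms of the maximum in
  \<open>susceptibility_bound\<close> are bounded by constants.\<close>

lemma critical_susceptibility_upper:
  "\<exists>C>0. \<forall>n. mean_moment 1 n bc \<le> C * real L powr (\<alpha> * n)"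
proof -
  obtain C1 where C1: "0 < C1" "\<And>n. real (tm n) \<le> C1 * real L powr ((d + \<alpha>) / 2 * n)"
    using typical_max_upper by blast
  define C2 where "C2 = max 2 (2 * 131220 * C1\<^sup>2 * bc)"
  have "mean_moment 1 n bc \<le> C2 * real L powr \<alpha> / bc * real L powr (\<alpha> * n)" for n
  proof -
    let ?M = "real (tm (Suc n))" and ?r = "real L powr ((d + \<alpha>) / 2 * Suc n)"
    note rate = top_rate_scale[of n bc]
    have vrate: "top_rate n bc * vol (Suc n) = bc * (real L powr (- \<alpha>) * real L powr (- (\<alpha> * n)))"
    proof -
      have "vol (Suc n) = real L powr real (d * Suc n)" using L1 by (subst powr_realpow) auto
      then show ?thesis using L1 by (simp add: top_rate_def powr_add[symmetric] algebra_simps)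
    qed
    have "?M\<^sup>2 * top_rate n bc \<le> (C1 * ?r)\<^sup>2 * top_rate n bc"
      using C1(2)[of "Suc n"] top_rate_nonneg[OF bc_nonneg] by (intro mult_right_mono power_mono) auto
    also have "\<dots> = C1\<^sup>2 * bc" using L1 by (simp add: rate power_mult_distrib)
    finally have "2 * (131220 * ?M\<^sup>2) * top_rate n bc \<le> 2 * 131220 * C1\<^sup>2 * bc" by simp
    then have "max 2 (2 * (131220 * ?M\<^sup>2) * top_rate n bc) \<le> C2"
      unfolding C2_def by (rule max.mono[OF order_refl])
    moreover have "1 \<le> tm (Suc n)" using typical_max(2)[of "Suc n"] by simp
    ultimately have "top_rate n bc * (vol (Suc n) * mean_moment 1 n bc) \<le> C2"
      using susceptibility_bound[OF bc_nonneg _ typical_max(1), of n] by (meson order_trans)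
    then have "bc * (real L powr (- \<alpha>) * real L powr (- (\<alpha> * n))) * mean_moment 1 n bc \<le> C2"
      by (simp only: vrate[symmetric] mult.assoc)
    then show ?thesis using bc_pos L1 by (simp add: powr_minus field_simps)
  qed
  moreover have "0 < C2 * real L powr \<alpha> / bc" using bc_pos L1 by (simp add: C2_def max_def)
  ultimately show ?thesis by blast
qed

section \<open>The lower bound for d < 3 \<alpha>\<close>

context
  assumes low_dim: "real d < 3 * \<alpha>"
begin

text \<open>The gap between the exponents 3\<alpha> and (d + 3\<alpha>) / 2 compared in the lower
  bound.\<close>

definition "\<gamma> = (3 * \<alpha> - d) / 2"

text \<open>In the mean-field regime of small clusters the ratio \<open>E(|K|\<^sup>2) / (E|K|)\<^sup>3\<close> would stay constant,
  whereas at criticality it is at most of order \<open>L\<^sup>-\<^sup>\<gamma>\<^sup>n\<close>.\<close>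

definition "ratio n = mean_moment 2 n bc / mean_moment 1 n bc ^ 3 * real L powr (\<gamma> * n)"

lemma \<gamma>_pos: "0 < \<gamma>"
  using low_dim by (simp add: \<gamma>_def)

lemma ratio_pos: "0 < ratio n"
  using mean_moment_ge_1[OF bc_nonneg, of 1 n] mean_moment_ge_1[OF bc_nonneg, of 2 n] L1
  unfolding ratio_def by (intro mult_pos_pos divide_pos_pos zero_less_power) auto

text \<open>If the largest cluster is small, \<open>moment_ratio_step\<close> loses at most a factor
  L^(-\<gamma>), which the weight in \<open>ratio\<close> regains in one scale.\<close>

lemma ratio_step:
  "\<exists>\<epsilon>>0. \<forall>n. real (tm (Suc n)) \<le> \<epsilon> * real L powr ((d + \<alpha>) / 2 * Suc n) \<longrightarrow> ratio n \<le> ratio (Suc n)"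
proof (intro exI conjI allI impI)
  \<comment> \<open>Solves 3 * 131220 * bc * \<epsilon>^2 = \<gamma> ln L, so the exponential loss
    is exactly L^(-\<gamma>) at the threshold.\<close>
  let ?\<epsilon> = "sqrt (\<gamma> * ln (real L) / (3 * 131220 * bc))"
  have arg: "0 < \<gamma> * ln (real L) / (3 * 131220 * bc)" using \<gamma>_pos L1 bc_pos by simp
  then show "0 < ?\<epsilon>" by simp
  fix n :: nat
  let ?M = "real (tm (Suc n))" and ?r = "real L powr ((d + \<alpha>) / 2 * Suc n)"
  assume M: "?M \<le> ?\<epsilon> * ?r"
  note rate = top_rate_scale[of n bc]
  have "?M\<^sup>2 * top_rate n bc \<le> (?\<epsilon> * ?r)\<^sup>2 * top_rate n bc"
    using M top_rate_nonneg[OF bc_nonneg] by (intro mult_right_mono power_mono) auto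
  also have "\<dots> = ?\<epsilon>\<^sup>2 * bc" using L1 by (simp add: rate power_mult_distrib)
  also have "\<dots> = \<gamma> * ln (real L) / (3 * 131220)" using arg bc_pos by simp
  finally have "3 * (131220 * ?M\<^sup>2) * top_rate n bc \<le> \<gamma> * ln (real L)" by simp
  then have "exp (- (\<gamma> * ln (real L))) \<le> exp (- (3 * (131220 * ?M\<^sup>2) * top_rate n bc))" by simp
  moreover have "exp (- (\<gamma> * ln (real L))) = real L powr (- \<gamma>)" using L1 by (simp add: powr_def)
  ultimately have E: "real L powr (- \<gamma>) \<le> exp (- (3 * (131220 * ?M\<^sup>2) * top_rate n bc))" by simp
  let ?R = "\<lambda>n. mean_moment 2 n bc / mean_moment 1 n bc ^ 3"
  have R: "0 \<le> ?R n" using mean_moment_ge_1[OF bc_nonneg, of 1 n] mean_moment_ge_1[OF bc_nonneg, of 2 n]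
    by (intro divide_nonneg_nonneg zero_le_power) auto
  have "real L powr (- \<gamma>) * ?R n \<le> exp (- (3 * (131220 * ?M\<^sup>2) * top_rate n bc)) * ?R n"
    using E R by (rule mult_right_mono)
  also have "\<dots> \<le> ?R (Suc n)"
    using typical_max(2)[of "Suc n"] by (intro moment_ratio_step[OF bc_nonneg _ typical_max(1)]) simp
  finally have "real L powr (- \<gamma>) * ?R n * real L powr (\<gamma> * Suc n) \<le> ?R (Suc n) * real L powr (\<gamma> * Suc n)"
    by (intro mult_right_mono) auto
  moreover have "real L powr (- \<gamma>) * ?R n * real L powr (\<gamma> * Suc n) = ?R n * (real L powr (- \<gamma>) * real L powr (\<gamma> * Suc n))"
    by (simp only: mult_ac)
  moreover have "real L powr (- \<gamma>) * real L powr (\<gamma> * Suc n) = real L powr (\<gamma> * n)"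
    by (simp add: powr_add[symmetric] algebra_simps)
  ultimately show "ratio n \<le> ratio (Suc n)" by (simp only: ratio_def)
qed

text \<open>A largest cluster of order r = L^((d+\<alpha>)n/2) forces the second moment up to order
  r^3 / L^(dn). Divided by the cubed susceptibility, at most of order L^(3\<alpha>n), this leaves
  L^(-\<gamma>n).\<close>

lemma ratio_large:
  assumes "0 < \<epsilon>"
  shows "\<exists>c>0. \<forall>n. \<epsilon> * real L powr ((d + \<alpha>) / 2 * n) \<le> real (tm n) \<longrightarrow> c \<le> ratio n"
proof -
  obtain C where C: "0 < C" "\<And>n. mean_moment 1 n bc \<le> C * real L powr (\<alpha> * n)"
    using critical_susceptibility_upper by blast
  show ?thesis
  proof (intro exI conjI allI impI)
    let ?c = "(\<epsilon> / 2) ^ 3 * exp (- 1) / C ^ 3"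
    show "0 < ?c" using assms C(1) by simp
    fix n :: nat
    let ?r = "real L powr ((d + \<alpha>) / 2 * n)"
    assume M: "\<epsilon> * ?r \<le> real (tm n)"
    have v: "vol n = real L powr (real d * n)" using L1 by (simp add: powr_realpow[symmetric])
    have e: "?r ^ 3 * real L powr (\<gamma> * n) = vol n * (real L powr (\<alpha> * n)) ^ 3"
    proof -
      let ?a = "(d + \<alpha>) / 2 * real n"
      have "?a + ?a + ?a + \<gamma> * n = real d * n + (\<alpha> * n + \<alpha> * n + \<alpha> * n)"
        by (simp add: \<gamma>_def field_simps)
      then show ?thesis unfolding v by (simp only: power3_eq_cube powr_add[symmetric])
    qed
    have "(\<epsilon> / 2 * ?r) ^ 3 * exp (- 1) \<le> real (tm n - 1) ^ 3 * exp (- 1)"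
      using M typical_max_pred[of n] assms by (intro mult_right_mono power_mono) auto
    also have "\<dots> \<le> real (tm n - 1) ^ 3 * prob_largest n (tm n - 1) bc"
      using typical_max(3)[of n] by (intro mult_left_mono) auto
    also have "\<dots> \<le> vol n * mean_moment 2 n bc" by (rule second_moment_lower[OF bc_nonneg])
    finally have two: "(\<epsilon> / 2 * ?r) ^ 3 * exp (- 1) \<le> vol n * mean_moment 2 n bc" .
    have one: "mean_moment 1 n bc ^ 3 \<le> C ^ 3 * (real L powr (\<alpha> * n)) ^ 3"
      using C(2)[of n] mean_moment_ge_1[OF bc_nonneg, of 1 n]
      by (simp only: power_mult_distrib[symmetric], intro power_mono) auto
    have pos: "0 < mean_moment 1 n bc ^ 3" using mean_moment_ge_1[OF bc_nonneg, of 1 n] by simp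
    have "vol n * (?c * mean_moment 1 n bc ^ 3) \<le> vol n * (?c * (C ^ 3 * (real L powr (\<alpha> * n)) ^ 3))"
      using one assms C(1) vol_pos[of n] by (intro mult_left_mono) auto
    also have "\<dots> = (\<epsilon> / 2) ^ 3 * exp (- 1) * (vol n * (real L powr (\<alpha> * n)) ^ 3)" using C(1) by simp
    also have "\<dots> = (\<epsilon> / 2 * ?r) ^ 3 * exp (- 1) * real L powr (\<gamma> * n)"
      unfolding e[symmetric] by (simp only: power_mult_distrib mult_ac)
    also have "\<dots> \<le> vol n * mean_moment 2 n bc * real L powr (\<gamma> * n)"
      using two by (intro mult_right_mono) auto
    finally have "vol n * (?c * mean_moment 1 n bc ^ 3) \<le> vol n * (mean_moment 2 n bc * real L powr (\<gamma> * n))"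
      by (simp only: mult.assoc)
    then have "?c * mean_moment 1 n bc ^ 3 \<le> mean_moment 2 n bc * real L powr (\<gamma> * n)"
      using vol_pos[of n] by (simp only: mult_le_cancel_left_pos)
    then have "?c \<le> mean_moment 2 n bc * real L powr (\<gamma> * n) / mean_moment 1 n bc ^ 3"
      using pos by (simp only: pos_le_divide_eq)
    then show "?c \<le> ratio n" by (simp add: ratio_def)
  qed
qed

text \<open>Induction over scales: at each one either the largest cluster is small and the ratio
  does not decrease, or it is large and the ratio is bounded below directly.\<close>

lemma ratio_bounded_below: "\<exists>c>0. \<forall>n. c \<le> ratio n"
proof -
  obtain \<epsilon> where \<epsilon>: "0 < \<epsilon>"
    "\<And>n. real (tm (Suc n)) \<le> \<epsilon> * real L powr ((d + \<alpha>) / 2 * Suc n) \<Longrightarrow> ratio n \<le> ratio (Suc n)"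
    using ratio_step by blast
  obtain c where c: "0 < c" "\<And>n. \<epsilon> * real L powr ((d + \<alpha>) / 2 * n) \<le> real (tm n) \<Longrightarrow> c \<le> ratio n"
    using ratio_large[OF \<epsilon>(1)] by blast
  have "min c (ratio 0) \<le> ratio n" for n
  proof (induction n)
    case (Suc n)
    show ?case
    proof (cases "real (tm (Suc n)) \<le> \<epsilon> * real L powr ((d + \<alpha>) / 2 * Suc n)")
      case True
      then show ?thesis using \<epsilon>(2) Suc.IH by fastforce
    next
      case False
      then show ?thesis using c(2)[of "Suc n"] by fastforce
    qed
  qed simp
  then show ?thesis using c(1) ratio_pos[of 0] by (intro exI[of _ "min c (ratio 0)"]) auto
qed

text \<open>Inserting \<open>second_moment_upper\<close> into the bound on \<open>ratio\<close>
  gives c (E|K|)^2 <= 810 \<open>tm n\<close> L^(\<gamma>n), where E|K| is at least of order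
  L^(\<alpha>n); and 2\<alpha> - \<gamma> = (d + \<alpha>) / 2.\<close>

lemma typical_max_lower:
  "\<exists>c>0. \<forall>n. c * real L powr ((d + \<alpha>) / 2 * n) \<le> real (tm n)"
proof -
  obtain c where c: "0 < c" "\<And>n. c \<le> ratio n" using ratio_bounded_below by blast
  define h where "h = (real L powr \<alpha> - 1) / bc"
  have h: "0 < h" using L1 \<alpha>_pos bc_pos by (simp add: h_def)
  show ?thesis
  proof (intro exI conjI allI)
    show "0 < c * h\<^sup>2 / 810" using c(1) h by simp
    fix n :: nat
    let ?m1 = "mean_moment 1 n bc" and ?m2 = "mean_moment 2 n bc"
    have m1: "0 < ?m1" using mean_moment_ge_1[OF bc_nonneg, of 1 n] by linarith
    have "h * real L powr (\<alpha> * n) \<le> ?m1"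
      using critical_susceptibility[of n] bc_pos L1 by (simp add: h_def powr_minus field_simps)
    then have sq: "(h * real L powr (\<alpha> * n))\<^sup>2 \<le> ?m1\<^sup>2" using h by (intro power_mono) auto
    have e: "real L powr ((d + \<alpha>) / 2 * n) * real L powr (\<gamma> * n) = (real L powr (\<alpha> * n))\<^sup>2"
    proof -
      have "(d + \<alpha>) / 2 * n + \<gamma> * n = \<alpha> * n + \<alpha> * n" by (simp add: \<gamma>_def field_simps)
      then show ?thesis by (simp only: power2_eq_square powr_add[symmetric])
    qed
    have "c * ?m1 ^ 3 \<le> ?m2 * real L powr (\<gamma> * n)"
      using c(2)[of n] m1 by (simp add: ratio_def field_simps)
    also have "\<dots> \<le> 810 * real (tm n) * ?m1 * real L powr (\<gamma> * n)"
      using typical_max(2)[of n]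
      by (intro mult_right_mono second_moment_upper[OF bc_nonneg _ typical_max(1)]) auto
    finally have "(c * ?m1\<^sup>2) * ?m1 \<le> (810 * real (tm n) * real L powr (\<gamma> * n)) * ?m1"
      by (simp add: power3_eq_cube power2_eq_square mult_ac)
    then have "c * ?m1\<^sup>2 \<le> 810 * real (tm n) * real L powr (\<gamma> * n)" using m1 by (rule mult_right_le_imp_le)
    moreover have "c * (h * real L powr (\<alpha> * n))\<^sup>2 \<le> c * ?m1\<^sup>2" using sq c(1) by (intro mult_left_mono) auto
    ultimately have "c * h\<^sup>2 * (real L powr ((d + \<alpha>) / 2 * n) * real L powr (\<gamma> * n))
        \<le> 810 * real (tm n) * real L powr (\<gamma> * n)"
      unfolding e by (simp add: power_mult_distrib)
    then have "(c * h\<^sup>2 * real L powr ((d + \<alpha>) / 2 * n)) * real L powr (\<gamma> * n)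
        \<le> (810 * real (tm n)) * real L powr (\<gamma> * n)" by (simp only: mult.assoc)
    then have "c * h\<^sup>2 * real L powr ((d + \<alpha>) / 2 * n) \<le> 810 * real (tm n)"
      by (rule mult_right_le_imp_le) (use L1 in simp)
    then show "c * h\<^sup>2 / 810 * real L powr ((d + \<alpha>) / 2 * n) \<le> real (tm n)" by simp
  qed
qed

end

end

theorem theorem5p1:
  fixes d L :: nat and \<alpha> :: real
  assumes "d \<ge> 1" and "L \<ge> 2"
    and "0 < \<alpha>" and "\<alpha> < real d"
    and "real d < 3 * \<alpha>"
  shows "\<exists>c C :: real. 0 < c \<and> 0 < C \<and>
    (\<forall>n :: nat.
       c * real L powr ((real d + \<alpha>) / 2 * real n) \<le> real (typical_max d L \<alpha> n) \<and>
       real (typical_max d L \<alpha> n) \<le> C * real L powr ((real d + \<alpha>) / 2 * real n))"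
proof -
  interpret hierarchical d L \<alpha> using assms by unfold_locales
  obtain C where "0 < C" "\<And>n. real (tm n) \<le> C * real L powr ((d + \<alpha>) / 2 * n)"
    using typical_max_upper by blast
  moreover obtain c where "0 < c" "\<And>n. c * real L powr ((d + \<alpha>) / 2 * n) \<le> real (tm n)"
    using typical_max_lower[OF assms(5)] by blast
  ultimately show ?thesis by blast
qed

end
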